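(* There is an algorithm that, given a $P_6$-free graph $G$, finds in cubic time, i.e. in time $O(|V(G)|^3)$, a perfect edge dominating set of $G$ of minimum size (cardinality).
   Context: All graphs are finite, undirected, without loops or multiple edges. A graph is $P_6$-free if it has no induced subgraph isomorphic to the path $P_6$ on six vertices. An edge of a graph $G$ dominates itself and every edge sharing an endpoint with it. A perfect edge dominating set of $G$ is a set $P\subseteq E(G)$ such that every edge of $E(G)\setminus P$ is dominated by exactly one edge of $P$. *)

theory Defs
  imports "HOL-Library.Landau_Symbols"
begin

section \<open>Finite simple graphs and perfect edge domination\<close>

record 'a graph =
  verts :: "'a set"
  edges :: "'a set set"

definition simple_graph :: "'a graph \<Rightarrow> bool" where
  "simple_graph G \<longleftrightarrow> finite (verts G) \<and> (\<forall>e\<in>edges G. e \<subseteq> verts G \<and> card e = 2)"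

definition induced_subgraph :: "'a graph \<Rightarrow> 'a set \<Rightarrow> 'a graph" where
  "induced_subgraph G X = \<lparr>verts = X, edges = {e \<in> edges G. e \<subseteq> X}\<rparr>"

definition graph_iso :: "'a graph \<Rightarrow> 'b graph \<Rightarrow> bool" where
  "graph_iso G H \<longleftrightarrow> (\<exists>f. bij_betw f (verts G) (verts H) \<and>
     (\<forall>u\<in>verts G. \<forall>v\<in>verts G. {u, v} \<in> edges G \<longleftrightarrow> {f u, f v} \<in> edges H))"

definition path_graph :: "nat \<Rightarrow> nat graph" where
  "path_graph k = \<lparr>verts = {..<k}, edges = {{i, Suc i} | i. Suc i < k}\<rparr>"

definition P6_free :: "'a graph \<Rightarrow> bool" where
  "P6_free G \<longleftrightarrow> \<not> (\<exists>X\<subseteq>verts G. graph_iso (induced_subgraph G X) (path_graph 6))"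

definition dominates :: "'a set \<Rightarrow> 'a set \<Rightarrow> bool" where
  "dominates e f \<longleftrightarrow> e = f \<or> e \<inter> f \<noteq> {}"

definition perfect_edge_dominating :: "'a graph \<Rightarrow> 'a set set \<Rightarrow> bool" where
  "perfect_edge_dominating G P \<longleftrightarrow>
     P \<subseteq> edges G \<and> (\<forall>f\<in>edges G - P. \<exists>!e. e \<in> P \<and> dominates e f)"

definition minimum_perfect_edge_dominating :: "'a graph \<Rightarrow> 'a set set \<Rightarrow> bool" where
  "minimum_perfect_edge_dominating G P \<longleftrightarrow> perfect_edge_dominating G P \<and>
     (\<forall>Q. perfect_edge_dominating G Q \<longrightarrow> card P \<le> card Q)"

section \<open>Machine model: structured word-RAM programs\<close>

text \<open>
  Algorithms are programs of a fixed deterministic imperative language with natural-number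
  scalars and randomly accessible arrays. Every operator, memory access, test and command
  costs one time unit. As a fixed program mentions only finitely many names, its arrays can be
  interleaved in the single memory of a RAM at constant-factor cost.
\<close>

type_synonym name = string

datatype aexp =
    Const nat
  | Var name
  | Load name aexp
  | Plus aexp aexp
  | Minus aexp aexp
  | Times aexp aexp
  | Div aexp aexp
  | Mod aexp aexp

datatype bexp =
    Less aexp aexp
  | Equal aexp aexp
  | Not bexp
  | And bexp bexp

datatype com =
    Skip
  | Assign name aexp
  | Store name aexp aexp
  | Seq com com
  | If bexp com com
  | While bexp com

record state =
  scalars :: "name \<Rightarrow> nat"
  arrays :: "name \<Rightarrow> nat \<Rightarrow> nat"

text \<open>Subtraction is truncated at zero; division and remainder by zero give
  \<^term>\<open>0::nat\<close> and the dividend.\<close>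

primrec aval :: "aexp \<Rightarrow> state \<Rightarrow> nat" where
  "aval (Const c) s = c"
| "aval (Var x) s = scalars s x"
| "aval (Load A i) s = arrays s A (aval i s)"
| "aval (Plus a b) s = aval a s + aval b s"
| "aval (Minus a b) s = aval a s - aval b s"
| "aval (Times a b) s = aval a s * aval b s"
| "aval (Div a b) s = aval a s div aval b s"
| "aval (Mod a b) s = aval a s mod aval b s"

primrec bval :: "bexp \<Rightarrow> state \<Rightarrow> bool" where
  "bval (Less a b) s \<longleftrightarrow> aval a s < aval b s"
| "bval (Equal a b) s \<longleftrightarrow> aval a s = aval b s"
| "bval (Not p) s \<longleftrightarrow> \<not> bval p s"
| "bval (And p q) s \<longleftrightarrow> bval p s \<and> bval q s"

primrec acost :: "aexp \<Rightarrow> nat" where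
  "acost (Const c) = 1"
| "acost (Var x) = 1"
| "acost (Load A i) = acost i + 1"
| "acost (Plus a b) = acost a + acost b + 1"
| "acost (Minus a b) = acost a + acost b + 1"
| "acost (Times a b) = acost a + acost b + 1"
| "acost (Div a b) = acost a + acost b + 1"
| "acost (Mod a b) = acost a + acost b + 1"

primrec bcost :: "bexp \<Rightarrow> nat" where
  "bcost (Less a b) = acost a + acost b + 1"
| "bcost (Equal a b) = acost a + acost b + 1"
| "bcost (Not p) = bcost p + 1"
| "bcost (And p q) = bcost p + bcost q + 1"

text \<open>
  \<open>exec W c s t s'\<close>: started in \<open>s\<close>, program \<open>c\<close> halts in \<open>s'\<close> after exactly \<open>t\<close> time units,
  and every value and every address it writes is at most \<open>W\<close>. A program that would write
  anything larger has no execution. This is the usual word-size restriction, without which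
  constant-time multiplication would be unrealistically powerful; values occurring inside an
  expression of a fixed program then exceed \<open>W\<close> at most polynomially, so they occupy a
  constant number of words.
\<close>

inductive exec :: "nat \<Rightarrow> com \<Rightarrow> state \<Rightarrow> nat \<Rightarrow> state \<Rightarrow> bool" for W :: nat where
  exec_Skip: "exec W Skip s 1 s"
| exec_Assign: "aval a s \<le> W \<Longrightarrow>
    exec W (Assign x a) s (acost a + 1) (s\<lparr>scalars := (scalars s)(x := aval a s)\<rparr>)"
| exec_Store: "aval i s \<le> W \<Longrightarrow> aval a s \<le> W \<Longrightarrow>
    exec W (Store A i a) s (acost i + acost a + 1)
      (s\<lparr>arrays := (arrays s)(A := (arrays s A)(aval i s := aval a s))\<rparr>)"
| exec_Seq: "exec W c s t s' \<Longrightarrow> exec W d s' t' s'' \<Longrightarrow> exec W (Seq c d) s (t + t' + 1) s''"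
| exec_IfTrue: "bval p s \<Longrightarrow> exec W c s t s' \<Longrightarrow> exec W (If p c d) s (bcost p + t + 1) s'"
| exec_IfFalse: "\<not> bval p s \<Longrightarrow> exec W d s t s' \<Longrightarrow> exec W (If p c d) s (bcost p + t + 1) s'"
| exec_WhileFalse: "\<not> bval p s \<Longrightarrow> exec W (While p c) s (bcost p + 1) s"
| exec_WhileTrue: "bval p s \<Longrightarrow> exec W c s t s' \<Longrightarrow> exec W (While p c) s' t' s'' \<Longrightarrow>
    exec W (While p c) s (bcost p + t + t' + 1) s''"

inductive_cases exec_SkipE: "exec W Skip s t s'"
inductive_cases exec_AssignE: "exec W (Assign x a) s t s'"
inductive_cases exec_StoreE: "exec W (Store A i a) s t s'"
inductive_cases exec_SeqE: "exec W (Seq c d) s t s'"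
inductive_cases exec_IfE: "exec W (If p c d) s t s'"
inductive_cases exec_WhileE: "exec W (While p c) s t s'"

lemma exec_deterministic:
  "exec W c s t s' \<Longrightarrow> exec W c s u r \<Longrightarrow> t = u \<and> s' = r"
proof (induction arbitrary: u r rule: exec.induct)
  case exec_Skip then show ?case by (auto elim: exec_SkipE)
next
  case exec_Assign then show ?case by (auto elim: exec_AssignE)
next
  case exec_Store then show ?case by (auto elim: exec_StoreE)
next
  case exec_Seq
  from exec_Seq.prems show ?case
    by (rule exec_SeqE) (auto dest!: exec_Seq.IH)
next
  case exec_IfTrue
  from exec_IfTrue.prems exec_IfTrue.hyps show ?case
    by - (erule exec_IfE, auto dest!: exec_IfTrue.IH)
next
  case exec_IfFalse
  from exec_IfFalse.prems exec_IfFalse.hyps show ?case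
    by - (erule exec_IfE, auto dest!: exec_IfFalse.IH)
next
  case exec_WhileFalse
  from exec_WhileFalse.prems exec_WhileFalse.hyps show ?case
    by - (erule exec_WhileE, auto)
next
  case exec_WhileTrue
  from exec_WhileTrue.prems exec_WhileTrue.hyps show ?case
    by - (erule exec_WhileE, auto dest!: exec_WhileTrue.IH)
qed

section \<open>Input and output\<close>

text \<open>Sets of edges on the vertices \<open>0, \<dots>, n - 1\<close> are passed as row-major 0/1 adjacency
  matrices. All scalars and array cells not holding the input are initially zero.\<close>

definition adj_matrix :: "nat \<Rightarrow> nat set set \<Rightarrow> nat \<Rightarrow> nat" where
  "adj_matrix n F k = (if k < n * n \<and> {k div n, k mod n} \<in> F then 1 else 0)"

definition input_state :: "nat graph \<Rightarrow> state" where
  "input_state G =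
     \<lparr>scalars = (\<lambda>_. 0)(''n'' := card (verts G)),
      arrays = (\<lambda>_ _. 0)(''adj'' := adj_matrix (card (verts G)) (edges G))\<rparr>"

definition outputs_edge_set :: "nat \<Rightarrow> state \<Rightarrow> nat set set \<Rightarrow> bool" where
  "outputs_edge_set n s P \<longleftrightarrow> (\<forall>k<n * n. arrays s ''out'' k = adj_matrix n P k)"

end

theory Submission
  imports Defs
begin

text \<open>
  Let \<open>P\<close> be a perfect edge dominating set, and call a vertex white if no edge of \<open>P\<close> ends in it.
  White vertices are pairwise nonadjacent, since nothing would dominate an edge between two of them.
  Every edge without a white end belongs to \<open>P\<close>, since otherwise it would be dominated by two different
  edges, one at each end. And a nonwhite vertex with a white neighbour has exactly one nonwhite
  neighbour. Conversely, an independent set \<open>W\<close> with the last property is the set of white vertices of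
  the perfect edge dominating set of all edges that avoid \<open>W\<close> (\<open>peds_uncovered\<close>, \<open>peds_valid\<close>). So in
  each connected component \<open>H\<close> separately one looks for a white set \<open>W\<close> that is avoided by as few
  edges as possible.

  Call a nonwhite vertex black if it has two nonwhite neighbours; it then has no white neighbour.
  Absence of induced six-vertex paths determines the shape of \<open>H\<close> in each of three cases.

  \<^item> Two adjacent black vertices lie in a component \<open>D\<close> of \<open>H - W\<close>. Then every white vertex is adjacent
  to \<open>D\<close>, and the other components of \<open>H - W\<close> are single edges whose two ends have the same white
  neighbours (\<open>outside_twin\<close>, \<open>white_near\<close>). A vertex of \<open>D\<close> with a white neighbour is a leaf of \<open>D\<close>;
  call its neighbour in \<open>D\<close> its parent. If a white vertex \<open>w\<close> is adjacent to two leaves with adjacent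
  parents, then \<open>w\<close> alone determines \<open>W\<close> (\<open>parents_adjacent\<close>). Otherwise all parents of such leaves have
  a common black neighbour \<open>c\<close> (\<open>common_core\<close>), and \<open>W\<close> is contained in a white set that is determined
  by \<open>c\<close> (\<open>common_core_subset\<close>).

  \<^item> There is a black vertex \<open>d\<close>, but no two black vertices are adjacent. Then \<open>d\<close> and its neighbours
  form a component of \<open>H - W\<close>.

  \<^item> There is no black vertex. Then, unless \<open>H\<close> is a single vertex, the components of \<open>H - W\<close> are single
  edges, and one of them can be found among linearly many pairs of vertices (\<open>pairs_improve\<close>).

  In the last two cases one component \<open>D\<close> of \<open>H - W\<close> is known. Vertices at distance one from \<open>D\<close> are
  white, those at distance two are not, and the only vertices with an open colour have distance three.
  Each vertex at distance two that has no neighbour at distance two needs exactly one nonwhite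
  neighbour at distance three; giving it one of largest degree is consistent and yields a white set
  of the same cost as \<open>W\<close> (\<open>PK_exact\<close>, \<open>around_block_valid\<close>, \<open>around_block_cost\<close>).

  Hence \<open>n\<close> guesses of a vertex, with nine candidates for each guess, contain for every component a
  candidate that is as good as the best white set (\<open>some_candidate_improves\<close>). A candidate is computed,
  tested and compared in a bounded number of passes, each of which sums or maximises over all \<open>j\<close> for
  every \<open>i\<close> and so takes quadratic time; closures need only four rounds, because an induced path has at
  most five vertices (\<open>spread4_closed\<close>). Such passes form a small language of vector operations, whose
  compilation is verified once (\<open>compile_op_exec\<close>), so that the algorithm itself is analysed as a
  sequence of array equations (\<open>update_ops_sem\<close>, \<open>body_ops_sem\<close>).
\<close>

section \<open>White sets and components\<close>

text \<open>
  Connectedness is stated as a closure property: whatever contains one vertex of \<open>H\<close> and is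
  closed within \<open>H\<close> contains all of \<open>H\<close>. Arguments about connectedness then need
  no paths.
\<close>
definition graph_component :: "('a \<Rightarrow> 'a \<Rightarrow> bool) \<Rightarrow> 'a set \<Rightarrow> bool" where
  "graph_component r H \<longleftrightarrow> finite H \<and> H \<noteq> {} \<and> (\<forall>v\<in>H. \<forall>u. r v u \<longrightarrow> u \<in> H) \<and>
     (\<forall>S. (\<exists>v\<in>H. v \<in> S) \<longrightarrow> (\<forall>v\<in>S \<inter> H. \<forall>u. r v u \<longrightarrow> u \<in> S) \<longrightarrow> H \<subseteq> S)"

lemma graph_component_closed: "graph_component r H \<Longrightarrow> v \<in> H \<Longrightarrow> r v u \<Longrightarrow> u \<in> H"
  unfolding graph_component_def by blast

lemma graph_component_connected:
  assumes "graph_component r H" "v \<in> H" "v \<in> S"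
    and "\<And>v u. v \<in> S \<Longrightarrow> v \<in> H \<Longrightarrow> r v u \<Longrightarrow> u \<in> S"
  shows "H \<subseteq> S"
  using assms unfolding graph_component_def by blast

lemma graph_component_reachable:
  assumes sym: "\<And>u v. r u v \<Longrightarrow> r v u" and fin: "finite {v. r\<^sup>*\<^sup>* a v}"
  shows "graph_component r {v. r\<^sup>*\<^sup>* a v}"
proof -
  have rev: "r\<^sup>*\<^sup>* v u" if "r\<^sup>*\<^sup>* u v" for u v
    using that by (induction) (auto intro: converse_rtranclp_into_rtranclp sym)
  have "{v. r\<^sup>*\<^sup>* a v} \<subseteq> S"
    if v: "r\<^sup>*\<^sup>* a v" "v \<in> S" and cl: "\<forall>v\<in>S \<inter> {v. r\<^sup>*\<^sup>* a v}. \<forall>u. r v u \<longrightarrow> u \<in> S" for S v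
  proof
    fix u assume "u \<in> {v. r\<^sup>*\<^sup>* a v}"
    then have "r\<^sup>*\<^sup>* v u" using rev[OF v(1)] by auto
    then have "u \<in> S \<and> r\<^sup>*\<^sup>* a u"
      by induction (use v cl in \<open>auto intro: rtranclp.rtrancl_into_rtrancl\<close>)
    then show "u \<in> S" by simp
  qed
  then show ?thesis using fin unfolding graph_component_def
    by (auto intro: rtranclp.rtrancl_into_rtrancl)
qed

text \<open>
  These are the sets of vertices of \<open>H\<close> that a perfect edge dominating set leaves uncovered.
\<close>
definition white_set_on :: "('a \<Rightarrow> 'a \<Rightarrow> bool) \<Rightarrow> 'a set \<Rightarrow> 'a set \<Rightarrow> bool" where
  "white_set_on adj H W \<longleftrightarrow> W \<subseteq> H \<and> (\<forall>u\<in>W. \<forall>v\<in>W. \<not> adj u v) \<and>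
     (\<forall>v\<in>H - W. (\<exists>w\<in>W. adj v w) \<longrightarrow> (\<exists>!u. adj v u \<and> u \<notin> W))"

text \<open>
  Each edge of \<open>H\<close> that avoids \<open>W\<close> is counted twice, once from either end.
\<close>
definition cost :: "('a \<Rightarrow> 'a \<Rightarrow> bool) \<Rightarrow> 'a set \<Rightarrow> 'a set \<Rightarrow> nat" where
  "cost adj H W = (\<Sum>v\<in>H - W. card {u. adj v u \<and> u \<notin> W})"

definition level1 :: "('a \<Rightarrow> 'a \<Rightarrow> bool) \<Rightarrow> 'a set \<Rightarrow> 'a set" where
  "level1 adj D = {v. v \<notin> D \<and> (\<exists>u\<in>D. adj v u)}"
definition level2 :: "('a \<Rightarrow> 'a \<Rightarrow> bool) \<Rightarrow> 'a set \<Rightarrow> 'a set" where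
  "level2 adj D = {v. v \<notin> D \<and> v \<notin> level1 adj D \<and> (\<exists>u\<in>level1 adj D. adj v u)}"
definition level3 :: "('a \<Rightarrow> 'a \<Rightarrow> bool) \<Rightarrow> 'a set \<Rightarrow> 'a set" where
  "level3 adj D = {v. v \<notin> D \<and> v \<notin> level1 adj D \<and> v \<notin> level2 adj D \<and> (\<exists>u\<in>level2 adj D. adj v u)}"

definition spread :: "('a \<Rightarrow> 'a \<Rightarrow> bool) \<Rightarrow> 'a set \<Rightarrow> 'a set \<Rightarrow> 'a set" where
  "spread adj B S = S \<union> {v. v \<notin> B \<and> (\<exists>u\<in>S. adj v u)}"

text \<open>
  In a graph without induced six-vertex path, four rounds reach everything that is reachable from
  \<open>S\<close> outside \<open>B\<close>; see \<open>spread4_closed\<close> below.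
\<close>
definition spread4 :: "('a \<Rightarrow> 'a \<Rightarrow> bool) \<Rightarrow> 'a set \<Rightarrow> 'a set \<Rightarrow> 'a set" where
  "spread4 adj B S = spread adj B (spread adj B (spread adj B (spread adj B S)))"

text \<open>
  The intended picture is that \<open>B\<close> is nonwhite, level one consists of leaves hanging on
  \<open>B\<close>, level two is white, and level three consists of pairs of adjacent nonwhite vertices. The
  set collects the vertices whose own neighbourhood fits this picture.
\<close>
definition unspoilt :: "('a \<Rightarrow> 'a \<Rightarrow> bool) \<Rightarrow> 'a set \<Rightarrow> 'a set" where
  "unspoilt adj B = {v \<in> level1 adj B. (\<exists>!u. adj v u \<and> u \<in> B) \<and> \<not> (\<exists>u\<in>level1 adj B. adj v u)}
     \<union> {v \<in> level2 adj B. \<not> (\<exists>u\<in>level2 adj B. adj v u)}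
     \<union> {v \<in> level3 adj B. \<exists>!u. adj v u \<and> u \<in> level3 adj B}"

text \<open>
  The guess is that \<open>c\<close> is black and adjacent to the parents of all leaves with a white
  neighbour. A component outside the closed neighbourhood of \<open>c\<close> has white vertices only if all
  of it fits the picture above, so vertices that do not fit spoil their whole component.
\<close>
definition around_core :: "('a \<Rightarrow> 'a \<Rightarrow> bool) \<Rightarrow> 'a \<Rightarrow> 'a set" where
  "around_core adj c = (let B = insert c {v. adj v c} in
     level2 adj B - spread4 adj B (- B - unspoilt adj B))"

text \<open>
  The guess is that \<open>w\<close> is white and adjacent to two leaves with adjacent parents. The vertices
  at distance two are then black or white, and exactly the black ones have neighbours at that distance.
\<close>
definition around_white :: "('a \<Rightarrow> 'a \<Rightarrow> bool) \<Rightarrow> 'a \<Rightarrow> 'a set" where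
  "around_white adj w = insert w {v \<in> level2 adj {w}. \<not> (\<exists>u\<in>level2 adj {w}. adj v u)}"

locale p6free_graph =
  fixes adj :: "'a \<Rightarrow> 'a \<Rightarrow> bool"
  assumes adj_sym: "adj u v \<Longrightarrow> adj v u" and adj_irrefl: "\<not> adj u u"
  and no_P6: "adj a b \<Longrightarrow> adj b c \<Longrightarrow> adj c d \<Longrightarrow> adj d e \<Longrightarrow> adj e f \<Longrightarrow>
    \<not> adj a c \<Longrightarrow> \<not> adj a d \<Longrightarrow> \<not> adj a e \<Longrightarrow> \<not> adj a f \<Longrightarrow> \<not> adj b d \<Longrightarrow> \<not> adj b e \<Longrightarrow> \<not> adj b f \<Longrightarrow>
    \<not> adj c e \<Longrightarrow> \<not> adj c f \<Longrightarrow> \<not> adj d f \<Longrightarrow> False"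
begin

lemma adj_commute: "adj u v \<longleftrightarrow> adj v u" using adj_sym by blast

lemma spread_mono: "S \<subseteq> spread adj B S" unfolding spread_def by blast

text \<open>
  A vertex first reached in a fifth round would end an induced path with one vertex in each of the layers
  zero to five, because an edge outside \<open>B\<close> never skips a layer.
\<close>
lemma spread4_closed:
  assumes "v \<in> spread4 adj B S" "adj v u" "u \<notin> B" "S \<inter> B = {}"
  shows "u \<in> spread4 adj B S"
proof (rule ccontr)
  define S0 S1 S2 S3 S4 where "S0 = S" "S1 = spread adj B S0" "S2 = spread adj B S1"
    "S3 = spread adj B S2" "S4 = spread adj B S3"
  note defs = this
  assume "u \<notin> spread4 adj B S"
  then have u: "u \<notin> S4" and v: "v \<in> S4" using assms unfolding spread4_def defs by auto
  have stepI: "y \<in> spread adj B Z" if "x \<in> Z" "adj x y" "y \<notin> B" for x y Z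
    using that adj_sym unfolding spread_def by blast
  have pred: "\<exists>x\<in>Z. adj y x \<and> y \<notin> B" if "y \<in> spread adj B Z" "y \<notin> Z" for y Z
    using that unfolding spread_def by blast
  have in_spread: "x \<in> spread adj B Z" if "x \<in> Z" for x Z using that spread_mono by blast
  have v4: "v \<notin> S3" using u assms(2,3) stepI unfolding defs by blast
  then obtain x3 where x3: "x3 \<in> S3" "adj v x3" "v \<notin> B" using pred v unfolding defs by blast
  have n3: "x3 \<notin> S2" using v4 x3 stepI adj_sym unfolding defs by blast
  then obtain x2 where x2: "x2 \<in> S2" "adj x3 x2" "x3 \<notin> B" using pred x3 unfolding defs by blast
  have n2: "x2 \<notin> S1" using n3 x2 stepI adj_sym unfolding defs by blast
  then obtain x1 where x1: "x1 \<in> S1" "adj x2 x1" "x2 \<notin> B" using pred x2 unfolding defs by blast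
  have n1: "x1 \<notin> S0" using n2 x1 stepI adj_sym unfolding defs by blast
  then obtain x0 where x0: "x0 \<in> S0" "adj x1 x0" "x1 \<notin> B" using pred x1 unfolding defs by blast
  have up: "S0 \<subseteq> S1" "S1 \<subseteq> S2" "S2 \<subseteq> S3" "S3 \<subseteq> S4" unfolding defs by (auto intro: in_spread)
  have s1: "y \<in> S1" if "x \<in> S0" "adj x y" "y \<notin> B" for x y using that stepI unfolding defs by blast
  have s2: "y \<in> S2" if "x \<in> S1" "adj x y" "y \<notin> B" for x y using that stepI unfolding defs by blast
  have s3: "y \<in> S3" if "x \<in> S2" "adj x y" "y \<notin> B" for x y using that stepI unfolding defs by blast
  have s4: "y \<in> S4" if "x \<in> S3" "adj x y" "y \<notin> B" for x y using that stepI unfolding defs by blast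
  show False
  proof (rule no_P6[of x0 x1 x2 x3 v u])
    show "adj x0 x1" "adj x1 x2" "adj x2 x3" "adj x3 v" "adj v u" using x0 x1 x2 x3 assms adj_sym by auto
    show "\<not> adj x0 x2" using s1 x0 n2 x1 by blast
    show "\<not> adj x0 x3" using s1 x0 n3 x2 up by blast
    show "\<not> adj x0 v" using s1 x0 v4 x3 up by blast
    show "\<not> adj x0 u" using s1 x0 u assms(3) up by blast
    show "\<not> adj x1 x3" using s2 x1 n3 x2 up by blast
    show "\<not> adj x1 v" using s2 x1 v4 x3 up by blast
    show "\<not> adj x1 u" using s2 x1 u assms(3) up by blast
    show "\<not> adj x2 v" using s3 x2 v4 x3 up by blast
    show "\<not> adj x2 u" using s3 x2 u assms(3) up by blast
    show "\<not> adj x3 u" using s4 x3 u assms(3) up by blast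
  qed
qed

lemma spread4_sup: "S \<subseteq> spread4 adj B S"
  unfolding spread4_def using spread_mono by blast

lemma spread4_least:
  assumes "S \<subseteq> Z" "\<And>v u. v \<in> Z \<Longrightarrow> adj v u \<Longrightarrow> u \<notin> B \<Longrightarrow> u \<in> Z"
  shows "spread4 adj B S \<subseteq> Z"
proof -
  have "spread adj B Y \<subseteq> Z" if "Y \<subseteq> Z" for Y
  proof
    fix x assume "x \<in> spread adj B Y"
    then consider "x \<in> Y" | u where "x \<notin> B" "u \<in> Y" "adj x u" unfolding spread_def by blast
    then show "x \<in> Z"
      by cases (use that assms(2) adj_sym in \<open>auto simp: subset_iff\<close>)
  qed
  then show ?thesis unfolding spread4_def using assms(1) by simp
qed

lemma graph_component_spread4:
  assumes fin: "finite (spread4 adj {} {a})"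
  shows "graph_component adj (spread4 adj {} {a})"
  unfolding graph_component_def
proof (intro conjI allI impI ballI)
  let ?H = "spread4 adj {} {a}"
  show "finite ?H" by (rule fin)
  have a: "a \<in> ?H" using spread4_sup[of "{a}" "{}"] by blast
  then show "?H \<noteq> {}" by blast
  have cl_H: "u \<in> ?H" if "v \<in> ?H" "adj v u" for v u by (rule spread4_closed[OF that]) auto
  then show "u \<in> ?H" if "v \<in> ?H" "adj v u" for v u using that .
  fix S assume ex: "\<exists>v\<in>?H. v \<in> S" and cl: "\<forall>v\<in>S \<inter> ?H. \<forall>u. adj v u \<longrightarrow> u \<in> S"
  have "a \<in> S"
  proof (rule ccontr)
    assume aS: "a \<notin> S"
    have "?H \<subseteq> ?H - S"
    proof (rule spread4_least)
      show "{a} \<subseteq> ?H - S" using a aS by simp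
      fix v u assume "v \<in> ?H - S" and vu: "adj v u"
      then have v: "v \<in> ?H" "v \<notin> S" by auto
      have "u \<in> ?H" using cl_H v(1) vu by simp
      moreover have "u \<notin> S" using cl v(2) adj_sym[OF vu] calculation by auto
      ultimately show "u \<in> ?H - S" by simp
    qed
    then show False using ex by auto
  qed
  have "?H \<subseteq> S \<inter> ?H"
  proof (rule spread4_least)
    show "{a} \<subseteq> S \<inter> ?H" using a \<open>a \<in> S\<close> by simp
    fix v u assume "v \<in> S \<inter> ?H" "adj v u"
    then show "u \<in> S \<inter> ?H" using cl cl_H by auto
  qed
  then show "?H \<subseteq> S" by simp
qed

end

locale white_set = p6free_graph adj for adj :: "'a \<Rightarrow> 'a \<Rightarrow> bool" +
  fixes H W :: "'a set"
  assumes comp: "graph_component adj H" and white_W: "white_set_on adj H W"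
begin

lemma closed: "v \<in> H \<Longrightarrow> adj v u \<Longrightarrow> u \<in> H" by (rule graph_component_closed[OF comp])
lemma finite_H: "finite H" using comp unfolding graph_component_def by simp
lemma W_sub: "W \<subseteq> H" using white_W unfolding white_set_on_def by simp
lemma white_indep: "u \<in> W \<Longrightarrow> v \<in> W \<Longrightarrow> \<not> adj u v" using white_W unfolding white_set_on_def by simp
lemma white_nbr: "v \<notin> W \<Longrightarrow> w \<in> W \<Longrightarrow> adj v w \<Longrightarrow> \<exists>!u. adj v u \<and> u \<notin> W"
proof -
  assume a: "v \<notin> W" "w \<in> W" "adj v w"
  have "v \<in> H - W" using closed[of w v] adj_sym[OF a(3)] W_sub a(1,2) by blast
  moreover have "\<forall>v\<in>H - W. (\<exists>w\<in>W. adj v w) \<longrightarrow> (\<exists>!u. adj v u \<and> u \<notin> W)"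
    using white_W unfolding white_set_on_def by simp
  ultimately show ?thesis using a by blast
qed
lemma partner_ex: "v \<notin> W \<Longrightarrow> w \<in> W \<Longrightarrow> adj v w \<Longrightarrow> \<exists>u. adj v u \<and> u \<notin> W"
  using white_nbr by blast
text \<open>
  The nonwhite neighbour of a nonwhite vertex with a white neighbour is called its partner, or its parent
  when the vertex is a leaf of a larger component.
\<close>
lemma partner_unique: "v \<notin> W \<Longrightarrow> w \<in> W \<Longrightarrow> adj v w \<Longrightarrow> adj v a \<Longrightarrow> a \<notin> W \<Longrightarrow> adj v b \<Longrightarrow> b \<notin> W \<Longrightarrow> a = b"
  by (metis white_nbr)

definition black :: "'a \<Rightarrow> bool" where
  "black v \<longleftrightarrow> v \<notin> W \<and> (\<exists>p q. p \<noteq> q \<and> p \<notin> W \<and> q \<notin> W \<and> adj v p \<and> adj v q)"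

lemma blackI: "v \<notin> W \<Longrightarrow> p \<noteq> q \<Longrightarrow> p \<notin> W \<Longrightarrow> q \<notin> W \<Longrightarrow> adj v p \<Longrightarrow> adj v q \<Longrightarrow> black v"
  unfolding black_def by blast

lemma black_white: "black v \<Longrightarrow> w \<in> W \<Longrightarrow> \<not> adj v w \<and> \<not> adj w v"
proof -
  assume a: "black v" "w \<in> W"
  then obtain p q where "v \<notin> W" "p \<noteq> q" "p \<notin> W" "q \<notin> W" "adj v p" "adj v q"
    unfolding black_def by blast
  then have "\<not> adj v w" using partner_unique[of v w p q] a by blast
  then show ?thesis using adj_sym[of w v] by blast
qed

text \<open>
  Components of \<open>H - W\<close> are components of \<open>H\<close> with respect to this relation.
\<close>
definition nadj :: "'a \<Rightarrow> 'a \<Rightarrow> bool" where "nadj u v \<longleftrightarrow> adj u v \<and> u \<notin> W \<and> v \<notin> W"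

lemma nonwhite_component_ex:
  assumes "a \<in> H" "a \<notin> W"
  obtains D where "graph_component nadj D" "a \<in> D" "D \<subseteq> H - W"
proof -
  have sub: "{v. nadj\<^sup>*\<^sup>* a v} \<subseteq> H - W"
  proof safe
    fix v assume "nadj\<^sup>*\<^sup>* a v"
    then have *: "v \<in> H \<and> v \<notin> W" by induction (use assms closed in \<open>auto simp: nadj_def\<close>)
    then show "v \<in> H" by simp
    assume "v \<in> W" then show False using * by simp
  qed
  show thesis
    by (rule that[OF graph_component_reachable _ sub])
      (use adj_sym finite_subset[OF sub] finite_H in \<open>auto simp: nadj_def\<close>)
qed

end

locale black_edge = white_set +
  fixes D :: "'a set" and b1 b2 :: 'a
  assumes comp_D: "graph_component nadj D" and D_sub: "D \<subseteq> H - W"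
    and b: "b1 \<in> D" "b2 \<in> D" "adj b1 b2" "black b1" "black b2"
begin

lemma D_nonwhite: "v \<in> D \<Longrightarrow> v \<notin> W" using D_sub by blast
lemma D_closed: "v \<in> D \<Longrightarrow> adj v u \<Longrightarrow> u \<notin> W \<Longrightarrow> u \<in> D"
  using graph_component_closed[OF comp_D, of v u] D_nonwhite[of v] unfolding nadj_def by blast

lemma D_connected: "v \<in> D \<Longrightarrow> v \<in> S \<Longrightarrow> (\<And>v u. v \<in> S \<Longrightarrow> v \<in> D \<Longrightarrow> adj v u \<Longrightarrow> u \<in> D \<Longrightarrow> u \<in> S) \<Longrightarrow> D \<subseteq> S"
  by (rule graph_component_connected[OF comp_D, of v], assumption, assumption)
    (metis nadj_def D_closed)

text \<open>
  A shortest path in \<open>D\<close> from \<open>d0\<close> to \<open>d\<close> is cut off after three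
  steps. The last conclusion records that its third vertex is \<open>d\<close> or continues, hence is black
  as well when \<open>d\<close> is.
\<close>
lemma D_path:
  assumes "d0 \<in> D" "d \<in> D" "d \<noteq> d0" "\<not> adj d0 d"
  obtains (two) q where "q \<in> D" "adj d0 q" "adj q d"
    | (three) q1 q2 q3 where "q1 \<in> D" "q2 \<in> D" "q3 \<in> D" "adj d0 q1" "adj q1 q2" "adj q2 q3"
        "\<not> adj d0 q2" "\<not> adj d0 q3" "\<not> adj q1 q3" "q2 \<noteq> d0"
        "q3 = d \<or> (\<exists>q4\<in>D. adj q3 q4 \<and> q4 \<noteq> q2)"
proof -
  define N1 where "N1 = {v\<in>D. adj d0 v}"
  define N2 where "N2 = {v\<in>D. v \<noteq> d0 \<and> v \<notin> N1 \<and> (\<exists>u\<in>N1. adj u v)}"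
  define N3 where "N3 = {v\<in>D. v \<noteq> d0 \<and> v \<notin> N1 \<and> v \<notin> N2 \<and> (\<exists>u\<in>N2. adj u v)}"
  have chain: thesis if "q3 \<in> N3" "q3 = d \<or> (\<exists>q4\<in>D. adj q3 q4 \<and> q4 \<notin> N2)" for q3
  proof -
    from that obtain q2 q1 where q: "q2 \<in> N2" "adj q2 q3" "q1 \<in> N1" "adj q1 q2"
      unfolding N3_def N2_def by blast
    have "\<not> adj q1 q3" using that q unfolding N3_def N2_def by blast
    then show thesis using three[of q1 q2 q3] that q unfolding N1_def N2_def N3_def by blast
  qed
  show thesis
  proof (cases "d \<in> N2 \<or> d \<in> N3")
    case True
    then show thesis
    proof
      assume "d \<in> N2" then show thesis using two unfolding N1_def N2_def by blast
    next
      assume "d \<in> N3" then show thesis using chain by blast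
    qed
  next
    case False
    then have "d \<notin> {d0} \<union> N1 \<union> N2 \<union> N3" using assms unfolding N1_def by blast
    then have "\<not> D \<subseteq> {d0} \<union> N1 \<union> N2 \<union> N3" using assms by blast
    then obtain v u where vu: "v \<in> {d0} \<union> N1 \<union> N2 \<union> N3" "v \<in> D" "adj v u" "u \<in> D"
      "u \<notin> {d0} \<union> N1 \<union> N2 \<union> N3"
      using D_connected[of d0 "{d0} \<union> N1 \<union> N2 \<union> N3"] assms(1) by blast
    then have "v \<in> N3" unfolding N1_def N2_def N3_def by blast
    then show thesis using chain vu by blast
  qed
qed

text \<open>
  A vertex of \<open>D\<close> with a white neighbour is a leaf. If its parent \<open>d\<close> had no black
  neighbour, then \<open>d\<close> and its neighbours in \<open>D\<close> would be all of \<open>D\<close>,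
  a star, which has no two adjacent black vertices.
\<close>
lemma leaf_parent:
  assumes "y \<in> D" "w \<in> W" "adj y w"
  shows "\<exists>d c. d \<in> D \<and> c \<in> D \<and> adj y d \<and> adj d c \<and> black d \<and> black c \<and> c \<noteq> y \<and>
    (\<forall>u. adj y u \<longrightarrow> u \<notin> W \<longrightarrow> u = d)"
proof -
  have yW: "y \<notin> W" using D_nonwhite assms by blast
  obtain d where d: "adj y d" "d \<notin> W" using partner_ex[OF yW assms(2,3)] by blast
  have uq: "u = d" if "adj y u" "u \<notin> W" for u using partner_unique[OF yW assms(2,3)] d that by blast
  have dD: "d \<in> D" using D_closed assms d by blast
  have ynb: "\<not> black y" using black_white assms by blast
  have "\<exists>c\<in>D. adj d c \<and> black c"
  proof (rule ccontr)
    assume no: "\<not> (\<exists>c\<in>D. adj d c \<and> black c)"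
    let ?S = "insert d {c \<in> D. adj d c}"
    have "D \<subseteq> ?S"
    proof (rule D_connected[OF dD])
      fix v u assume vu: "v \<in> ?S" "v \<in> D" "adj v u" "u \<in> D"
      show "u \<in> ?S"
      proof (cases "v = d \<or> u = d")
        case False
        then have "adj v d" "adj d v" using vu adj_sym by auto
        then have "black v" using blackI[of v u d] vu False D_nonwhite dD by blast
        then show ?thesis using no vu \<open>adj d v\<close> by blast
      qed (use vu in auto)
    qed simp
    then have "b1 = d" "b2 = d" using b no by blast+
    then show False using b(3) adj_irrefl by blast
  qed
  then obtain c where c: "c \<in> D" "adj d c" "black c" by blast
  have "c \<noteq> y" using c ynb by blast
  then have "black d" using blackI[of d c y] c d assms D_nonwhite dD adj_sym by blast
  then show ?thesis using dD d(1) uq c \<open>c \<noteq> y\<close> by blast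
qed

text \<open>
  Otherwise the path \<open>c, d, y, w, t, s\<close> would be induced, where \<open>d\<close> is the parent
  of \<open>y\<close> and \<open>c\<close> a black neighbour of \<open>d\<close>: black vertices are not
  adjacent to \<open>w\<close>, and \<open>D\<close> has no edges to \<open>t\<close> and \<open>s\<close>.
\<close>
lemma outside_twin:
  assumes y: "y \<in> D" "w \<in> W" "adj y w" and t: "t \<notin> D" "t \<notin> W" "adj t w" and s: "adj t s" "s \<notin> W"
  shows "adj s w" "s \<notin> D"
proof -
  show sD: "s \<notin> D" using s t D_closed[of s t] adj_sym by blast
  obtain d c where d: "d \<in> D" "c \<in> D" "adj y d" "adj d c" "black d" "black c" "c \<noteq> y"
    "\<And>u. adj y u \<Longrightarrow> u \<notin> W \<Longrightarrow> u = d" using leaf_parent[OF y] by blast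
  have nD: "\<not> adj v t" "\<not> adj v s" if "v \<in> D" for v
    using that s t sD D_closed[of v t] D_closed[of v s] by blast+
  have cy: "\<not> adj y c" using d D_nonwhite adj_irrefl by blast
  have "\<not> adj d w" "\<not> adj c w" using black_white d y by blast+
  note ground = this
  show "adj s w"
  proof (rule ccontr)
    assume "\<not> adj s w"
    then show False
      by (intro no_P6[of c d y w t s])
        (use adj_sym[OF d(3)] adj_sym[OF d(4)] y(3) adj_sym[OF t(3)] s(1) cy ground
      nD[OF d(1)] nD[OF d(2)] nD[OF y(1)] adj_commute[of c y] adj_commute[of w s] in simp_all)
  qed
qed

text \<open>
  The vertices of \<open>D\<close>, the white vertices adjacent to \<open>D\<close>, and the remaining
  nonwhite neighbours of the latter are closed under adjacency, so they are all of \<open>H\<close>. The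
  only way to leave this set would be a step from a nonwhite vertex \<open>v\<close> outside
  \<open>D\<close> to a white vertex that is not adjacent to \<open>D\<close>, and this step would end an
  induced path \<open>c, d, y, w, v, u\<close> as in the previous lemma.
\<close>
lemma white_near:
  assumes "w0 \<in> W"
  shows "w \<in> W \<Longrightarrow> \<exists>y\<in>D. adj y w"
    and "v \<in> H \<Longrightarrow> v \<notin> W \<Longrightarrow> v \<notin> D \<Longrightarrow> \<exists>w\<in>W. adj v w"
proof -
  let ?WD = "{w\<in>W. \<exists>y\<in>D. adj y w}"
  let ?T = "{t. t \<notin> W \<and> t \<notin> D \<and> (\<exists>w\<in>?WD. adj t w)}"
  have "H \<subseteq> D \<union> ?WD \<union> ?T"
  proof (rule graph_component_connected[OF comp])
    show "b1 \<in> H" "b1 \<in> D \<union> ?WD \<union> ?T" using b D_sub by auto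
    fix v u assume v: "v \<in> D \<union> ?WD \<union> ?T" "v \<in> H" "adj v u"
    show "u \<in> D \<union> ?WD \<union> ?T"
    proof (rule ccontr)
      assume u: "\<not> ?thesis"
      have vD: "v \<notin> D"
      proof
        assume "v \<in> D"
        then show False using u v D_closed[of v u] by blast
      qed
      have "v \<notin> ?WD"
      proof
        assume vW: "v \<in> ?WD"
        then have "u \<notin> W" using v white_indep[of v u] by blast
        then show False using u v vW adj_sym[of v u] by blast
      qed
      then have vT: "v \<in> ?T" using v vD by blast
      then obtain w y where w: "w \<in> W" "adj v w" "y \<in> D" "adj y w" by blast
      have vW: "v \<notin> W" using vT by blast
      show False
      proof (cases "u \<in> W")
        case False
        have "adj u w" using outside_twin(1)[OF w(3,1,4) vD vW w(2) v(3) False] .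
        then show False using u False w by blast
      next
        case True
        obtain d c where d: "d \<in> D" "c \<in> D" "adj y d" "adj d c" "black d" "black c" "c \<noteq> y"
          "\<And>u. adj y u \<Longrightarrow> u \<notin> W \<Longrightarrow> u = d" using leaf_parent[OF w(3,1,4)] by blast
        have nv: "\<not> adj x v" if "x \<in> D" for x using that vD vW D_closed[of x v] by blast
        have nu: "\<not> adj x u" if "x \<in> D" for x using that u True by blast
        have cy: "\<not> adj y c" using d D_nonwhite adj_irrefl by blast
        have "\<not> adj d w" "\<not> adj c w" "\<not> adj w u" using black_white d w white_indep True by blast+
        then show False
          by (intro no_P6[of c d y w v u]) (use adj_sym[OF d(3)] adj_sym[OF d(4)] w(4) adj_sym[OF w(2)] v(3) cy
            nv[OF d(1)] nv[OF d(2)] nv[OF w(3)] nu[OF d(1)] nu[OF d(2)] nu[OF w(3)] adj_commute[of c y] in simp_all)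
      qed
    qed
  qed
  then show "w \<in> W \<Longrightarrow> \<exists>y\<in>D. adj y w"
    and "v \<in> H \<Longrightarrow> v \<notin> W \<Longrightarrow> v \<notin> D \<Longrightarrow> \<exists>w\<in>W. adj v w"
    using W_sub D_nonwhite by blast+
qed

text \<open>
  Two parents that are neither equal nor adjacent are joined by a shortest path inside \<open>D\<close>.
  Extended by \<open>y0, w0\<close> at one end and by the leaf \<open>z\<close> at the other it stays
  induced, since all its vertices are black and leaves have no further neighbours in \<open>D\<close>; its
  first six vertices are a forbidden path.
\<close>
lemma far_parents:
  assumes w0: "w0 \<in> W" "y0 \<in> D" "adj y0 w0" "adj y0 d0" "d0 \<in> D"
    and z: "z \<in> D" "w1 \<in> W" "adj z w1" "adj z d" "d \<in> D" and ne: "\<not> adj z w0" "\<not> adj d0 d" "d \<noteq> d0"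
  shows False
proof -
  have W: "z \<notin> W" "d \<notin> W" "d0 \<notin> W" "y0 \<notin> W"
    using z w0 D_nonwhite by auto
  have u0: "u = d0" if "adj y0 u" "u \<notin> W" for u using partner_unique[of y0 w0 u d0] that w0 W by blast
  have uz: "u = d" if "adj z u" "u \<notin> W" for u using partner_unique[of z w1 u d] that z W by blast
  have bd0: "black d0" using leaf_parent[OF w0(2,1,3)] w0(4) W by blast
  have bd: "black d" using leaf_parent[OF z(1,2,3)] z(4) W by blast
  have ny: "\<not> adj y0 x" if "x \<notin> W" "x \<noteq> d0" for x using u0 that by blast
  have nz: "\<not> adj x z" if "x \<notin> W" "x \<noteq> d" for x using uz that adj_sym by blast
  have bw: "\<not> adj w0 x" if "black x" for x using that black_white w0 by blast
  show False
  proof (rule D_path[OF w0(5) z(5) ne(3,2)])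
    fix q assume q: "q \<in> D" "adj d0 q" "adj q d"
    have qW: "q \<notin> W" using q D_nonwhite by auto
    have qd: "q \<noteq> d0" "q \<noteq> d" using q ne adj_irrefl by auto
    have bq: "black q" using blackI[of q d0 d] q ne W qW adj_sym by blast
    have zd0: "z \<noteq> d0" using z(4) ne by blast
    have 1: "\<not> adj y0 q" "\<not> adj y0 d" "\<not> adj y0 z" using ny qd qW W ne zd0 by auto
    have 2: "\<not> adj d0 z" "\<not> adj q z" using nz qd qW W ne by auto
    have 3: "\<not> adj w0 d0" "\<not> adj w0 q" "\<not> adj w0 d" using bw bd bq bd0 by auto
    show False
      by (rule no_P6[of w0 y0 d0 q d z]) (use 1 2 3 q w0 z ne adj_sym in blast)+
  next
    fix q1 q2 q3 assume q: "q1 \<in> D" "q2 \<in> D" "q3 \<in> D" "adj d0 q1" "adj q1 q2" "adj q2 q3"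
        "\<not> adj d0 q2" "\<not> adj d0 q3" "\<not> adj q1 q3" "q2 \<noteq> d0"
        "q3 = d \<or> (\<exists>q4\<in>D. adj q3 q4 \<and> q4 \<noteq> q2)"
    have qW: "q1 \<notin> W" "q2 \<notin> W" "q3 \<notin> W" using q D_nonwhite by auto
    have qd: "q1 \<noteq> d0" "q3 \<noteq> d0" "q1 \<noteq> q3" using q adj_irrefl adj_sym by blast+
    have b1: "black q1" using blackI[of q1 d0 q2] q qW W adj_sym by blast
    have b2: "black q2" using blackI[of q2 q1 q3] q qW qd adj_sym by blast
    have b3: "black q3" using q(11)
    proof
      assume "\<exists>q4\<in>D. adj q3 q4 \<and> q4 \<noteq> q2"
      then obtain q4 where "q4 \<in> D" "adj q3 q4" "q4 \<noteq> q2" by blast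
      then show ?thesis using blackI[of q3 q2 q4] adj_sym[OF q(6)] qW D_nonwhite[of q4] by auto
    qed (use bd in simp)
    have 1: "\<not> adj y0 q1" "\<not> adj y0 q2" "\<not> adj y0 q3" using ny qd q qW by auto
    have 3: "\<not> adj w0 d0" "\<not> adj w0 q1" "\<not> adj w0 q2" "\<not> adj w0 q3" using bw b1 b2 b3 bd0 by auto
    show False
      by (rule no_P6[of w0 y0 d0 q1 q2 q3]) (use 1 3 q w0 adj_sym in blast)+
  qed
qed

end

section \<open>Nonwhite components with adjacent black vertices\<close>

context p6free_graph begin

lemma lev_subset:
  assumes "\<And>v u. v \<in> H \<Longrightarrow> adj v u \<Longrightarrow> u \<in> H" "D \<subseteq> H"
  shows "level1 adj D \<subseteq> H" "level2 adj D \<subseteq> H" "level3 adj D \<subseteq> H"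
proof -
  show 1: "level1 adj D \<subseteq> H"
    using assms adj_sym unfolding level1_def by (auto simp: subset_iff)
  show 2: "level2 adj D \<subseteq> H"
    using assms(1) 1 adj_sym unfolding level2_def by (auto simp: subset_iff)
  show "level3 adj D \<subseteq> H"
    using assms(1) 2 adj_sym unfolding level3_def by (auto simp: subset_iff)
qed

text \<open>
  Spoiling is closed outside \<open>B\<close>, so a white vertex has only unspoilt neighbours outside
  \<open>B\<close>, and these see exactly one nonwhite vertex each: level one inside \<open>B\<close>, level
  three inside level three.
\<close>
lemma around_core_valid:
  assumes comp: "graph_component adj H" and c: "c \<in> H"
  shows "white_set_on adj H (around_core adj c)"
proof -
  define B where "B = insert c {v. adj v c}"
  define L1 L2 L3 where "L1 = level1 adj B" "L2 = level2 adj B" "L3 = level3 adj B"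
  note L = this
  define bad where "bad = spread4 adj B (- B - unspoilt adj B)"
  have around_core: "around_core adj c = L2 - bad" unfolding around_core_def Let_def B_def bad_def L by simp
  note closed = graph_component_closed[OF comp]
  have BH: "B \<subseteq> H" unfolding B_def using c closed adj_sym by (auto simp: subset_iff)
  have bad_closed: "u \<in> bad" if "v \<in> bad" "adj v u" "u \<notin> B" for u v
    unfolding bad_def by (rule spread4_closed) (use that in \<open>auto simp: bad_def\<close>)
  have good: "v \<in> unspoilt adj B" if "v \<notin> bad" "v \<notin> B" for v
    using that spread4_sup[of "- B - unspoilt adj B" B] unfolding bad_def by (auto simp: subset_iff)
  have disj: "B \<inter> L1 = {}" "B \<inter> L2 = {}" "B \<inter> L3 = {}" "L1 \<inter> L2 = {}" "L1 \<inter> L3 = {}" "L2 \<inter> L3 = {}"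
    unfolding L level1_def level2_def level3_def by auto
  have nbr1: "u \<in> B \<or> u \<in> L1 \<or> u \<in> L2" if "v \<in> L1" "adj v u" for u v
    using that adj_sym[OF that(2)] unfolding L level2_def by blast
  have nbr2: "u \<in> L1 \<or> u \<in> L2 \<or> u \<in> L3" if "v \<in> L2" "adj v u" for u v
    using that adj_sym[OF that(2)] unfolding L level1_def level2_def level3_def by blast
  show ?thesis unfolding white_set_on_def around_core
  proof (intro conjI ballI impI)
    show "L2 - bad \<subseteq> H" using lev_subset[of H B] closed BH unfolding L by blast
    fix u v assume "u \<in> L2 - bad" "v \<in> L2 - bad"
    then have uv: "u \<in> L2" "u \<notin> bad" "v \<in> L2" by auto
    have "u \<in> unspoilt adj B" "u \<notin> L1" "u \<notin> L3" using good[of u] uv disj by auto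
    then show "\<not> adj u v" using uv unfolding unspoilt_def L by auto
  next
    fix v assume v: "v \<in> H - (L2 - bad)" and "\<exists>w\<in>L2 - bad. adj v w"
    then obtain w where w: "w \<in> L2" "w \<notin> bad" "adj v w" by blast
    have wB: "w \<notin> B" using w disj by blast
    have vbad: "v \<notin> bad" using bad_closed[OF _ w(3) wB] w by blast
    have vL2: "v \<notin> L2" using v vbad by blast
    have v13: "v \<in> L1 \<or> v \<in> L3" using nbr2[OF w(1) adj_sym[OF w(3)]] vL2 by blast
    then have vB: "v \<notin> B" using disj by blast
    note g = good[OF vbad vB]
    have out: "u \<notin> bad" if "adj v u" for u
      using bad_closed[OF _ adj_sym[OF that] vB] vbad by blast
    from v13 show "\<exists>!u. adj v u \<and> u \<notin> L2 - bad"
    proof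
      assume v1: "v \<in> L1"
      then have ex: "\<exists>!u. adj v u \<and> u \<in> B" and no: "\<And>u. u \<in> L1 \<Longrightarrow> \<not> adj v u"
        using g disj unfolding unspoilt_def L by auto
      have "adj v u \<and> u \<notin> L2 - bad \<longleftrightarrow> adj v u \<and> u \<in> B" for u
        using nbr1[OF v1, of u] no[of u] out[of u] disj by blast
      then show ?thesis using ex by simp
    next
      assume v3: "v \<in> L3"
      then have ex: "\<exists>!u. adj v u \<and> u \<in> L3"
        using g disj unfolding unspoilt_def L by auto
      have nb: "u \<notin> B" if "adj v u" for u using that v3 unfolding L level3_def level1_def by blast
      have n1: "u \<notin> L1" if "adj v u" for u using that v3 unfolding L level3_def level2_def by blast
      have g3: "u \<in> L2 \<or> u \<in> L3" if "adj v u" for u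
        using good[OF out[OF that] nb[OF that]] n1[OF that] unfolding unspoilt_def L by blast
      have "adj v u \<and> u \<notin> L2 - bad \<longleftrightarrow> adj v u \<and> u \<in> L3" for u
        using g3[of u] out[of u] disj by blast
      then show ?thesis using ex by simp
    qed
  qed
qed

end

context white_set begin

lemma finite_nbrs: "v \<in> H \<Longrightarrow> finite {u. adj v u \<and> P u}"
  by (rule finite_subset[OF _ finite_H]) (use closed in auto)

lemma cost_mono: "W \<subseteq> W' \<Longrightarrow> cost adj H W' \<le> cost adj H W"
  unfolding cost_def
  by (rule order.trans[OF sum_mono2 sum_mono])
    (use finite_H in \<open>auto intro!: card_mono finite_nbrs intro: finite_subset\<close>)

end

context black_edge begin

text \<open>
  Let the parents \<open>d1\<close> and \<open>d2\<close> of two leaves at \<open>w\<close> be adjacent. A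
  white vertex that shares no neighbour with \<open>w\<close> would be joined to \<open>w\<close> by a long
  induced path through \<open>D\<close>, so all of \<open>W\<close> is within distance two of
  \<open>w\<close>. A nonwhite vertex \<open>q\<close> at distance two is the parent of a leaf at
  \<open>w\<close>, and it is adjacent to \<open>d1\<close> or \<open>d2\<close>, since otherwise \<open>d2,
  d1, y1, w, y, q\<close> would be an induced path. White vertices at distance two have no black neighbours,
  hence none at distance two. So the white vertices at distance two are exactly those without a neighbour at
  that distance.
\<close>
lemma parents_adjacent:
  assumes alpha: "w \<in> W" "y1 \<in> D" "y2 \<in> D" "adj y1 w" "adj y2 w" "adj y1 d1" "adj y2 d2"
    "d1 \<in> D" "d2 \<in> D" "adj d1 d2"
  shows "W = around_white adj w"
proof -
  have dW: "d1 \<notin> W" "d2 \<notin> W" "y1 \<notin> W" "y2 \<notin> W" using alpha D_nonwhite by auto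
  have u1: "u = d1" if "adj y1 u" "u \<notin> W" for u using partner_unique[of y1 w u d1] that alpha dW by blast
  have u2: "u = d2" if "adj y2 u" "u \<notin> W" for u using partner_unique[of y2 w u d2] that alpha dW by blast
  have bd: "black d1" "black d2"
    using leaf_parent[OF alpha(2,1,4)] leaf_parent[OF alpha(3,1,5)] alpha(6,7) dW by blast+
  have dw: "\<not> adj d1 w" "\<not> adj d2 w" "\<not> adj w d1" "\<not> adj w d2" using bd black_white alpha(1) by blast+
  have dd: "d1 \<noteq> d2" using alpha adj_irrefl by blast
  have y12: "\<not> adj y1 d2" "\<not> adj y2 d1" "y1 \<noteq> y2" using u1 u2 dd dW alpha by blast+
  have lev1w: "v \<in> level1 adj {w} \<longleftrightarrow> adj v w" for v using adj_irrefl by (auto simp: level1_def)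
  have lev2w: "v \<in> level2 adj {w} \<longleftrightarrow> v \<noteq> w \<and> \<not> adj v w \<and> (\<exists>u. adj u w \<and> adj v u)" for v
    unfolding level2_def by (auto simp: lev1w)
  have near: "\<exists>u. adj u w \<and> adj p u" if p: "p \<in> W" "p \<noteq> w" for p
  proof (rule ccontr)
    assume no: "\<not> ?thesis"
    obtain z where z: "z \<in> D" "adj z p" using white_near(1)[OF p(1) p(1)] by blast
    have zW: "z \<notin> W" using z D_nonwhite by blast
    have zw: "\<not> adj z w" using no z adj_sym by blast
    have pn: "\<not> adj y1 p" "\<not> adj y2 p" "\<not> adj p y1" "\<not> adj p y2" using no alpha adj_sym by blast+
    obtain e where e: "e \<in> D" "adj z e" "black e" "\<And>u. adj z u \<Longrightarrow> u \<notin> W \<Longrightarrow> u = e"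
      using leaf_parent[OF z(1) p(1) z(2)] by blast
    have ep: "\<not> adj e p" "\<not> adj d1 p" "\<not> adj d2 p" "\<not> adj e w" using black_white bd e alpha(1) p(1) by blast+
    have wp: "\<not> adj w p" using white_indep alpha(1) p by blast
    show False
    proof (cases "e = d1")
      case True
      have "\<not> adj z d2" using e(4)[of d2] dW dd True by blast
      moreover have "\<not> adj z y2" using e(4)[of y2] dW(4) ep(4) alpha(5) by blast
      ultimately show False
        by (intro no_P6[of p z d1 d2 y2 w])
          (use z adj_sym[OF z(2)] e(2) True alpha adj_sym[OF alpha(7)] ep pn wp zw y12 dw adj_commute in auto)
    next
      case False
      show False
      proof (cases "adj d1 e")
        case True
        have "\<not> adj y1 e" using u1[of e] False e D_nonwhite by blast
        moreover have "\<not> adj y1 z" using e(4)[of y1] dW(3) ep(4) alpha(4) adj_sym by blast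
        moreover have "\<not> adj d1 z" using e(4)[of d1] dW False adj_sym by blast
        ultimately show False
          by (intro no_P6[of w y1 d1 e z p])
            (use z e(2) True alpha(4,6) ep pn wp zw dw in \<open>simp_all add: adj_commute\<close>)
      next
        case nadj: False
        show False
          by (rule far_parents[OF alpha(1,2,4,6,8) z(1) p(1) z(2) e(2) e(1) zw nadj False])
      qed
    qed
  qed
  have nw: "q \<in> D \<and> black q \<and> (adj q d1 \<or> adj q d2)"
    if q: "q \<in> level2 adj {w}" "q \<notin> W" for q
  proof -
    obtain y where y: "adj y w" "adj q y" "\<not> adj q w" using q lev2w by blast
    have yW: "y \<notin> W" using white_indep alpha(1) y by blast
    have yD: "y \<in> D"
    proof (rule ccontr)
      assume "y \<notin> D"
      then show False using outside_twin(1)[OF alpha(2,1,4) _ yW y(1) adj_sym[OF y(2)] q(2)] y by blast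
    qed
    obtain d where d: "d \<in> D" "black d" "\<And>u. adj y u \<Longrightarrow> u \<notin> W \<Longrightarrow> u = d"
      using leaf_parent[OF yD alpha(1) y(1)] by blast
    have qd: "q = d" using d(3) q y adj_sym by blast
    have "adj q d1 \<or> adj q d2"
    proof (rule ccontr)
      assume no: "\<not> ?thesis"
      then have ne: "q \<noteq> d2" "q \<noteq> d1" using alpha(10) adj_sym by blast+
      have 1: "\<not> adj y d1" "\<not> adj y d2" using d(3) dW qd ne by blast+
      have 2: "\<not> adj y1 q" using u1 ne q by blast
      have 3: "\<not> adj y1 y" using d(3)[of y1] qd alpha(4) y(3) dW(3) adj_sym by blast
      show False
        by (intro no_P6[of d2 d1 y1 w y q])
          (use no 1 2 3 y alpha dw y12 in \<open>simp_all add: adj_commute\<close>)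
    qed
    then show ?thesis using d qd by blast
  qed
  have din: "d1 \<in> level2 adj {w}" "d2 \<in> level2 adj {w}"
    unfolding lev2w using dw dW alpha adj_sym by blast+
  show ?thesis
  proof (intro set_eqI iffI)
    fix v assume v: "v \<in> W"
    have "\<not> (\<exists>u\<in>level2 adj {w}. adj v u)" if "v \<noteq> w"
      using nw white_indep v black_white by blast
    then show "v \<in> around_white adj w"
      unfolding around_white_def lev2w using near[OF v] white_indep[OF v alpha(1)] adj_sym by blast
  next
    fix v assume v: "v \<in> around_white adj w"
    show "v \<in> W"
    proof (rule ccontr)
      assume "v \<notin> W"
      then show False using v nw[of v] din alpha(1) unfolding around_white_def by blast
    qed
  qed
qed

text \<open>
  Start from one leaf \<open>y0\<close> with parent \<open>d0\<close> and a black neighbour \<open>c\<close>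
  of \<open>d0\<close>. For another leaf \<open>y\<close> with parent \<open>d\<close> different from
  \<open>d0\<close>: if \<open>y0\<close> and \<open>y\<close> have a common white neighbour
  \<open>x\<close>, then the assumption makes \<open>d0\<close> and \<open>d\<close> nonadjacent, and
  \<open>c, d0, y0, x, y, d\<close> is an induced path unless \<open>d\<close> is adjacent to
  \<open>c\<close>. If they have none, there is a long induced path through \<open>D\<close> between their
  white neighbours.
\<close>
lemma common_core:
  assumes ne: "W \<noteq> {}"
    and no_alpha: "\<And>w y1 y2 d1 d2. w \<in> W \<Longrightarrow> y1 \<in> D \<Longrightarrow> y2 \<in> D \<Longrightarrow> adj y1 w \<Longrightarrow> adj y2 w \<Longrightarrow>
      adj y1 d1 \<Longrightarrow> adj y2 d2 \<Longrightarrow> d1 \<in> D \<Longrightarrow> d2 \<in> D \<Longrightarrow> \<not> adj d1 d2"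
  obtains c where "c \<in> D" "black c"
    "\<And>w y d. w \<in> W \<Longrightarrow> y \<in> D \<Longrightarrow> adj y w \<Longrightarrow> adj y d \<Longrightarrow> d \<in> D \<Longrightarrow> adj d c"
proof -
  obtain w0 where w0: "w0 \<in> W" using ne by blast
  obtain y0 where y0: "y0 \<in> D" "adj y0 w0" using white_near(1)[OF w0 w0] by blast
  obtain d0 c where d0: "d0 \<in> D" "c \<in> D" "adj y0 d0" "adj d0 c" "black d0" "black c" "c \<noteq> y0"
    "\<And>u. adj y0 u \<Longrightarrow> u \<notin> W \<Longrightarrow> u = d0" using leaf_parent[OF y0(1) w0 y0(2)] by blast
  have W: "c \<notin> W" "d0 \<notin> W" "y0 \<notin> W" using d0(1,2) y0(1) D_nonwhite by auto
  have y0c: "\<not> adj y0 c" using d0(8)[of c] W d0(4) adj_irrefl by blast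
  have "adj d c" if w: "w \<in> W" and y: "y \<in> D" "adj y w" and d: "adj y d" "d \<in> D" for w y d
  proof (cases "d = d0")
    case True then show ?thesis using d0 by simp
  next
    case ne: False
    have yW: "y \<notin> W" "d \<notin> W" using y d D_nonwhite by auto
    have uy: "u = d" if "adj y u" "u \<notin> W" for u using partner_unique[of y w u d] that w y yW d by blast
    have bd: "black d" using leaf_parent[OF y(1) w y(2)] d(1) yW by blast
    have y0d: "\<not> adj y0 d" "\<not> adj y d0" using d0(8)[of d] uy[of d0] ne W yW by blast+
    have no_y: "y \<noteq> d0" using black_white[OF d0(5) w] y(2) by blast
    have y0y: "\<not> adj y0 y" using d0(8)[of y] yW(1) no_y by blast
    show ?thesis
    proof (cases "\<exists>x\<in>W. adj y0 x \<and> adj y x")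
      case True
      then obtain x where x: "x \<in> W" "adj y0 x" "adj y x" by blast
      have nd: "\<not> adj d0 d" using no_alpha[OF x(1) y0(1) y(1) x(2,3) d0(3) d(1) d0(1) d(2)] .
      have dc: "d \<noteq> c" using nd d0 by blast
      have yc: "\<not> adj y c" using uy W dc by blast
      show ?thesis
      proof (rule ccontr)
        assume nc: "\<not> adj d c"
        have "\<not> adj c x" "\<not> adj d x" "\<not> adj d0 x" using black_white d0 bd x by blast+
        then show False
          by (intro no_P6[of c d0 y0 x y d])
            (use nc nd yc y0c y0d y0y x d d0(3,4) in \<open>simp_all add: adj_commute\<close>)
      qed
    next
      case False
      then have no: "\<not> adj y w0" "\<not> adj y0 w" using w w0 y0 y by blast+
      show ?thesis
      proof (cases "adj d0 d")
        case True
        have "\<not> adj w0 d0" "\<not> adj w0 d" "\<not> adj d w" "\<not> adj d0 w" "\<not> adj w0 w"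
          using black_white d0 bd w w0 white_indep by blast+
        then have False
          by (intro no_P6[of w0 y0 d0 d y w])
            (use True no y0d y0y d d0(3) y0(2) y(2) in \<open>simp_all add: adj_commute\<close>)
        then show ?thesis ..
      next
        case nadj: False
        have False
          by (rule far_parents[OF w0 y0 d0(3,1) y(1) w y(2) d no(1) nadj ne])
        then show ?thesis ..
      qed
    qed
  qed
  then show thesis using that d0(2,6) by blast
qed

text \<open>
  The leaves with a white neighbour, the white vertices and the vertices outside \<open>D\<close> lie on
  levels one, two and three around the closed neighbourhood \<open>B\<close> of \<open>c\<close>. They fit
  the picture of \<open>unspoilt\<close>, and their neighbours outside \<open>B\<close> are again of these
  kinds, so no spoilt vertex reaches them. White vertices that the candidate has in addition only lower the
  cost.
\<close>
lemma common_core_subset: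
  assumes ne: "W \<noteq> {}" and c: "c \<in> D" "black c"
    and par: "\<And>w y d. w \<in> W \<Longrightarrow> y \<in> D \<Longrightarrow> adj y w \<Longrightarrow> adj y d \<Longrightarrow> d \<in> D \<Longrightarrow> adj d c"
  shows "W \<subseteq> around_core adj c"
proof -
  define B where "B = insert c {v. adj v c}"
  obtain w0 where w0: "w0 \<in> W" using ne by blast
  define Y where "Y = {y\<in>D. \<exists>w\<in>W. adj y w}"
  define T where "T = H - W - D"
  have cW: "c \<notin> W" using c D_nonwhite by blast
  have BD: "B \<subseteq> D"
  proof
    fix v assume "v \<in> B"
    then have "v = c \<or> adj v c" unfolding B_def by blast
    then show "v \<in> D" using c D_closed[of c v] adj_sym[of v c] black_white[of c v] by blast
  qed
  have white: "\<exists>y\<in>Y. adj y w" if "w \<in> W" for w using white_near(1)[OF w0 that] that unfolding Y_def by blast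
  obtain y0 where y0: "y0 \<in> D" "adj y0 w0" using white_near(1)[OF w0 w0] by blast
  have Y: "y \<notin> B \<and> y \<notin> W \<and> (\<exists>d. adj y d \<and> d \<in> B \<and> (\<forall>u. adj y u \<longrightarrow> u \<notin> W \<longrightarrow> u = d))" if y: "y \<in> Y" for y
  proof -
    obtain w where w: "w \<in> W" "adj y w" "y \<in> D" using y unfolding Y_def by blast
    obtain d where d: "d \<in> D" "adj y d" "\<And>u. adj y u \<Longrightarrow> u \<notin> W \<Longrightarrow> u = d"
      using leaf_parent[OF w(3,1,2)] by blast
    have dc: "adj d c" using par[OF w(1,3,2) d(2,1)] .
    then have "\<not> adj y c" using d(3)[of c] cW adj_irrefl by blast
    moreover have "y \<noteq> c" using black_white[OF c(2) w(1)] w by blast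
    ultimately show ?thesis using d dc D_nonwhite[OF w(3)] unfolding B_def by blast
  qed
  have T: "\<exists>s\<in>T. adj t s \<and> (\<forall>u. adj t u \<longrightarrow> u \<notin> W \<longrightarrow> u = s)" and Tw: "\<exists>w\<in>W. adj t w" if t: "t \<in> T" for t
  proof -
    show "\<exists>w\<in>W. adj t w" using white_near(2)[OF w0] t unfolding T_def by blast
    then obtain w where w: "w \<in> W" "adj t w" by blast
    obtain y where y: "y \<in> D" "adj y w" using white_near(1)[OF w0 w(1)] by blast
    have tt: "t \<notin> D" "t \<notin> W" "t \<in> H" using t unfolding T_def by auto
    obtain s where s: "adj t s" "s \<notin> W" using partner_ex[OF tt(2) w] by blast
    have "s \<in> T" using outside_twin(2)[OF y(1) w(1) y(2) tt(1,2) w(2) s] s closed tt unfolding T_def by blast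
    moreover have "u = s" if "adj t u" "u \<notin> W" for u using partner_unique[OF tt(2) w that s] .
    ultimately show "\<exists>s\<in>T. adj t s \<and> (\<forall>u. adj t u \<longrightarrow> u \<notin> W \<longrightarrow> u = s)" using s by blast
  qed
  have wn: "u \<in> Y \<or> u \<in> T" if "w \<in> W" "adj w u" for w u
  proof -
    have "u \<notin> W" "u \<in> H" using that white_indep closed W_sub by blast+
    then show ?thesis using that adj_sym[OF that(2)] unfolding Y_def T_def by blast
  qed
  have yl1: "Y \<subseteq> level1 adj B" using Y unfolding level1_def by blast
  have WB: "W \<inter> B = {}" "T \<inter> B = {}" using BD D_nonwhite unfolding T_def by blast+
  have YB: "Y \<inter> B = {}" using Y by blast
  have wl1: "w \<notin> level1 adj B" if "w \<in> W" for w
    using wn[OF that] YB WB unfolding level1_def by blast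
  have wl2: "w \<in> level2 adj B" if "w \<in> W" for w
    using white[OF that] wl1[OF that] yl1 WB that adj_sym unfolding level2_def by blast
  have tl1: "t \<notin> level1 adj B" if "t \<in> T" for t
  proof
    assume "t \<in> level1 adj B"
    then obtain u where "u \<in> B" "adj t u" unfolding level1_def by blast
    then show False using T[OF that] WB by blast
  qed
  have tl2: "t \<notin> level2 adj B" if "t \<in> T" for t
  proof
    assume "t \<in> level2 adj B"
    then obtain u where u: "u \<in> level1 adj B" "adj t u" unfolding level2_def by blast
    then have "u \<notin> W" using wl1 by blast
    then have "u \<in> T" using T[OF that] u by blast
    then show False using tl1 u by blast
  qed
  have tl3: "t \<in> level3 adj B" if "t \<in> T" for t
    using Tw[OF that] tl1[OF that] tl2[OF that] wl2 WB that unfolding level3_def by blast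
  have good: "Y \<union> W \<union> T \<subseteq> unspoilt adj B"
  proof (intro subsetI; elim UnE)
    fix v assume v: "v \<in> Y"
    obtain d where d: "adj v d" "d \<in> B" "\<And>u. adj v u \<Longrightarrow> u \<notin> W \<Longrightarrow> u = d" using Y[OF v] by blast
    have "\<exists>!u. adj v u \<and> u \<in> B" using d WB by blast
    moreover have "\<not> (\<exists>u\<in>level1 adj B. adj v u)" using d wl1 unfolding level1_def by blast
    ultimately show "v \<in> unspoilt adj B" unfolding unspoilt_def using v yl1 by blast
  next
    fix v assume v: "v \<in> W"
    have "\<not> (\<exists>u\<in>level2 adj B. adj v u)" using wn[OF v] tl2 yl1 unfolding level2_def by blast
    then show "v \<in> unspoilt adj B" unfolding unspoilt_def using wl2[OF v] by blast
  next
    fix v assume v: "v \<in> T"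
    obtain s where s: "s \<in> T" "adj v s" "\<And>u. adj v u \<Longrightarrow> u \<notin> W \<Longrightarrow> u = s" using T[OF v] by blast
    have w3: "u \<notin> level3 adj B" if "u \<in> W" for u using wl2[OF that] unfolding level3_def by blast
    have "\<exists>!u. adj v u \<and> u \<in> level3 adj B" using s tl3 w3 by blast
    then show "v \<in> unspoilt adj B" unfolding unspoilt_def using tl3[OF v] by blast
  qed
  have "spread4 adj B (- B - unspoilt adj B) \<subseteq> - (B \<union> Y \<union> W \<union> T)"
  proof (rule spread4_least)
    show "- B - unspoilt adj B \<subseteq> - (B \<union> Y \<union> W \<union> T)" using good by blast
    fix v u assume v: "v \<in> - (B \<union> Y \<union> W \<union> T)" "adj v u" "u \<notin> B"
    have "u \<notin> Y"
      using Y[of u] adj_sym[OF v(2)] v(1) by blast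
    moreover have "u \<notin> W" using wn[of u v] adj_sym[OF v(2)] v(1) by blast
    moreover have "u \<notin> T" using T[of u] adj_sym[OF v(2)] v(1) by blast
    ultimately show "u \<in> - (B \<union> Y \<union> W \<union> T)" using v(3) by blast
  qed
  then show ?thesis unfolding around_core_def Let_def B_def[symmetric] using wl2 by blast
qed

theorem black_edge_candidate:
  assumes ne: "W \<noteq> {}"
  shows "\<exists>g\<in>H. (white_set_on adj H (around_core adj g) \<and> cost adj H (around_core adj g) \<le> cost adj H W) \<or>
    (white_set_on adj H (around_white adj g) \<and> cost adj H (around_white adj g) \<le> cost adj H W)"
proof (cases "\<exists>w y1 y2 d1 d2. w \<in> W \<and> y1 \<in> D \<and> y2 \<in> D \<and> adj y1 w \<and> adj y2 w \<and>
      adj y1 d1 \<and> adj y2 d2 \<and> d1 \<in> D \<and> d2 \<in> D \<and> adj d1 d2")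
  case True
  then obtain w where "w \<in> W" "W = around_white adj w" using parents_adjacent by blast
  moreover have "w \<in> H" using calculation(1) W_sub by blast
  ultimately show ?thesis using white_W by (metis order_refl)
next
  case False
  obtain c where c: "c \<in> D" "black c"
    "\<And>w y d. w \<in> W \<Longrightarrow> y \<in> D \<Longrightarrow> adj y w \<Longrightarrow> adj y d \<Longrightarrow> d \<in> D \<Longrightarrow> adj d c"
    by (rule common_core[OF ne]) (use False in blast)+
  have "W \<subseteq> around_core adj c" by (rule common_core_subset[OF ne c])
  moreover have "c \<in> H" using c(1) D_sub by blast
  ultimately show ?thesis using around_core_valid[OF comp] cost_mono by blast
qed

end

section \<open>Recolouring around a block\<close>

text \<open>
  Let \<open>D\<close> be a component of \<open>H - W\<close>. Level one is white and level two is not, so a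
  vertex of level two needs exactly one nonwhite neighbour on level two or three. Matched vertices have it
  on level two; their neighbours on level three must be white.
\<close>
definition matched :: "('a \<Rightarrow> 'a \<Rightarrow> bool) \<Rightarrow> 'a set \<Rightarrow> 'a set" where
  "matched adj D = {v \<in> level2 adj D. \<exists>u\<in>level2 adj D. adj v u}"
definition unmatched :: "('a \<Rightarrow> 'a \<Rightarrow> bool) \<Rightarrow> 'a set \<Rightarrow> 'a set" where
  "unmatched adj D = {v \<in> level2 adj D. \<not> (\<exists>u\<in>level2 adj D. adj v u)}"
definition undecided :: "('a \<Rightarrow> 'a \<Rightarrow> bool) \<Rightarrow> 'a set \<Rightarrow> 'a set" where
  "undecided adj D = {v \<in> level3 adj D. \<not> (\<exists>u\<in>matched adj D. adj v u)}"
text \<open>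
  An edge between two vertices of level three with an end that is still undecided forces exactly one of its
  ends to be nonwhite; see \<open>C_edge\<close> below.
\<close>
definition linked :: "('a \<Rightarrow> 'a \<Rightarrow> bool) \<Rightarrow> 'a set \<Rightarrow> 'a set" where
  "linked adj D = {v \<in> undecided adj D. \<exists>u\<in>level3 adj D. adj v u}"
text \<open>
  The partner of a served vertex must be linked. Its undecided neighbours that are not linked are therefore
  white, so they must not be eligible for any other vertex.
\<close>
definition served :: "('a \<Rightarrow> 'a \<Rightarrow> bool) \<Rightarrow> 'a set \<Rightarrow> 'a set" where
  "served adj D = {v \<in> unmatched adj D. \<exists>u\<in>linked adj D. adj v u}"
definition eligible :: "('a \<Rightarrow> 'a \<Rightarrow> bool) \<Rightarrow> 'a set \<Rightarrow> 'a set" where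
  "eligible adj D = {v \<in> undecided adj D. v \<in> linked adj D \<or> \<not> (\<exists>u\<in>served adj D. adj v u)}"
definition picked :: "('a \<Rightarrow> 'a \<Rightarrow> bool) \<Rightarrow> ('a \<Rightarrow> nat) \<Rightarrow> 'a set \<Rightarrow> 'a set" where
  "picked adj rank D = {v \<in> eligible adj D. \<exists>y\<in>unmatched adj D. adj v y \<and>
     (\<forall>p\<in>eligible adj D. adj y p \<longrightarrow> rank p \<le> rank v)}"
definition around_block :: "('a \<Rightarrow> 'a \<Rightarrow> bool) \<Rightarrow> ('a \<Rightarrow> nat) \<Rightarrow> 'a set \<Rightarrow> 'a set" where
  "around_block adj rank D = level1 adj D \<union> (level3 adj D - picked adj rank D)"

text \<open>
  Ranks order by degree and break ties in the same way for all vertices that pick.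
\<close>
definition degree_rank :: "('a \<Rightarrow> 'a \<Rightarrow> bool) \<Rightarrow> 'a set \<Rightarrow> ('a \<Rightarrow> nat) \<Rightarrow> bool" where
  "degree_rank adj H rank \<longleftrightarrow> inj_on rank H \<and>
     (\<forall>u\<in>H. \<forall>v\<in>H. card {x. adj u x} < card {x. adj v x} \<longrightarrow> rank u < rank v)"

text \<open>
  The assumption \<open>tail\<close> provides an induced path \<open>a, b, w, y\<close> that enters
  \<open>D\<close>. Beyond \<open>y\<close> only one more vertex can be appended to it, and this controls
  level three.
\<close>
locale rooted = white_set adj H W for adj :: "'a \<Rightarrow> 'a \<Rightarrow> bool" and H W +
  fixes D :: "'a set" and rank :: "'a \<Rightarrow> nat"
  assumes D_sub: "D \<subseteq> H - W" and D_closed: "v \<in> D \<Longrightarrow> adj v u \<Longrightarrow> u \<notin> W \<Longrightarrow> u \<in> D"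
    and D_ne: "D \<noteq> {}"
    and tail: "y \<in> unmatched adj D \<Longrightarrow>
      \<exists>a\<in>D. \<exists>b\<in>D. \<exists>w\<in>level1 adj D. adj a b \<and> adj b w \<and> adj w y \<and> \<not> adj a w"
    and rank: "degree_rank adj H rank"
begin

text \<open>
  The partners in \<open>W\<close> of unmatched vertices form \<open>X\<close>, and \<open>PK\<close> is the
  choice made by the algorithm. Both are subsets of level three.
\<close>
abbreviation "L1 \<equiv> level1 adj D"
abbreviation "L2 \<equiv> level2 adj D"
abbreviation "L3 \<equiv> level3 adj D"
abbreviation "M \<equiv> matched adj D"
abbreviation "U \<equiv> unmatched adj D"
abbreviation "C \<equiv> undecided adj D"
abbreviation "E \<equiv> linked adj D"
abbreviation "SV \<equiv> served adj D"
abbreviation "EL \<equiv> eligible adj D"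
abbreviation "PK \<equiv> picked adj rank D"
abbreviation "X \<equiv> L3 - W"

lemma rank_inj: "u \<in> H \<Longrightarrow> v \<in> H \<Longrightarrow> rank u = rank v \<Longrightarrow> u = v"
  using rank unfolding degree_rank_def inj_on_def by simp
lemma rank_deg: "u \<in> H \<Longrightarrow> v \<in> H \<Longrightarrow> rank u \<le> rank v \<Longrightarrow> card {x. adj u x} \<le> card {x. adj v x}"
  using rank unfolding degree_rank_def by (meson linorder_not_le)

lemma D_W: "v \<in> D \<Longrightarrow> v \<notin> W" using D_sub by blast
lemma levels_disjoint: "v \<in> L1 \<Longrightarrow> v \<notin> D" "v \<in> L2 \<Longrightarrow> v \<notin> D \<and> v \<notin> L1" "v \<in> L3 \<Longrightarrow> v \<notin> D \<and> v \<notin> L1 \<and> v \<notin> L2"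
  unfolding level1_def level2_def level3_def by blast+
lemma levels_H: "v \<in> L1 \<Longrightarrow> v \<in> H" "v \<in> L2 \<Longrightarrow> v \<in> H" "v \<in> L3 \<Longrightarrow> v \<in> H"
  using lev_subset[of H D] closed D_sub by blast+

lemma nbr0: "v \<in> D \<Longrightarrow> adj v u \<Longrightarrow> u \<in> D \<or> u \<in> L1"
  using adj_sym unfolding level1_def by blast
lemma nbr1: "v \<in> L1 \<Longrightarrow> adj v u \<Longrightarrow> u \<in> D \<or> u \<in> L1 \<or> u \<in> L2"
  using adj_sym unfolding level2_def by blast
lemma nbr2: "v \<in> L2 \<Longrightarrow> adj v u \<Longrightarrow> u \<in> L1 \<or> u \<in> L2 \<or> u \<in> L3"
  using adj_sym[of v u] unfolding level1_def level2_def level3_def by blast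
lemma nbr3: "v \<in> L3 \<Longrightarrow> adj v u \<Longrightarrow> u \<notin> D \<and> u \<notin> L1"
  unfolding level1_def level2_def level3_def by blast

lemma L1_white: "v \<in> L1 \<Longrightarrow> v \<in> W"
  using D_closed adj_sym unfolding level1_def by blast
lemma L2_white_nbr: "v \<in> L2 \<Longrightarrow> \<exists>w\<in>W. adj v w \<and> w \<in> L1"
  using L1_white unfolding level2_def by blast
lemma L2_nonwhite: "v \<in> L2 \<Longrightarrow> v \<notin> W"
  using L2_white_nbr white_indep by blast
lemma L2_unique: "v \<in> L2 \<Longrightarrow> adj v a \<Longrightarrow> a \<notin> W \<Longrightarrow> adj v b \<Longrightarrow> b \<notin> W \<Longrightarrow> a = b"
  using L2_white_nbr[of v] L2_nonwhite[of v] partner_unique[of v _ a b] by blast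
lemma L3_L2: "v \<in> L3 \<Longrightarrow> \<exists>y\<in>L2. adj v y" unfolding level3_def by blast
lemma L2_split: "v \<in> L2 \<longleftrightarrow> v \<in> M \<or> v \<in> U" unfolding matched_def unmatched_def by blast
lemma U_L2: "v \<in> U \<Longrightarrow> v \<in> L2" unfolding unmatched_def by blast

lemma X_nbr_U: "x \<in> X \<Longrightarrow> adj x y \<Longrightarrow> y \<in> L2 \<Longrightarrow> y \<in> U"
proof -
  assume a: "x \<in> X" "adj x y" "y \<in> L2"
  have "\<not> adj y u" if "u \<in> L2" for u
  proof
    assume "adj y u"
    then have "u = x" using L2_unique[OF a(3) _ L2_nonwhite[OF that] adj_sym[OF a(2)]] a(1) by blast
    then show False using that a(1) levels_disjoint by blast
  qed
  then show "y \<in> U" using a unfolding unmatched_def by blast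
qed

lemma X_C: "x \<in> X \<Longrightarrow> x \<in> C"
  using X_nbr_U unfolding undecided_def matched_def unmatched_def by blast

lemma C_L3: "p \<in> C \<Longrightarrow> p \<in> L3" unfolding undecided_def by blast
lemma C_nbr_U: "p \<in> C \<Longrightarrow> adj p y \<Longrightarrow> y \<in> L2 \<Longrightarrow> y \<in> U"
  unfolding undecided_def using L2_split by blast
lemma C_U: "p \<in> C \<Longrightarrow> \<exists>y\<in>U. adj p y" using C_L3 L3_L2 C_nbr_U by blast

lemma U_X: "y \<in> U \<Longrightarrow> \<exists>!x. x \<in> X \<and> adj y x"
proof -
  assume y: "y \<in> U"
  note y2 = U_L2[OF y]
  obtain w where w: "w \<in> W" "adj y w" using L2_white_nbr y2 by blast
  obtain x where x: "adj y x" "x \<notin> W" using partner_ex[OF L2_nonwhite[OF y2] w] by blast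
  have "x \<in> L3" using nbr2[OF y2 x(1)] x L1_white y unfolding unmatched_def by blast
  then show ?thesis using x L2_unique[OF y2] by blast
qed

text \<open>
  The path \<open>a, b, w, y, p\<close> is induced and must not be continued by \<open>q\<close>.
\<close>
lemma C_path:
  assumes p: "p \<in> L3" and y: "y \<in> U" "adj p y" and q: "adj p q"
  shows "q \<in> L2 \<or> (q \<in> L3 \<and> adj q y)"
proof (cases "q \<in> L2")
  case False
  have qn: "q \<notin> D" "q \<notin> L1" using nbr3[OF p q] by auto
  obtain a b w where t: "a \<in> D" "b \<in> D" "w \<in> L1" "adj a b" "adj b w" "adj w y" "\<not> adj a w"
    using tail[OF y(1)] by blast
  have dy: "\<not> adj x y" if "x \<in> D" for x using nbr0[OF that, of y] levels_disjoint U_L2[OF y(1)] by blast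
  have dp: "\<not> adj x p" if "x \<in> D" for x using nbr0[OF that, of p] levels_disjoint p by blast
  have dq: "\<not> adj x q" if "x \<in> D" for x using nbr0[OF that, of q] qn by blast
  have wp: "\<not> adj w p" using nbr1[OF t(3), of p] levels_disjoint p by blast
  have wq: "\<not> adj w q" using nbr1[OF t(3), of q] qn False by blast
  have "adj y q"
  proof (rule ccontr)
    assume "\<not> adj y q"
    then show False
      by (intro no_P6[of a b w y p q]) (use t dy dp dq wp wq adj_sym[OF y(2)] q in simp_all)
  qed
  then show ?thesis using nbr2[OF U_L2[OF y(1)], of q] False qn adj_sym by blast
qed simp

lemma C_nbr:
  assumes "p \<in> C" "adj p q"
  shows "q \<in> U \<or> (q \<in> L3 \<and> p \<in> E \<and> (\<forall>y\<in>L2. adj p y \<longrightarrow> adj q y))"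
proof (cases "q \<in> L2")
  case False
  have *: "q \<in> L3 \<and> adj q y" if "y \<in> L2" "adj p y" for y
    using C_path[OF C_L3[OF assms(1)] C_nbr_U[OF assms(1) that(2,1)] that(2) assms(2)] False by blast
  moreover obtain y where "y \<in> U" "adj p y" using C_U[OF assms(1)] by blast
  ultimately show ?thesis using U_L2 assms unfolding linked_def by blast
qed (use C_nbr_U assms in blast)

text \<open>
  A white vertex on level four would continue the path from \<open>D\<close> to its neighbour on level
  three, which is nonwhite and therefore undecided. A fifth level does not exist, because a shortest path
  from \<open>D\<close> to it would have six vertices.
\<close>
lemma outside_nonwhite:
  assumes z: "z \<in> H" "z \<notin> D" "z \<notin> L1" "z \<notin> L2" "z \<notin> L3"
  shows "z \<notin> W"
proof -
  let ?L4 = "{v. v \<notin> L2 \<and> v \<notin> L3 \<and> (\<exists>u\<in>L3. adj v u)}"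
  have L4: "v \<notin> W" if v: "v \<in> ?L4" for v
  proof
    assume vW: "v \<in> W"
    obtain p where p: "p \<in> L3" "adj v p" "v \<notin> L2" "v \<notin> L3" using v by blast
    have "p \<in> X" using p white_indep[OF vW] by blast
    then show False using C_nbr[OF X_C adj_sym[OF p(2)]] p U_L2 by blast
  qed
  have "H \<subseteq> D \<union> L1 \<union> L2 \<union> L3 \<union> ?L4"
  proof -
    obtain d where d: "d \<in> D" using D_ne by blast
    show ?thesis
    proof (rule graph_component_connected[OF comp, of d])
      show "d \<in> H" "d \<in> D \<union> L1 \<union> L2 \<union> L3 \<union> ?L4" using d D_sub by auto
      fix v u assume v: "v \<in> D \<union> L1 \<union> L2 \<union> L3 \<union> ?L4" "v \<in> H" "adj v u"
      show "u \<in> D \<union> L1 \<union> L2 \<union> L3 \<union> ?L4"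
      proof (rule ccontr)
        assume u: "\<not> ?thesis"
        have "v \<notin> D" "v \<notin> L1" "v \<notin> L2" using nbr0[of v u] nbr1[of v u] nbr2[of v u] u v(3) by blast+
        moreover have "v \<notin> L3" using u adj_sym[OF v(3)] by blast
        ultimately have v4: "v \<in> ?L4" using v by blast
        then obtain p where p: "p \<in> L3" "adj v p" by blast
        obtain y where y: "y \<in> L2" "adj p y" using L3_L2 p by blast
        obtain w where w: "w \<in> L1" "adj y w" using y unfolding level2_def by blast
        obtain b where b: "b \<in> D" "adj w b" using w unfolding level1_def by blast
        have vn: "v \<notin> D" "v \<notin> L1" "v \<notin> L2" "v \<notin> L3" by fact+
        have bn: "\<not> adj b x" if "x \<notin> D" "x \<notin> L1" for x using nbr0[OF b(1)] that by blast
        have wn: "\<not> adj w x" if "x \<notin> D" "x \<notin> L1" "x \<notin> L2" for x using nbr1[OF w(1)] that by blast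
        have yn: "\<not> adj y x" if "x \<notin> L1" "x \<notin> L2" "x \<notin> L3" for x using nbr2[OF y(1)] that by blast
        have "\<not> adj p u" using u p adj_sym by blast
        then show False
          by (intro no_P6[of b w y p v u])
            (use bn wn yn vn u adj_sym[OF b(2)] adj_sym[OF w(2)] adj_sym[OF y(2)] adj_sym[OF p(2)] v(3)
              levels_disjoint y(1) p(1) in auto)
      qed
    qed
  qed
  then show ?thesis using z L4 by blast
qed

lemma U_indep: "y \<in> U \<Longrightarrow> y' \<in> U \<Longrightarrow> \<not> adj y y'" unfolding unmatched_def by blast
lemma E_C: "p \<in> E \<Longrightarrow> p \<in> C" unfolding linked_def by blast
lemma EL_C: "p \<in> EL \<Longrightarrow> p \<in> C" unfolding eligible_def by blast
lemma EL_H: "p \<in> EL \<Longrightarrow> p \<in> H" using EL_C C_L3 levels_H(3) by blast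
lemma PK_EL: "p \<in> PK \<Longrightarrow> p \<in> EL" unfolding picked_def by blast
lemma SV_U: "y \<in> SV \<Longrightarrow> y \<in> U" unfolding served_def by blast
lemma U_X_unique: "y \<in> U \<Longrightarrow> a \<in> X \<Longrightarrow> b \<in> X \<Longrightarrow> adj y a \<Longrightarrow> adj y b \<Longrightarrow> a = b"
  using U_X[of y] by blast

text \<open>
  Both ends are neighbours of every level-two neighbour \<open>y\<close> of \<open>p\<close>, and
  \<open>y\<close> has only one nonwhite neighbour; so exactly one end is in \<open>X\<close>. This end has
  a white neighbour, the other end, and hence only one nonwhite neighbour, so \<open>y\<close> is unique.
\<close>
lemma C_edge:
  assumes "p \<in> C" "q \<in> L3" "adj p q"
  shows "p \<in> E" "(p \<in> X \<and> q \<in> W) \<or> (q \<in> X \<and> p \<in> W)"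
    "y \<in> L2 \<Longrightarrow> adj p y \<Longrightarrow> adj q y"
    "y \<in> L2 \<Longrightarrow> adj p y \<Longrightarrow> y' \<in> L2 \<Longrightarrow> adj p y' \<Longrightarrow> y = y'"
proof -
  show pE: "p \<in> E" using assms unfolding linked_def by blast
  have qU: "q \<notin> U" using U_L2 levels_disjoint(3)[OF assms(2)] by blast
  show qy: "adj q y" if "y \<in> L2" "adj p y" for y using C_nbr[OF assms(1,3)] qU that by blast
  obtain y0 where y0: "y0 \<in> U" "adj p y0" using C_U[OF assms(1)] by blast
  have "\<not> (p \<in> X \<and> q \<in> X)"
    using U_X_unique[OF y0(1), of p q] y0 adj_sym[OF y0(2)] adj_sym[OF qy[OF U_L2[OF y0(1)] y0(2)]] assms(3) adj_irrefl by blast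
  moreover have "\<not> (p \<in> W \<and> q \<in> W)" using white_indep assms(3) by blast
  ultimately show one: "(p \<in> X \<and> q \<in> W) \<or> (q \<in> X \<and> p \<in> W)" using C_L3[OF assms(1)] assms(2) by blast
  show "y = y'" if y: "y \<in> L2" "adj p y" "y' \<in> L2" "adj p y'" for y y'
    using one
  proof
    assume "p \<in> X \<and> q \<in> W"
    then show ?thesis
      using partner_unique[of p q y y'] assms(3) y L2_nonwhite[OF y(1)] L2_nonwhite[OF y(3)] by blast
  next
    assume "q \<in> X \<and> p \<in> W"
    then show ?thesis
      using partner_unique[of q p y y'] adj_sym[OF assms(3)] qy[OF y(1,2)] qy[OF y(3,4)] L2_nonwhite[OF y(1)] L2_nonwhite[OF y(3)] by blast
  qed
qed

lemma E_ex: "p \<in> E \<Longrightarrow> \<exists>q\<in>L3. adj p q" unfolding linked_def by blast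

text \<open>
  Of the two ends of an edge that makes \<open>y\<close> served, the one in \<open>X\<close> is adjacent to
  \<open>y\<close>, hence is the partner of \<open>y\<close>.
\<close>
lemma served_X:
  assumes "y \<in> SV" "x \<in> X" "adj y x"
  shows "x \<in> E"
proof -
  obtain p where p: "p \<in> E" "adj y p" using assms(1) unfolding served_def by blast
  obtain q where q: "q \<in> L3" "adj p q" using E_ex[OF p(1)] by blast
  note e = C_edge[OF E_C[OF p(1)] q]
  have y: "y \<in> U" "y \<in> L2" using assms(1) SV_U U_L2 by blast+
  have qy: "adj y q" using e(3)[OF y(2) adj_sym[OF p(2)]] adj_sym by blast
  from e(2) show ?thesis
  proof
    assume "p \<in> X \<and> q \<in> W"
    then have "p = x" using U_X_unique[OF y(1)] assms p by blast
    then show ?thesis using p by simp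
  next
    assume "q \<in> X \<and> p \<in> W"
    then have "q = x" using U_X_unique[OF y(1)] assms qy by blast
    then show ?thesis using C_edge(1)[OF X_C[OF assms(2)] C_L3[OF E_C[OF p(1)]]] q adj_sym by blast
  qed
qed

text \<open>
  All level-three edges at \<open>p\<close> must end in \<open>X\<close>, and so in the partner
  \<open>x\<close> of \<open>y\<close>.
\<close>
lemma served_E:
  assumes y: "y \<in> SV" and x: "x \<in> X" "adj y x" and p: "p \<in> E" "adj y p" "p \<noteq> x"
  shows "{u. adj p u} = {y, x}"
proof -
  have yU: "y \<in> U" "y \<in> L2" using y SV_U U_L2 by blast+
  have pX: "p \<notin> X" using U_X_unique[OF yU(1) _ x(1) p(2) x(2)] p(3) by blast
  have L3n: "q = x" if q: "q \<in> L3" "adj p q" for q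
  proof -
    note e = C_edge[OF E_C[OF p(1)] q]
    have "q \<in> X" using e(2) pX by blast
    moreover have "adj y q" using e(3)[OF yU(2) adj_sym[OF p(2)]] adj_sym by blast
    ultimately show ?thesis using U_X_unique[OF yU(1)] x by blast
  qed
  obtain q where q: "q \<in> L3" "adj p q" using E_ex[OF p(1)] by blast
  have "u = y \<or> u = x" if "adj p u" for u
    using C_nbr[OF E_C[OF p(1)] that] L3n[OF _ that] U_L2 that
      C_edge(4)[OF E_C[OF p(1)] q _ that yU(2) adj_sym[OF p(2)]] by blast
  moreover have "adj p x" using L3n[OF q] q by simp
  ultimately show ?thesis using adj_sym[OF p(2)] by blast
qed

lemma X_EL: "x \<in> X \<Longrightarrow> x \<in> EL"
  using X_C served_X adj_sym unfolding eligible_def by blast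

definition best :: "'a \<Rightarrow> 'a \<Rightarrow> bool" where
  "best y z \<longleftrightarrow> y \<in> U \<and> z \<in> EL \<and> adj y z \<and> (\<forall>p\<in>EL. adj y p \<longrightarrow> rank p \<le> rank z)"

lemma PK_best: "z \<in> PK \<longleftrightarrow> (\<exists>y. best y z)"
  unfolding picked_def best_def using adj_sym by blast

lemma finite_nb: "p \<in> EL \<Longrightarrow> finite {u. adj p u}"
  using finite_nbrs[of p "\<lambda>_. True"] levels_H(3) C_L3 EL_C by simp

lemma best_ex:
  assumes y: "y \<in> U"
  shows "\<exists>z. best y z"
proof -
  let ?S = "{p\<in>EL. adj y p}"
  have fin: "finite ?S" by (rule finite_subset[OF _ finite_H]) (use levels_H(3) C_L3 EL_C in blast)
  have "?S \<noteq> {}" using U_X[OF y] X_EL by blast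
  then have "Max (rank ` ?S) \<in> rank ` ?S" using fin by simp
  then obtain z where z: "z \<in> ?S" "rank z = Max (rank ` ?S)" by auto
  have "rank p \<le> rank z" if "p \<in> ?S" for p using that fin z(2) by simp
  then show ?thesis using z y unfolding best_def by blast
qed

lemma best_unique: "best y a \<Longrightarrow> best y b \<Longrightarrow> a = b"
  unfolding best_def using rank_inj[of a b] EL_H[of a] EL_H[of b] order_antisym[of "rank a" "rank b"] by blast

lemma best_card: "best y z \<Longrightarrow> p \<in> EL \<Longrightarrow> adj y p \<Longrightarrow> card {u. adj p u} \<le> card {u. adj z u}"
  unfolding best_def using rank_deg EL_H by blast

lemma served_EL: "y \<in> SV \<Longrightarrow> p \<in> EL \<Longrightarrow> adj y p \<Longrightarrow> p \<in> E"
  unfolding eligible_def using adj_sym by blast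

text \<open>
  If a served vertex does not pick its partner \<open>x\<close>, then the picked vertex has degree two by
  the previous lemma, and as its degree is largest, \<open>x\<close> has degree two as well. The two
  vertices are then adjacent and have the same neighbours otherwise, so it does not matter which of them is
  white.
\<close>
lemma served_best:
  assumes y: "y \<in> SV" and b: "best y z" and x: "x \<in> X" "adj y x" and ne: "z \<noteq> x"
  shows "{u. adj x u} = {y, z}"
proof -
  have z: "z \<in> EL" "adj y z" using b unfolding best_def by auto
  have Nz: "{u. adj z u} = {y, x}" by (rule served_E[OF y x served_EL[OF y z] z(2) ne])
  have zx: "adj x z" using Nz adj_sym by blast
  have yz: "y \<noteq> z" using z(2) adj_irrefl by blast
  have "card {u. adj x u} \<le> card {y, x}" using best_card[OF b X_EL[OF x(1)] x(2)] Nz by simp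
  also have "\<dots> \<le> card {y, z}" using yz by (simp add: card_insert_if)
  finally have "{y, z} = {u. adj x u}"
    by (intro card_seteq) (use finite_nb X_EL x zx adj_sym in auto)
  then show ?thesis by simp
qed

text \<open>
  Eligible vertices that are not linked have all their neighbours among the unserved unmatched vertices.
  From here on the problem is to select some of them such that each unserved vertex has exactly one selected
  neighbour; \<open>X\<close> is such a selection.
\<close>
lemma plain:
  assumes "p \<in> EL" "p \<notin> E" "adj p u"
  shows "u \<in> U" "u \<notin> SV"
  using C_nbr[OF EL_C[OF assms(1)] assms(3)] assms unfolding eligible_def by blast+

lemma unserved_EL: "y \<in> U \<Longrightarrow> y \<notin> SV \<Longrightarrow> p \<in> EL \<Longrightarrow> adj y p \<Longrightarrow> p \<notin> E"
  unfolding served_def by blast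

text \<open>
  If \<open>r\<close> shares neighbours with two members of \<open>X\<close>, it has all neighbours of both:
  otherwise \<open>y3, x1, y1, r, y2, x2\<close> is an induced path, because members of \<open>X\<close>
  have no common neighbours.
\<close>
lemma merge:
  assumes r: "r \<in> EL" "r \<notin> E" and x: "x1 \<in> X" "x1 \<notin> E" "x2 \<in> X" "x2 \<notin> E" "x1 \<noteq> x2"
    and y: "adj r y1" "adj x1 y1" "adj r y2" "adj x2 y2"
  shows "{u. adj x1 u} \<subseteq> {u. adj r u}"
proof (intro subsetI CollectI; elim CollectE)
  fix y3 assume y3: "adj x1 y3"
  have x12: "x1 \<in> EL" "x2 \<in> EL" using X_EL x by auto
  have U: "y1 \<in> U" "y2 \<in> U" "y3 \<in> U" using plain r y y3 x12 x by blast+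
  \<comment> \<open>Members of \<open>X\<close> have no common neighbours.\<close>
  have uni: "\<not> adj y x2" if "y \<in> U" "adj x1 y" for y
    using U_X_unique[OF that(1) x(1,3) adj_sym[OF that(2)]] x(5) by blast
  have "\<not> adj x1 y2" using U_X_unique[OF U(2) x(1,3)] adj_sym y(4) x(5) by blast
  moreover have "v \<notin> EL" if "v \<in> U" for v using that U_L2 EL_C C_L3 levels_disjoint by blast
  then have "\<not> adj x1 r" "\<not> adj x1 x2" "\<not> adj r x2" using plain(1) r x x12 by blast+
  ultimately show "adj r y3"
    using no_P6[of y3 x1 y1 r y2 x2] adj_sym[OF y3] y adj_sym[OF y(1)] adj_sym[OF y(4)]
      U_indep U uni y3 adj_commute[of y3 r] by metis
qed

text \<open>
  Suppose \<open>q\<close> has the neighbour \<open>y''\<close> in addition to a common neighbour with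
  \<open>p\<close>. By \<open>merge\<close>, the neighbourhoods of \<open>p\<close> and \<open>q\<close> are
  each contained in the neighbourhood of one member of \<open>X\<close> or unions of several of them. In all
  cases either some vertex \<open>r\<close> has every neighbour of \<open>p\<close> and also
  \<open>y''\<close>, contradicting the largest degree of \<open>p\<close>, or \<open>y3, p, y', q, y'',
  x''\<close> is an induced path.
\<close>
lemma best_covers:
  assumes y: "y \<in> U" "y \<notin> SV" and b: "best y p" and q: "q \<in> EL" "q \<notin> E"
    and y': "adj p y'" "adj q y'"
  shows "{u. adj q u} \<subseteq> {u. adj p u}"
proof (rule ccontr)
  assume "\<not> ?thesis"
  then obtain y'' where y'': "adj q y''" "\<not> adj p y''" by blast
  have p: "p \<in> EL" "p \<notin> E" "adj p y" using b unserved_EL[OF y] adj_sym unfolding best_def by blast+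
  \<comment> \<open>Such an \<open>r\<close> would have been preferred to \<open>p\<close> by \<open>y\<close>.\<close>
  have nobig: False if "r \<in> EL" "{u. adj p u} \<subseteq> {u. adj r u}" "adj r y''" for r
  proof -
    have "adj y r" using that(2) p(3) adj_sym by blast
    then have "{u. adj p u} = {u. adj r u}"
      using card_seteq[OF finite_nb[OF that(1)] that(2)] best_card[OF b that(1)] by blast
    then show False using that(3) y''(2) by blast
  qed
  have U': "y' \<in> U" "y' \<notin> SV" using plain[OF p(1,2) y'(1)] by auto
  have U'': "y'' \<in> U" "y'' \<notin> SV" using plain[OF q y''(1)] by auto
  obtain x' where x': "x' \<in> X" "adj x' y'" using U_X[OF U'(1)] adj_sym by blast
  obtain x'' where x'': "x'' \<in> X" "adj x'' y''" using U_X[OF U''(1)] adj_sym by blast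
  have xE: "x' \<notin> E" "x'' \<notin> E"
    using unserved_EL[OF U' X_EL[OF x'(1)] adj_sym[OF x'(2)]]
      unserved_EL[OF U'' X_EL[OF x''(1)] adj_sym[OF x''(2)]] by auto
  show False
  proof (cases "x' = x''")
    case True
    show False
    proof (cases "{u. adj p u} \<subseteq> {u. adj x' u}")
      case sub: True
      show False using nobig[OF X_EL[OF x'(1)] sub] x'' True by blast
    next
      case False
      then obtain y3 where y3: "adj p y3" "\<not> adj x' y3" by blast
      note U3 = plain[OF p(1,2) y3(1)]
      obtain x3 where x3: "x3 \<in> X" "adj x3 y3" using U_X[OF U3(1)] adj_sym by blast
      have "x3 \<notin> E" using unserved_EL[OF U3 X_EL[OF x3(1)] adj_sym[OF x3(2)]] .
      moreover have "x' \<noteq> x3" using x3 y3 by blast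
      ultimately have "{u. adj x' u} \<subseteq> {u. adj p u}"
        using merge[OF p(1,2) x'(1) xE(1) x3(1) _ _ y'(1) x'(2) y3(1) x3(2)] by blast
      then show False using x'' True y''(2) by blast
    qed
  next
    case ne: False
    have sub: "{u. adj x'' u} \<subseteq> {u. adj q u}"
      using merge[OF q x''(1) xE(2) x'(1) xE(1) _ y''(1) x''(2) y'(2) x'(2)] ne by blast
    show False
    proof (cases "{u. adj p u} \<subseteq> {u. adj q u}")
      case True
      show False using nobig[OF q(1) True y''(1)] .
    next
      case False
      then obtain y3 where y3: "adj p y3" "\<not> adj q y3" by blast
      note U3 = plain[OF p(1,2) y3(1)]
      have n3: "\<not> adj x'' y3" using sub y3 by blast
      have n1: "\<not> adj x'' y'" using U_X_unique[OF U'(1) x'(1) x''(1)] x'(2) adj_sym ne by blast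
      have "v \<notin> EL" if "v \<in> U" for v using that U_L2 EL_C C_L3 levels_disjoint by blast
      then have 2: "\<not> adj p q" "\<not> adj p x''" "\<not> adj q x''"
        using plain(1)[OF p(1,2)] plain(1)[OF q] q X_EL[OF x''(1)] by blast+
      have 3: "\<not> adj y3 y'" "\<not> adj y3 y''" "\<not> adj y' y''" using U_indep U3 U' U'' by blast+
      show False
        by (intro no_P6[of y3 p y' q y'' x''])
          (use 2 3 n1 n3 y3 y' y'' x'' in \<open>simp_all add: adj_commute\<close>)
    qed
  qed
qed

text \<open>
  If an unserved vertex \<open>y\<close> picks \<open>p\<close> and is adjacent to the pick \<open>z\<close>
  of another vertex, then \<open>best_covers\<close> applied at \<open>y\<close> shows that \<open>p\<close>
  was available to that vertex too, so neither of \<open>p\<close> and \<open>z\<close> has the smaller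
  rank, and they are equal. A served vertex has only linked eligible neighbours, and these are adjacent to
  no other unmatched vertex.
\<close>
lemma PK_exact:
  assumes y: "y \<in> U"
  shows "\<exists>!z. z \<in> PK \<and> adj y z"
proof -
  obtain p where p: "best y p" using best_ex[OF y] by blast
  have pPK: "p \<in> PK" "adj y p" "p \<in> EL" using p PK_best unfolding best_def by blast+
  have "z = p" if z: "z \<in> PK" "adj y z" for z
  proof -
    obtain y1 where y1: "best y1 z" using z PK_best by blast
    have zE: "z \<in> EL" "adj z y1" "y1 \<in> U" using y1 adj_sym unfolding best_def by blast+
    show ?thesis
    proof (cases "y \<in> SV")
      case True
      have "z \<in> E" using served_EL[OF True zE(1) z(2)] .
      then have "y1 = y" using C_edge(4)[OF E_C _ _ U_L2[OF zE(3)] zE(2) U_L2[OF y] adj_sym[OF z(2)]] E_ex by blast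
      then show ?thesis using best_unique p y1 by blast
    next
      case False
      have n: "z \<notin> E" "p \<notin> E" using unserved_EL[OF y False] zE z pPK by blast+
      have y1s: "y1 \<notin> SV" using plain(2)[OF zE(1) n(1) zE(2)] .
      have "{u. adj z u} \<subseteq> {u. adj p u}"
        using best_covers[OF y False p zE(1) n(1) adj_sym[OF pPK(2)] adj_sym[OF z(2)]] .
      then have "adj y1 p" using zE(2) adj_sym by blast
      then have "rank p \<le> rank z" using y1 pPK unfolding best_def by blast
      moreover have "rank z \<le> rank p" using p zE(1) z(2) unfolding best_def by blast
      ultimately show ?thesis using rank_inj[of z p] EL_H[OF zE(1)] EL_H[OF pPK(3)] by simp
    qed
  qed
  then show ?thesis using pPK by blast
qed

text \<open>
  One end is the partner \<open>x\<close> of a common neighbour \<open>y\<close> of both ends. If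
  \<open>y\<close> picks another vertex, the only neighbours of \<open>x\<close> are \<open>y\<close> and
  this vertex, which is therefore the other end.
\<close>
lemma PK_edge:
  assumes p: "p \<in> C" and q: "q \<in> L3" "adj p q"
  shows "p \<in> PK \<longleftrightarrow> q \<notin> PK"
proof -
  note e = C_edge[OF p q]
  obtain y where y: "y \<in> U" "adj p y" using C_U[OF p] by blast
  have yL: "y \<in> L2" using U_L2[OF y(1)] .
  have qy: "adj y q" "adj y p" using e(3)[OF yL y(2)] y adj_sym by blast+
  have s: "y \<in> SV" unfolding served_def using y(1) e(1) qy by blast
  have "\<not> (p \<in> PK \<and> q \<in> PK)" using PK_exact[OF y(1)] qy q adj_irrefl by blast
  moreover have "p \<in> PK \<or> q \<in> PK"
  proof -
    obtain z where z: "best y z" using best_ex[OF y(1)] by blast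
    then have zP: "z \<in> PK" using PK_best by blast
    obtain x where x: "x \<in> X" "adj y x" using U_X[OF y(1)] by blast
    have pq: "p = x \<or> q = x" using e(2) U_X_unique[OF y(1)] x qy by blast
    show ?thesis
    proof (cases "z = x")
      case False
      have "{u. adj x u} = {y, z}" by (rule served_best[OF s z x False])
      then have "u = z" if "adj x u" "u \<in> L3" for u
      proof -
        have "u \<in> {y, z}" using \<open>{u. adj x u} = {y, z}\<close> that(1) by blast
        then show ?thesis using levels_disjoint(3)[OF that(2)] yL by blast
      qed
      then show ?thesis using pq zP q adj_sym[OF q(2)] C_L3[OF p] by blast
    qed (use pq zP in blast)
  qed
  ultimately show ?thesis by blast
qed

lemma PK_L3: "p \<in> PK \<Longrightarrow> p \<in> L3" using PK_EL EL_C C_L3 by blast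

abbreviation "W' \<equiv> around_block adj rank D"

lemma W'_iff: "v \<in> W' \<longleftrightarrow> v \<in> L1 \<or> (v \<in> L3 \<and> v \<notin> PK)" unfolding around_block_def by blast

text \<open>
  The old and the new white set differ on level three only, so only vertices of this level and unmatched
  vertices can have different nonwhite neighbours in the two.
\<close>
lemma same_outside: "v \<in> H \<Longrightarrow> v \<notin> L3 \<Longrightarrow> v \<in> W' \<longleftrightarrow> v \<in> W"
  using L1_white D_W L2_nonwhite outside_nonwhite W'_iff by blast

lemma not_C_same: "v \<in> L3 \<Longrightarrow> v \<notin> C \<Longrightarrow> v \<in> W' \<and> v \<in> W"
  using W'_iff X_C PK_EL EL_C by blast

lemma same_nbrs:
  assumes v: "v \<in> H" "v \<notin> L1" "v \<notin> L3" "v \<notin> U" and u: "adj v u"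
  shows "u \<in> W' \<longleftrightarrow> u \<in> W"
proof (cases "u \<in> L3")
  case True
  have "u \<notin> C"
  proof
    assume "u \<in> C"
    then show False using C_nbr[OF _ adj_sym[OF u]] v by blast
  qed
  then show ?thesis using not_C_same[OF True] by blast
next
  case False
  then show ?thesis using same_outside closed[OF v(1) u] by blast
qed

lemma U_nbrs: "y \<in> U \<Longrightarrow> adj y u \<Longrightarrow> u \<notin> W' \<longleftrightarrow> u \<in> PK"
  using nbr2[OF U_L2, of y u] W'_iff PK_L3 levels_disjoint unfolding unmatched_def by blast

lemma L3_nonwhite_nbrs:
  assumes "z \<in> PK" "adj z u"
  shows "u \<notin> W' \<longleftrightarrow> u \<in> U"
  using C_nbr[OF EL_C[OF PK_EL[OF assms(1)]] assms(2)] PK_edge[OF EL_C[OF PK_EL[OF assms(1)]] _ assms(2)]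
    assms(1) W'_iff U_L2 levels_disjoint by blast

lemma X_nonwhite_nbrs:
  assumes "x \<in> X" "adj x u"
  shows "u \<notin> W \<longleftrightarrow> u \<in> U"
  using C_nbr[OF X_C[OF assms(1)] assms(2)] C_edge(2)[OF X_C[OF assms(1)] _ assms(2)]
    assms(1) U_L2 L2_nonwhite levels_disjoint by blast

theorem around_block_valid: "white_set_on adj H W'"
  unfolding white_set_on_def
proof (intro conjI ballI impI)
  show "W' \<subseteq> H" using W'_iff levels_H by blast
  fix u v assume uv: "u \<in> W'" "v \<in> W'"
  show "\<not> adj u v"
  proof
    assume a: "adj u v"
    show False
    proof (cases "u \<in> L3 \<and> v \<in> L3")
      case True
      have "u \<notin> C" using PK_edge[of u v] a uv True W'_iff levels_disjoint by blast
      moreover have "v \<notin> C" using PK_edge[of v u] adj_sym[OF a] uv True W'_iff levels_disjoint by blast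
      ultimately show False using not_C_same True white_indep a by blast
    next
      case False
      then have "u \<in> L1 \<or> v \<in> L1" using uv W'_iff by blast
      then have "u \<in> L1 \<and> v \<in> L1" using nbr1[of u v] nbr1[of v u] a adj_sym[OF a] uv W'_iff levels_disjoint by blast
      then show False using L1_white white_indep a by blast
    qed
  qed
next
  fix v assume v: "v \<in> H - W'" and "\<exists>w\<in>W'. adj v w"
  then obtain w where w: "w \<in> W'" "adj v w" by blast
  have v1: "v \<notin> L1" using v W'_iff by blast
  consider "v \<in> U" | "v \<in> L3" | "v \<notin> U" "v \<notin> L3" by blast
  then show "\<exists>!u. adj v u \<and> u \<notin> W'"
  proof cases
    case 1
    then show ?thesis using U_nbrs[OF 1] PK_exact[OF 1] by blast
  next
    case 2
    then have vP: "v \<in> PK" using v W'_iff by blast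
    note vC = EL_C[OF PK_EL[OF vP]]
    have "w \<notin> U" using L3_nonwhite_nbrs[OF vP w(2)] w(1) by blast
    then have wL: "w \<in> L3" using C_nbr[OF vC w(2)] by blast
    obtain y where y: "y \<in> U" "adj v y" using C_U[OF vC] by blast
    show ?thesis using L3_nonwhite_nbrs[OF vP] y C_edge(4)[OF vC wL w(2)] U_L2 by blast
  next
    case 3
    have same: "adj v u \<Longrightarrow> u \<in> W' \<longleftrightarrow> u \<in> W" for u using same_nbrs v v1 3 by blast
    have "v \<notin> W" using same_outside v 3 by blast
    then show ?thesis using white_nbr[of v w] same w by blast
  qed
qed

text \<open>
  Outside levels one and three the nonwhite degrees agree. The nonwhite neighbours of \<open>X\<close> and
  of \<open>PK\<close> are unmatched vertices, each of which is counted exactly once.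
\<close>
theorem around_block_cost: "cost adj H W' = cost adj H W"
proof -
  define R where "R = H - L1 - L3"
  have fin: "finite U" "finite R" "finite X" "finite PK"
    unfolding R_def by (rule finite_subset[OF _ finite_H], use levels_H U_L2 PK_L3 in blast)+
  have HW: "H - W = R \<union> X" "R \<inter> X = {}"
    unfolding R_def using L1_white same_outside W'_iff levels_H by blast+
  have HW': "H - W' = R \<union> PK" "R \<inter> PK = {}"
    unfolding R_def using W'_iff levels_H PK_L3 levels_disjoint by blast+
  have R: "card {u. adj v u \<and> u \<notin> W'} = card {u. adj v u \<and> u \<notin> W}" if v: "v \<in> R" for v
  proof (cases "v \<in> U")
    case True
    have "\<exists>!u. adj v u \<and> u \<notin> W'" using U_nbrs[OF True] PK_exact[OF True] by blast
    then have "card {u. adj v u \<and> u \<notin> W'} = 1" by (auto simp: card_1_singleton_iff)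
    moreover have "\<exists>!u. adj v u \<and> u \<notin> W"
      using L2_white_nbr[OF U_L2[OF True]] white_nbr[OF L2_nonwhite[OF U_L2[OF True]]] by blast
    then have "card {u. adj v u \<and> u \<notin> W} = 1" by (auto simp: card_1_singleton_iff)
    ultimately show ?thesis by simp
  next
    case False
    have "{u. adj v u \<and> u \<notin> W'} = {u. adj v u \<and> u \<notin> W}"
      using same_nbrs[OF _ _ _ False] v unfolding R_def by blast
    then show ?thesis by simp
  qed
  have dc: "(\<Sum>x\<in>Z. card {u\<in>U. adj x u}) = card U"
    if Z: "finite Z" "\<And>y. y \<in> U \<Longrightarrow> \<exists>!x. x \<in> Z \<and> adj y x" for Z
  proof -
    have "card {x\<in>Z. adj x y} = 1" if "y \<in> U" for y
      using Z(2)[OF that] by (auto simp: card_1_singleton_iff adj_commute[of _ y])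
    then have "(\<Sum>x\<in>Z. card {u\<in>U. adj x u}) = (\<Sum>y\<in>U. 1)"
      by (intro sum_multicount_gen) (use Z(1) fin in auto)
    then show ?thesis by simp
  qed
  have "(\<Sum>z\<in>PK. card {u. adj z u \<and> u \<notin> W'}) = (\<Sum>z\<in>PK. card {u\<in>U. adj z u})"
    by (intro sum.cong arg_cong[of _ _ card]) (use L3_nonwhite_nbrs in blast)+
  also have "\<dots> = card U" by (rule dc[OF fin(4) PK_exact])
  also have "\<dots> = (\<Sum>x\<in>X. card {u\<in>U. adj x u})" by (rule dc[OF fin(3) U_X, symmetric])
  also have "\<dots> = (\<Sum>x\<in>X. card {u. adj x u \<and> u \<notin> W})"
    by (intro sum.cong arg_cong[of _ _ card]) (use X_nonwhite_nbrs in blast)+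
  finally show ?thesis
    unfolding cost_def HW HW' using fin HW(2) HW'(2) R by (simp add: sum.union_disjoint)
qed

end

section \<open>Some candidate is as good as any white set\<close>

context white_set begin

definition improves :: "'a set \<Rightarrow> bool" where
  "improves Z \<longleftrightarrow> white_set_on adj H Z \<and> cost adj H Z \<le> cost adj H W"

lemma rooted_improves:
  assumes "D \<subseteq> H - W" "\<And>v u. v \<in> D \<Longrightarrow> adj v u \<Longrightarrow> u \<notin> W \<Longrightarrow> u \<in> D" "D \<noteq> {}"
    and "\<And>y. y \<in> unmatched adj D \<Longrightarrow>
      \<exists>a\<in>D. \<exists>b\<in>D. \<exists>w\<in>level1 adj D. adj a b \<and> adj b w \<and> adj w y \<and> \<not> adj a w"
    and "degree_rank adj H rank"
  shows "improves (around_block adj rank D)"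
proof -
  interpret rooted adj H W D rank by unfold_locales (use assms in blast)+
  show ?thesis using around_block_valid around_block_cost unfolding improves_def by simp
qed

lemma black_edge_improves:
  assumes b: "b1 \<in> H" "adj b1 b2" "black b1" "black b2" and ne: "W \<noteq> {}"
  shows "\<exists>g\<in>H. improves (around_core adj g) \<or> improves (around_white adj g)"
proof -
  have W: "b1 \<notin> W" "b2 \<notin> W" using b unfolding black_def by auto
  obtain D where D: "graph_component nadj D" "b1 \<in> D" "D \<subseteq> H - W"
    by (rule nonwhite_component_ex[OF b(1) W(1)])
  have "b2 \<in> D" by (rule graph_component_closed[OF D(1,2)]) (use W b nadj_def in simp)
  then interpret black_edge adj H W D b1 b2 by unfold_locales (use D b in auto)
  show ?thesis using black_edge_candidate[OF ne] unfolding improves_def .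
qed

text \<open>
  Since no two black vertices are adjacent, the neighbours of \<open>d\<close> have no other nonwhite
  neighbours. A path into this block passes through a neighbour \<open>b\<close> of \<open>d\<close> and can
  be continued to \<open>d\<close>.
\<close>
lemma star_improves:
  assumes d: "d \<in> H" "black d" and nb: "\<And>v. adj v d \<Longrightarrow> \<not> black v"
    and r: "degree_rank adj H rank"
  shows "improves (around_block adj rank (insert d {v. adj v d}))"
proof (rule rooted_improves[OF _ _ _ _ r])
  let ?D = "insert d {v. adj v d}"
  have dW: "d \<notin> W" using d unfolding black_def by blast
  have nW: "v \<notin> W" if "adj v d" for v using black_white[OF d(2)] that by blast
  show "?D \<subseteq> H - W" using d(1) dW nW closed adj_sym by auto
  show "?D \<noteq> {}" by simp
  show "u \<in> ?D" if v: "v \<in> ?D" "adj v u" "u \<notin> W" for v u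
  proof (cases "v = d \<or> u = d")
    case False
    then have "adj v d" using v by simp
    then show ?thesis using blackI[of v d u] nb nW dW v False by blast
  qed (use v adj_sym in auto)
  fix y assume "y \<in> unmatched adj ?D"
  then obtain w where w: "w \<in> level1 adj ?D" "adj y w" unfolding unmatched_def level2_def by blast
  then obtain b where b: "b \<in> ?D" "adj w b" "w \<notin> ?D" unfolding level1_def by blast
  have "\<not> adj d w" "b \<noteq> d" using b adj_sym by blast+
  then show "\<exists>a\<in>?D. \<exists>b\<in>?D. \<exists>w\<in>level1 adj ?D. adj a b \<and> adj b w \<and> adj w y \<and> \<not> adj a w"
    using w b adj_sym by blast
qed

end

locale all_pairs = white_set +
  assumes no_black: "v \<in> H \<Longrightarrow> \<not> black v"
begin

lemma pair_unique: "v \<in> H \<Longrightarrow> v \<notin> W \<Longrightarrow> adj v a \<Longrightarrow> a \<notin> W \<Longrightarrow> adj v b \<Longrightarrow> b \<notin> W \<Longrightarrow> a = b"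
  using no_black[of v] blackI[of v a b] by blast

lemma pair_ex:
  assumes "v \<in> H" "v \<notin> W" "adj v n"
  shows "\<exists>p. adj v p \<and> p \<notin> W"
  using assms partner_ex[of v n] by (cases "n \<in> W") blast+

text \<open>
  A single edge is a suitable block if each unmatched vertex can be reached by way of a vertex
  \<open>w\<close> that is adjacent to only one end of the edge. This always holds if the edge is in no
  triangle.
\<close>
lemma pair_improves:
  assumes x: "x \<in> H" "x \<notin> W" and y: "adj x y" "y \<notin> W"
    and half: "\<And>z. z \<in> unmatched adj {x, y} \<Longrightarrow>
      \<exists>w\<in>level1 adj {x, y}. adj w z \<and> \<not> (adj x w \<and> adj y w)"
    and r: "degree_rank adj H rank"
  shows "improves (around_block adj rank {x, y})"
proof (rule rooted_improves[OF _ _ _ _ r])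
  have yH: "y \<in> H" using closed x y by blast
  show "{x, y} \<subseteq> H - W" using x y yH by blast
  show "{x, y} \<noteq> {}" by simp
  show "u \<in> {x, y}" if "v \<in> {x, y}" "adj v u" "u \<notin> W" for v u
    using that pair_unique[OF x y _ that(3)] pair_unique[OF yH y(2) adj_sym[OF y(1)] x(2) _ that(3)] by blast
  fix z assume "z \<in> unmatched adj {x, y}"
  from half[OF this] obtain w where w: "w \<in> level1 adj {x, y}" "adj w z" "\<not> (adj x w \<and> adj y w)" by blast
  then have "adj x w \<or> adj y w" unfolding level1_def using adj_sym by blast
  then show "\<exists>a\<in>{x, y}. \<exists>b\<in>{x, y}. \<exists>w\<in>level1 adj {x, y}. adj a b \<and> adj b w \<and> adj w z \<and> \<not> adj a w"
    using w y(1) adj_sym by blast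
qed

lemma pair_lev1_white:
  assumes x: "x \<in> H" "x \<notin> W" and y: "adj x y" "y \<notin> W" and w: "w \<in> level1 adj {x, y}"
  shows "w \<in> W"
proof (rule ccontr)
  assume "w \<notin> W"
  have yH: "y \<in> H" using closed x y by blast
  have "adj x w \<or> adj y w" "w \<noteq> x" "w \<noteq> y" using w unfolding level1_def using adj_sym by blast+
  then show False
    using pair_unique[OF x y _ \<open>w \<notin> W\<close>] pair_unique[OF yH y(2) adj_sym[OF y(1)] x(2) _ \<open>w \<notin> W\<close>] by blast
qed

text \<open>
  If the edge \<open>x y\<close> has an unmatched vertex \<open>y1\<close> at distance two, then
  \<open>y1\<close> with its partner \<open>p1\<close> is a suitable block. Otherwise some \<open>z\<close>
  is reached from it only by vertices \<open>w\<close> adjacent to both \<open>y1\<close> and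
  \<open>p1\<close>. With the partner \<open>p\<close> of \<open>z\<close> and a vertex \<open>n1\<close>
  that links \<open>y1\<close> to an end \<open>a\<close> of \<open>x y\<close>, the path \<open>a, n1, y1,
  w, z, p\<close> is induced.
\<close>
lemma second_root:
  assumes x: "x \<in> H" "x \<notin> W" and y: "adj x y" "y \<notin> W"
    and y1: "y1 \<in> unmatched adj {x, y}"
  shows "\<exists>p1. p1 \<notin> W \<and> adj y1 p1 \<and> y1 \<in> H \<and> y1 \<notin> W \<and> (\<forall>z \<in> unmatched adj {y1, p1}.
      \<exists>w\<in>level1 adj {y1, p1}. adj w z \<and> \<not> (adj y1 w \<and> adj p1 w))"
proof -
  have yH: "y \<in> H" using closed x y by blast
  obtain n1 where n1: "n1 \<in> level1 adj {x, y}" "adj y1 n1"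
    and y1': "y1 \<noteq> x" "y1 \<noteq> y" "y1 \<notin> level1 adj {x, y}" "y1 \<in> level2 adj {x, y}"
    and y1u: "\<And>u. u \<in> level2 adj {x, y} \<Longrightarrow> \<not> adj y1 u"
    using y1 unfolding unmatched_def level2_def by blast
  have n1W: "n1 \<in> W" by (rule pair_lev1_white[OF x y n1(1)])
  have y1H: "y1 \<in> H" "y1 \<notin> W"
    using W_sub n1W closed adj_sym n1 white_indep by blast+
  obtain p1 where p1: "adj y1 p1" "p1 \<notin> W" using partner_ex[OF y1H(2) n1W n1(2)] by blast
  have p1H: "p1 \<in> H" using closed y1H p1 by blast
  have u1: "a = p1" if "adj y1 a" "a \<notin> W" for a using pair_unique[OF y1H that p1] by simp
  have up: "a = y1" if "adj p1 a" "a \<notin> W" for a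
    using pair_unique[OF p1H p1(2) that adj_sym[OF p1(1)] y1H(2)] .
  have ux: "a = y" if "adj x a" "a \<notin> W" for a using pair_unique[OF x that y] by simp
  have uy: "a = x" if "adj y a" "a \<notin> W" for a
    using pair_unique[OF yH y(2) that adj_sym[OF y(1)] x(2)] .
  have xy1: "\<not> adj x y1" "\<not> adj y y1" using ux uy y1H y1' by blast+
  have p1n: "p1 \<noteq> x" "p1 \<noteq> y" using p1 xy1 adj_sym by blast+
  have p1l: "p1 \<notin> level1 adj {x, y}" using pair_lev1_white[OF x y] p1 by blast
  have far: "\<not> adj p1 w" if "w \<in> level1 adj {x, y}" for w
  proof
    assume "adj p1 w"
    then have "p1 \<in> level2 adj {x, y}" using that p1n p1l unfolding level2_def by blast
    then show False using y1u p1 by blast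
  qed
  have twin_far: "\<not> adj x w \<and> \<not> adj y w" if "adj p1 w" for w
  proof (rule ccontr)
    assume "\<not> ?thesis"
    then have "w = x \<or> w = y \<or> w \<in> level1 adj {x, y}" unfolding level1_def using adj_sym by blast
    then show False using far[of w] that up y1' x y by blast
  qed
  have "\<exists>w\<in>level1 adj {y1, p1}. adj w z \<and> \<not> (adj y1 w \<and> adj p1 w)"
    if z: "z \<in> unmatched adj {y1, p1}" for z
  proof (rule ccontr)
    assume no: "\<not> ?thesis"
    obtain w where w: "w \<in> level1 adj {y1, p1}" "adj z w"
      and z': "z \<noteq> y1" "z \<noteq> p1" "z \<notin> level1 adj {y1, p1}"
      and zu: "\<And>u. u \<in> level2 adj {y1, p1} \<Longrightarrow> \<not> adj z u"
      using z unfolding unmatched_def level2_def by blast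
    have wt: "adj y1 w" "adj p1 w" using no w adj_sym by blast+
    have wW: "w \<in> W" by (rule pair_lev1_white[OF y1H p1 w(1)])
    have zH: "z \<in> H" "z \<notin> W" using W_sub wW closed adj_sym w(2) white_indep by blast+
    have zxy: "z \<noteq> x" "z \<noteq> y" using twin_far[OF wt(2)] w(2) by blast+
    obtain p where p: "adj z p" "p \<notin> W" using partner_ex[OF zH(2) wW w(2)] by blast
    have n1p: "\<not> adj n1 p1" "\<not> adj p1 n1" using far[OF n1(1)] adj_sym by blast+
    have "n1 \<noteq> y1" "n1 \<noteq> p1" using n1W y1H p1 by blast+
    then have n1l: "n1 \<in> level1 adj {y1, p1}"
      unfolding level1_def using adj_sym[OF n1(2)] by blast
    have n1z: "\<not> adj n1 z" using no n1l n1p by blast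
    have upz: "a = z" if "adj p a" "a \<notin> W" for a
      using pair_unique[OF closed[OF zH(1) p(1)] p(2) that adj_sym[OF p(1)] zH(2)] .
    have pne: "p \<noteq> y1" "p \<noteq> p1" using u1 up p(1) adj_sym zH(2) z' by blast+
    have pl: "p \<notin> level1 adj {y1, p1}" using pair_lev1_white[OF y1H p1] p by blast
    have pfar: "\<not> adj v p" if "v \<in> level1 adj {y1, p1}" for v
    proof
      assume "adj v p"
      then have "p \<in> level2 adj {y1, p1}" unfolding level2_def using that pne pl adj_sym by blast
      then show False using zu p by blast
    qed
    have wn1: "\<not> adj n1 w" using white_indep n1W wW by blast
    have y1z: "\<not> adj y1 z" "\<not> adj y1 p" using u1 zH z' p pne by blast+
    have gen: False if a: "a = x \<or> a = y" and an: "adj a n1" for a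
    proof -
      have "\<not> adj a y1" "\<not> adj a w" using a xy1 twin_far[OF wt(2)] by blast+
      moreover have "\<not> adj a z" using a ux[of z] uy[of z] zH zxy by blast
      moreover have "a = z" if "adj a p"
      proof (rule upz)
        show "adj p a" using that by (rule adj_sym)
        show "a \<notin> W" using a x y by blast
      qed
      then have "\<not> adj a p" using a zxy by blast
      ultimately have "\<not> adj a y1" "\<not> adj a w" "\<not> adj a z" "\<not> adj a p" by blast+
      then show False
        by (intro no_P6[of a n1 y1 w z p])
          (use an n1(2) wt w p n1z wn1 y1z pfar[OF n1l] pfar[OF w(1)] in \<open>simp_all add: adj_commute\<close>)
    qed
    have "adj x n1 \<or> adj y n1" using n1(1) adj_sym unfolding level1_def by blast
    then show False using gen by blast
  qed
  then show ?thesis using p1 y1H by blast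
qed

text \<open>
  One end of an edge \<open>u v\<close> is nonwhite, say \<open>x\<close>; let \<open>y\<close> be its
  partner. If \<open>x y\<close> is in no triangle, it is a suitable block, of which one end is known. If it
  is, every triangle at \<open>x\<close> contains \<open>y\<close>, so \<open>y\<close> is one of two known
  vertices, and \<open>second_root\<close> provides a block of which one end is known. In either case it
  remains to guess the other end.
\<close>
lemma pairs_improve:
  assumes uv: "u \<in> H" "adj u v" and r: "degree_rank adj H rank"
    and tri: "\<And>x b c. adj x b \<Longrightarrow> adj x c \<Longrightarrow> adj b c \<Longrightarrow> adj x (t1 x) \<and> adj x (t2 x) \<and> adj (t1 x) (t2 x)"
    and some_unmatched: "\<And>x y. unmatched adj {x, y} \<noteq> {} \<Longrightarrow> some_unmatched x y \<in> unmatched adj {x, y}"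
  shows "\<exists>g\<in>H. \<exists>f\<in>{u, v, some_unmatched u (t1 u), some_unmatched u (t2 u), some_unmatched v (t1 v), some_unmatched v (t2 v)}.
    improves (around_block adj rank {f, g})"
proof -
  have "v \<in> H" using uv closed by blast
  have "u \<notin> W \<or> v \<notin> W" using white_indep uv by blast
  then obtain x n where x: "x \<in> {u, v}" "x \<notin> W" "x \<in> H" "adj x n" using uv \<open>v \<in> H\<close> adj_sym by blast
  obtain y where y: "adj x y" "y \<notin> W" using pair_ex[OF x(3,2,4)] by blast
  have yH: "y \<in> H" using closed x y by blast
  show ?thesis
  proof (cases "\<exists>c. adj x c \<and> adj y c")
    case False
    have "improves (around_block adj rank {x, y})"
    proof (rule pair_improves[OF x(3,2) y _ r])
      fix z assume "z \<in> unmatched adj {x, y}"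
      then show "\<exists>w\<in>level1 adj {x, y}. adj w z \<and> \<not> (adj x w \<and> adj y w)"
        using False adj_sym unfolding unmatched_def level2_def by blast
    qed
    then show ?thesis using x(1) yH by blast
  next
    case True
    then have t: "adj x (t1 x)" "adj x (t2 x)" "adj (t1 x) (t2 x)" using tri[of x y] y by blast+
    have "t1 x \<notin> W \<or> t2 x \<notin> W" using t white_indep by blast
    then have yt: "y = t1 x \<or> y = t2 x" using pair_unique[OF x(3,2) y] t by blast
    show ?thesis
    proof (cases "unmatched adj {x, y} = {}")
      case True
      have "improves (around_block adj rank {x, y})"
        by (rule pair_improves[OF x(3,2) y _ r]) (use True in blast)
      then show ?thesis using x(1) yH by blast
    next
      case False
      obtain p1 where p1: "p1 \<notin> W" "adj (some_unmatched x y) p1" "some_unmatched x y \<in> H" "some_unmatched x y \<notin> W"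
        "\<forall>z \<in> unmatched adj {some_unmatched x y, p1}.
           \<exists>w\<in>level1 adj {some_unmatched x y, p1}. adj w z \<and> \<not> (adj (some_unmatched x y) w \<and> adj p1 w)"
        using second_root[OF x(3,2) y some_unmatched[OF False]] by blast
      have "improves (around_block adj rank {some_unmatched x y, p1})"
        by (rule pair_improves[OF p1(3,4,2,1) _ r]) (use p1(5) in blast)
      moreover have "p1 \<in> H" using closed p1 by blast
      moreover have "some_unmatched x y \<in> {u, v, some_unmatched u (t1 u), some_unmatched u (t2 u), some_unmatched v (t1 v), some_unmatched v (t2 v)}"
        using yt x(1) by auto
      ultimately show ?thesis by blast
    qed
  qed
qed

end

context white_set begin

theorem some_candidate_improves:
  assumes u: "u \<in> H" and v: "\<And>x. adj u x \<Longrightarrow> adj u v" and r: "degree_rank adj H rank"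
    and tri: "\<And>x b c. adj x b \<Longrightarrow> adj x c \<Longrightarrow> adj b c \<Longrightarrow> adj x (t1 x) \<and> adj x (t2 x) \<and> adj (t1 x) (t2 x)"
    and some_unmatched: "\<And>x y. unmatched adj {x, y} \<noteq> {} \<Longrightarrow> some_unmatched x y \<in> unmatched adj {x, y}"
  shows "improves {} \<or> (\<exists>g\<in>H. improves (around_core adj g) \<or> improves (around_white adj g) \<or>
      improves (around_block adj rank (insert g {v. adj v g})) \<or>
      (\<exists>f\<in>{u, v, some_unmatched u (t1 u), some_unmatched u (t2 u), some_unmatched v (t1 v), some_unmatched v (t2 v)}. improves (around_block adj rank {f, g})))"
proof (cases "W = {}")
  case True
  then show ?thesis using white_W unfolding improves_def by simp
next
  case False
  show ?thesis
  proof (cases "\<exists>x. adj u x")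
    case no: False
    have "H \<subseteq> {u}" by (rule graph_component_connected[OF comp u]) (use no in auto)
    then have "cost adj H {} = 0" unfolding cost_def using no by (auto intro!: sum.neutral)
    then have "improves {}" unfolding improves_def white_set_on_def by simp
    then show ?thesis ..
  next
    case True
    then have uv: "adj u v" using v by blast
    show ?thesis
    proof (cases "\<exists>b1\<in>H. \<exists>b2. adj b1 b2 \<and> black b1 \<and> black b2")
      case True
      then show ?thesis using black_edge_improves False by blast
    next
      case nobb: False
      show ?thesis
      proof (cases "\<exists>d\<in>H. black d")
        case True
        then obtain d where d: "d \<in> H" "black d" by blast
        have "\<not> black v" if "adj v d" for v using nobb d adj_sym[OF that] by blast
        then show ?thesis using star_improves[OF d _ r] d by blast
      next
        case False
        then interpret all_pairs adj H W by unfold_locales blast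
        show ?thesis
        proof -
          have "\<exists>g\<in>H. \<exists>f\<in>{u, v, some_unmatched u (t1 u), some_unmatched u (t2 u), some_unmatched v (t1 v), some_unmatched v (t2 v)}.
              improves (around_block adj rank {f, g})"
            by (rule pairs_improve[OF u uv r]) (fact tri, fact some_unmatched)
          then show ?thesis by blast
        qed
      qed
    qed
  qed
qed

end

section \<open>Perfect edge dominating sets as white sets\<close>

definition graph_adj :: "nat graph \<Rightarrow> nat \<Rightarrow> nat \<Rightarrow> bool" where
  "graph_adj G u v \<longleftrightarrow> {u, v} \<in> edges G"

text \<open>
  The default zero for the empty set is the value of a maximum that the program accumulates from zero. It
  may name an unrelated vertex, but candidates built from it are tested before they are used.
\<close>
definition largest :: "nat set \<Rightarrow> nat" where "largest S = Max (insert 0 S)"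

lemma largest_in: "finite S \<Longrightarrow> S \<noteq> {} \<Longrightarrow> largest S \<in> S"
  unfolding largest_def by (cases "0 \<in> S") (auto simp: insert_absorb Max_insert)

definition some_nbr :: "(nat \<Rightarrow> nat \<Rightarrow> bool) \<Rightarrow> nat \<Rightarrow> nat" where "some_nbr adj u = largest {v. adj u v}"
definition triangle_left :: "(nat \<Rightarrow> nat \<Rightarrow> bool) \<Rightarrow> nat \<Rightarrow> nat" where
  "triangle_left adj x = largest {b. adj x b \<and> (\<exists>c. adj x c \<and> adj b c)}"
definition triangle_right :: "(nat \<Rightarrow> nat \<Rightarrow> bool) \<Rightarrow> nat \<Rightarrow> nat" where
  "triangle_right adj x = largest {c. adj x c \<and> adj (triangle_left adj x) c}"
definition some_unmatched :: "(nat \<Rightarrow> nat \<Rightarrow> bool) \<Rightarrow> nat \<Rightarrow> nat \<Rightarrow> nat" where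
  "some_unmatched adj x y = largest (unmatched adj {x, y})"

text \<open>
  The increment keeps every rank apart from zero, the maximum over no vertices.
\<close>
definition degree_key :: "(nat \<Rightarrow> nat \<Rightarrow> bool) \<Rightarrow> nat \<Rightarrow> nat \<Rightarrow> nat" where
  "degree_key adj n v = card {u. adj v u} * n + v + 1"

definition component_of :: "(nat \<Rightarrow> nat \<Rightarrow> bool) \<Rightarrow> nat \<Rightarrow> nat set" where
  "component_of adj g = spread4 adj {} {g}"

text \<open>
  Candidates for the known end of a block that is a single edge; they depend on the component only.
\<close>
definition roots :: "(nat \<Rightarrow> nat \<Rightarrow> bool) \<Rightarrow> nat \<Rightarrow> nat set" where
  "roots adj g = (let u = largest (component_of adj g); v = some_nbr adj u in
     {u, v, some_unmatched adj u (triangle_left adj u), some_unmatched adj u (triangle_right adj u), some_unmatched adj v (triangle_left adj v), some_unmatched adj v (triangle_right adj v)})"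

definition candidates :: "(nat \<Rightarrow> nat \<Rightarrow> bool) \<Rightarrow> nat \<Rightarrow> nat \<Rightarrow> nat set set" where
  "candidates adj n g = {around_core adj g, around_white adj g, around_block adj (degree_key adj n) (insert g {v. adj v g})} \<union>
     (\<lambda>f. around_block adj (degree_key adj n) {f, g}) ` roots adj g"

definition uncovered_edges :: "nat graph \<Rightarrow> nat set \<Rightarrow> nat set set" where
  "uncovered_edges G W = {e \<in> edges G. e \<inter> W = {}}"

text \<open>
  The vertices are distinct because no two vertices of a six-vertex path have the same neighbours.
\<close>
lemma P6_free_no_P6:
  assumes G: "simple_graph G" "P6_free G"
    and e: "graph_adj G a b" "graph_adj G b c" "graph_adj G c d" "graph_adj G d e" "graph_adj G e f"
    and ne: "\<not> graph_adj G a c" "\<not> graph_adj G a d" "\<not> graph_adj G a e" "\<not> graph_adj G a f" "\<not> graph_adj G b d"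
      "\<not> graph_adj G b e" "\<not> graph_adj G b f" "\<not> graph_adj G c e" "\<not> graph_adj G c f" "\<not> graph_adj G d f"
  shows False
proof -
  have sym: "graph_adj G u v = graph_adj G v u" for u v unfolding graph_adj_def by (simp add: insert_commute)
  have irr: "\<not> graph_adj G u u" for u using G unfolding graph_adj_def simple_graph_def by auto
  have inV: "u \<in> verts G" if "graph_adj G u v" for u v using that G unfolding graph_adj_def simple_graph_def by auto
  define xs where "xs = [a, b, c, d, e, f]"
  have six: "i = 0 \<or> i = 1 \<or> i = 2 \<or> i = 3 \<or> i = 4 \<or> i = 5" if "i < 6" for i :: nat using that by linarith
  have len: "length xs = 6" unfolding xs_def by simp
  have A: "graph_adj G (xs ! i) (xs ! j) \<longleftrightarrow> Suc i = j \<or> Suc j = i" if "i < 6" "j < 6" for i j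
    using six[OF that(1)] six[OF that(2)] unfolding xs_def
    by (elim disjE; hypsubst) (use e ne irr sym in auto)
  have dist: "distinct xs"
  proof -
    have "i = j" if ij: "i < 6" "j < 6" "xs ! i = xs ! j" for i j
    proof -
      have *: "Suc i = k \<or> Suc k = i \<longleftrightarrow> Suc j = k \<or> Suc k = j" if "k < 6" for k
        using A[OF ij(1) that] A[OF ij(2) that] ij(3) by simp
      show ?thesis using *[of 0] *[of 1] *[of 2] *[of 3] *[of 4] *[of 5] six[OF ij(1)] six[OF ij(2)]
        by (elim disjE) simp_all
    qed
    then show ?thesis using len by (simp add: distinct_conv_nth) blast
  qed
  let ?X = "set xs"
  let ?g = "\<lambda>i. xs ! i"
  have bij: "bij_betw ?g {..<6} ?X" using bij_betw_nth[OF dist, of "{..<6}" ?X] len by simp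
  let ?f = "inv_into {..<6} ?g"
  have "graph_iso (induced_subgraph G ?X) (path_graph 6)"
    unfolding graph_iso_def
  proof (intro exI[of _ ?f] conjI ballI)
    show "bij_betw ?f (verts (induced_subgraph G ?X)) (verts (path_graph 6))"
      unfolding induced_subgraph_def path_graph_def using bij_betw_inv_into[OF bij] by simp
    fix u v assume "u \<in> verts (induced_subgraph G ?X)" "v \<in> verts (induced_subgraph G ?X)"
    then have uv: "u \<in> ?X" "v \<in> ?X" unfolding induced_subgraph_def by auto
    obtain i j where ij: "i < 6" "j < 6" "u = xs ! i" "v = xs ! j"
      using uv len by (metis in_set_conv_nth)
    have f: "?f u = i" "?f v = j" using ij bij_betw_inv_into_left[OF bij] by auto
    have "{u, v} \<in> edges (induced_subgraph G ?X) \<longleftrightarrow> graph_adj G u v"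
      unfolding induced_subgraph_def graph_adj_def using uv by auto
    also have "\<dots> \<longleftrightarrow> Suc i = j \<or> Suc j = i" using A ij by simp
    also have "\<dots> \<longleftrightarrow> {i, j} \<in> edges (path_graph 6)"
      unfolding path_graph_def using ij by (auto simp: doubleton_eq_iff)
    finally show "{u, v} \<in> edges (induced_subgraph G ?X) \<longleftrightarrow> {?f u, ?f v} \<in> edges (path_graph 6)"
      using f by simp
  qed
  moreover have "?X \<subseteq> verts G" unfolding xs_def using inV e sym by auto
  ultimately show False using G unfolding P6_free_def by blast
qed

locale p6free_input =
  fixes G :: "nat graph" and n :: nat
  assumes simple: "simple_graph G" and verts: "verts G = {..<n}" and P6: "P6_free G"
begin

abbreviation "adj \<equiv> graph_adj G"

sublocale p6free_graph adj
proof
  show "adj v u" if "adj u v" for u v using that unfolding graph_adj_def by (simp add: insert_commute)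
  show "\<not> adj u u" for u using simple unfolding graph_adj_def simple_graph_def by auto
qed (rule P6_free_no_P6[OF simple P6])

lemma adj_less: "adj u v \<Longrightarrow> u < n \<and> v < n"
  using simple verts unfolding graph_adj_def simple_graph_def by auto

lemma edge_cases:
  assumes "e \<in> edges G"
  obtains u v where "e = {u, v}" "adj u v" "u \<noteq> v"
  using assms simple unfolding simple_graph_def graph_adj_def by (metis card_2_iff)

lemma finite_nb': "finite {u. adj v u \<and> P u}"
  by (rule finite_subset[of _ "{..<n}"]) (use adj_less in auto)

lemma comp_of_sub: "g < n \<Longrightarrow> component_of adj g \<subseteq> {..<n}"
  unfolding component_of_def by (rule spread4_least) (use adj_less in auto)

lemma comp_of_component: "g < n \<Longrightarrow> graph_component adj (component_of adj g)"
  unfolding component_of_def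
  by (rule graph_component_spread4) (use finite_subset[OF comp_of_sub] in \<open>auto simp: component_of_def\<close>)

lemma comp_of_self: "g \<in> component_of adj g"
  unfolding component_of_def using spread4_sup[of "{g}" "{}"] by blast

lemma components_eq:
  assumes H: "graph_component adj H" "graph_component adj H'" and v: "v \<in> H" "v \<in> H'"
  shows "H = H'"
  using graph_component_connected[OF H(1) v] graph_component_connected[OF H(2) v(2,1)]
    graph_component_closed[OF H(1)] graph_component_closed[OF H(2)] by blast

lemma degree_rank_degree_key: "H \<subseteq> {..<n} \<Longrightarrow> degree_rank adj H (degree_key adj n)"
proof -
  assume H: "H \<subseteq> {..<n}"
  have key: "degree_key adj n u < degree_key adj n v"
    if "u < n" "card {x. adj u x} < card {x. adj v x}" for u v
  proof -
    have "degree_key adj n u < (card {x. adj u x} + 1) * n + 1" unfolding degree_key_def using that by simp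
    also have "\<dots> \<le> card {x. adj v x} * n + 1" using mult_le_mono1[of "card {x. adj u x} + 1" "card {x. adj v x}" n] that by simp
    also have "\<dots> \<le> degree_key adj n v" unfolding degree_key_def by simp
    finally show ?thesis .
  qed
  have "u = v" if "u < n" "v < n" "degree_key adj n u = degree_key adj n v" for u v
  proof -
    have "card {x. adj u x} = card {x. adj v x}" using key[of u v] key[of v u] that by (metis less_irrefl nat_neq_iff)
    then show ?thesis using that(3) unfolding degree_key_def by simp
  qed
  then show ?thesis unfolding degree_rank_def inj_on_def using key H by blast
qed

text \<open>
  All vertices of a component give rise to the same component and the same roots, so the candidates of all
  its vertices together contain those of \<open>some_candidate_improves\<close>.
\<close>
lemma candidate_good:
  assumes g: "g < n" and W: "white_set_on adj (component_of adj g) W"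
    and c0: "c0 \<le> cost adj (component_of adj g) {}"
    and c: "\<And>h R. h \<in> component_of adj g \<Longrightarrow> R \<in> candidates adj n h \<Longrightarrow>
      white_set_on adj (component_of adj g) R \<Longrightarrow> c0 \<le> cost adj (component_of adj g) R"
  shows "c0 \<le> cost adj (component_of adj g) W"
proof -
  let ?H = "component_of adj g"
  interpret white_set adj ?H W using comp_of_component[OF g] W by unfold_locales
  let ?u = "largest ?H" and ?v = "some_nbr adj (largest ?H)"
  have u: "?u \<in> ?H" using largest_in[OF finite_H] comp_of_self by blast
  have v: "adj ?u ?v" if "adj ?u x" for x
    using largest_in[of "{v. adj ?u v}"] finite_nb'[of ?u "\<lambda>_. True"] that unfolding some_nbr_def by auto
  have tri: "adj x (triangle_left adj x) \<and> adj x (triangle_right adj x) \<and> adj (triangle_left adj x) (triangle_right adj x)"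
    if "adj x b" "adj x c" "adj b c" for x b c
  proof -
    have "triangle_left adj x \<in> {b. adj x b \<and> (\<exists>c. adj x c \<and> adj b c)}"
      unfolding triangle_left_def by (rule largest_in[OF finite_nb']) (use that in blast)
    then have t: "adj x (triangle_left adj x)" "\<exists>c. adj x c \<and> adj (triangle_left adj x) c" by auto
    have "triangle_right adj x \<in> {c. adj x c \<and> adj (triangle_left adj x) c}"
      unfolding triangle_right_def by (rule largest_in[OF finite_nb']) (use t in blast)
    then show ?thesis using t by simp
  qed
  have some_unmatched: "some_unmatched adj x y \<in> unmatched adj {x, y}" if ne: "unmatched adj {x, y} \<noteq> {}" for x y
  proof -
    have "unmatched adj {x, y} \<subseteq> {..<n}" using adj_less unfolding unmatched_def level2_def by auto
    then show ?thesis unfolding some_unmatched_def using largest_in ne finite_subset by blast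
  qed
  have same: "component_of adj h = ?H" if "h \<in> ?H" for h
    using components_eq[OF comp_of_component comp, of h h] comp_of_self that comp_of_sub[OF g] by auto
  have rts: "roots adj h = {?u, ?v, some_unmatched adj ?u (triangle_left adj ?u), some_unmatched adj ?u (triangle_right adj ?u),
      some_unmatched adj ?v (triangle_left adj ?v), some_unmatched adj ?v (triangle_right adj ?v)}" if "h \<in> ?H" for h
    unfolding roots_def Let_def same[OF that] ..
  have "improves {} \<or> (\<exists>g\<in>?H. improves (around_core adj g) \<or> improves (around_white adj g) \<or>
      improves (around_block adj (degree_key adj n) (insert g {v. adj v g})) \<or>
      (\<exists>f\<in>{?u, ?v, some_unmatched adj ?u (triangle_left adj ?u), some_unmatched adj ?u (triangle_right adj ?u), some_unmatched adj ?v (triangle_left adj ?v), some_unmatched adj ?v (triangle_right adj ?v)}.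
         improves (around_block adj (degree_key adj n) {f, g})))"
    by (rule some_candidate_improves[OF u v degree_rank_degree_key[OF comp_of_sub[OF g]]])
      (assumption, fact tri, fact some_unmatched)
  then have "improves {} \<or> (\<exists>h\<in>?H. \<exists>R\<in>candidates adj n h. improves R)"
    unfolding candidates_def using rts by blast
  then show ?thesis
  proof
    assume "improves {}" then show ?thesis using c0 unfolding improves_def by simp
  next
    assume "\<exists>h\<in>?H. \<exists>R\<in>candidates adj n h. improves R"
    then show ?thesis using c unfolding improves_def by (meson order_trans)
  qed
qed

lemma white_set_on_component:
  assumes "white_set_on adj {..<n} W" "g < n"
  shows "white_set_on adj (component_of adj g) (W \<inter> component_of adj g)"
  unfolding white_set_on_def
proof (intro conjI ballI impI)
  let ?H = "component_of adj g"
  note cl = graph_component_closed[OF comp_of_component[OF assms(2)]]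
  fix v assume v: "v \<in> ?H - W \<inter> ?H" and w: "\<exists>w\<in>W \<inter> ?H. adj v w"
  then have "\<exists>!u. adj v u \<and> u \<notin> W" using assms comp_of_sub[OF assms(2)] unfolding white_set_on_def by blast
  moreover have "adj v u \<and> u \<notin> W \<longleftrightarrow> adj v u \<and> u \<notin> W \<inter> ?H" for u using v cl[of v u] by blast
  ultimately show "\<exists>!u. adj v u \<and> u \<notin> W \<inter> ?H" by simp
qed (use assms in \<open>auto simp: white_set_on_def\<close>)

lemma cost_component: "g < n \<Longrightarrow> cost adj (component_of adj g) (W \<inter> component_of adj g) = cost adj (component_of adj g) W"
  unfolding cost_def
  by (intro sum.cong arg_cong[of _ _ card]) (use graph_component_closed[OF comp_of_component] in auto)

lemma cost_split: "cost adj {..<n} W = (\<Sum>H\<in>component_of adj ` {..<n}. cost adj H W)"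
proof -
  have U: "{..<n} - W = (\<Union>H\<in>component_of adj ` {..<n}. H - W)"
    using comp_of_self comp_of_sub by blast
  show ?thesis unfolding cost_def U
  proof (rule sum.UNION_disjoint)
    show "\<forall>H\<in>component_of adj ` {..<n}. finite (H - W)" using comp_of_sub finite_subset by blast
    show "\<forall>H\<in>component_of adj ` {..<n}. \<forall>K\<in>component_of adj ` {..<n}. H \<noteq> K \<longrightarrow> (H - W) \<inter> (K - W) = {}"
      using components_eq comp_of_component by blast
  qed simp
qed

lemma peds_uncovered:
  assumes W: "white_set_on adj {..<n} W"
  shows "perfect_edge_dominating G (uncovered_edges G W)"
  unfolding perfect_edge_dominating_def
proof (intro conjI ballI)
  show "uncovered_edges G W \<subseteq> edges G" unfolding uncovered_edges_def by blast
  fix f assume f: "f \<in> edges G - uncovered_edges G W"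
  then have "f \<inter> W \<noteq> {}" unfolding uncovered_edges_def by blast
  moreover obtain a b where ab: "f = {a, b}" "adj a b" using f edge_cases by blast
  ultimately obtain w v where wv: "f = {v, w}" "adj v w" "w \<in> W" using adj_sym by blast
  have vW: "v \<notin> W" using W wv unfolding white_set_on_def by blast
  have "v \<in> {..<n} - W" using vW adj_less[OF wv(2)] by simp
  then have ex: "\<exists>!u. adj v u \<and> u \<notin> W" using W wv unfolding white_set_on_def by blast
  then obtain u where u: "adj v u" "u \<notin> W" "\<And>x. adj v x \<Longrightarrow> x \<notin> W \<Longrightarrow> x = u" by blast
  show "\<exists>!e. e \<in> uncovered_edges G W \<and> dominates e f"
  proof (intro ex1I conjI)
    show "{v, u} \<in> uncovered_edges G W" using u vW unfolding uncovered_edges_def graph_adj_def by blast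
    show "dominates {v, u} f" unfolding dominates_def using wv by blast
    fix e assume e: "e \<in> uncovered_edges G W \<and> dominates e f"
    then have e': "e \<in> edges G" "e \<inter> W = {}" "e \<inter> f \<noteq> {}" unfolding uncovered_edges_def dominates_def using f e by auto
    obtain p q where pq: "e = {p, q}" "adj p q" using e'(1) edge_cases by blast
    have "v \<in> e" using e' wv by blast
    then obtain x where "e = {v, x}" "adj v x" using pq adj_sym by blast
    then show "e = {v, u}" using u(3) e'(2) by blast
  qed
qed

lemma peds_valid:
  assumes Q: "perfect_edge_dominating G Q"
  shows "white_set_on adj {..<n} ({..<n} - \<Union>Q)" "Q = uncovered_edges G ({..<n} - \<Union>Q)"
proof -
  let ?W = "{..<n} - \<Union>Q"
  have QE: "Q \<subseteq> edges G" using Q unfolding perfect_edge_dominating_def by blast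
  have dom: "\<exists>!e. e \<in> Q \<and> dominates e f" if "f \<in> edges G" "f \<notin> Q" for f
    using Q that unfolding perfect_edge_dominating_def by blast
  have both: "{u, v} \<in> Q" if uv: "adj u v" "u \<in> \<Union>Q" "v \<in> \<Union>Q" for u v
  proof (rule ccontr)
    assume no: "{u, v} \<notin> Q"
    obtain e1 e2 where e: "e1 \<in> Q" "u \<in> e1" "e2 \<in> Q" "v \<in> e2" using uv by blast
    have "e1 = e2" using dom[of "{u, v}"] uv(1) no e unfolding graph_adj_def dominates_def by blast
    moreover obtain p q where "e1 = {p, q}" using e QE edge_cases by blast
    moreover have "u \<noteq> v" using uv adj_irrefl by blast
    ultimately have "e1 = {u, v}" using e by auto
    then show False using e no by simp
  qed
  show "white_set_on adj {..<n} ?W"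
    unfolding white_set_on_def
  proof (intro conjI ballI impI)
    fix u v assume uv: "u \<in> ?W" "v \<in> ?W"
    show "\<not> adj u v"
    proof
      assume a: "adj u v"
      then have "{u, v} \<notin> Q" using uv by blast
      then obtain e where "e \<in> Q" "dominates e {u, v}" using dom a unfolding graph_adj_def by blast
      then show False using uv unfolding dominates_def by blast
    qed
  next
    fix v assume v: "v \<in> {..<n} - ?W" and "\<exists>w\<in>?W. adj v w"
    then obtain w where w: "w \<in> ?W" "adj v w" by blast
    have vQ: "v \<in> \<Union>Q" using v by blast
    have f: "{v, w} \<in> edges G" "{v, w} \<notin> Q" using w unfolding graph_adj_def by blast+
    obtain e where e: "e \<in> Q" "v \<in> e" using vQ by blast
    obtain p q where pq: "e = {p, q}" "adj p q" using e(1) QE edge_cases by blast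
    then obtain x where x: "e = {v, x}" "adj v x" using e(2) adj_sym by blast
    have "u = x" if u: "adj v u" "u \<notin> ?W" for u
    proof -
      have "u \<in> \<Union>Q" using u adj_less by blast
      then have "{v, u} \<in> Q" using both[OF u(1) vQ] by blast
      then have "{v, u} = e" using dom[OF f] e unfolding dominates_def by blast
      then show ?thesis using x by (auto simp: doubleton_eq_iff)
    qed
    moreover have "x \<notin> ?W" using x(1) e(1) by blast
    ultimately show "\<exists>!u. adj v u \<and> u \<notin> ?W" using x(2) by blast
  qed blast
  show "Q = uncovered_edges G ?W"
  proof (intro set_eqI iffI)
    fix e assume "e \<in> Q"
    then show "e \<in> uncovered_edges G ?W" using QE unfolding uncovered_edges_def by blast
  next
    fix e assume e: "e \<in> uncovered_edges G ?W"
    then have "e \<in> edges G" unfolding uncovered_edges_def by simp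
    then obtain u v where uv: "e = {u, v}" "adj u v" by (rule edge_cases)
    then have "u \<in> \<Union>Q" "v \<in> \<Union>Q" using e adj_less[OF uv(2)] unfolding uncovered_edges_def by auto
    then show "e \<in> Q" using both uv by blast
  qed
qed

lemma cost_card: "cost adj {..<n} W = 2 * card (uncovered_edges G W)"
proof -
  let ?P = "uncovered_edges G W"
  have finP: "finite ?P"
    by (rule finite_subset[of _ "Pow {..<n}"])
      (use simple verts in \<open>auto simp: uncovered_edges_def simple_graph_def\<close>)
  have deg: "card {u. adj v u \<and> u \<notin> W} = card {e\<in>?P. v \<in> e}" if v: "v \<in> {..<n} - W" for v
  proof (rule bij_betw_same_card[of "\<lambda>u. {v, u}"])
    show "bij_betw (\<lambda>u. {v, u}) {u. adj v u \<and> u \<notin> W} {e\<in>?P. v \<in> e}"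
      unfolding bij_betw_def
    proof (intro conjI set_eqI iffI)
      show "inj_on (\<lambda>u. {v, u}) {u. adj v u \<and> u \<notin> W}" by (auto simp: inj_on_def doubleton_eq_iff)
      fix e
      show "e \<in> {e\<in>?P. v \<in> e}" if "e \<in> (\<lambda>u. {v, u}) ` {u. adj v u \<and> u \<notin> W}"
        using that v unfolding uncovered_edges_def graph_adj_def by auto
      assume e: "e \<in> {e\<in>?P. v \<in> e}"
      then have "e \<in> edges G" unfolding uncovered_edges_def by simp
      then obtain p q where pq: "e = {p, q}" "adj p q" by (rule edge_cases)
      then obtain x where "e = {v, x}" "adj v x" using e adj_sym by blast
      then show "e \<in> (\<lambda>u. {v, u}) ` {u. adj v u \<and> u \<notin> W}"
        using e unfolding uncovered_edges_def by blast
    qed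
  qed
  have two: "card {v\<in>{..<n} - W. v \<in> e} = 2" if e: "e \<in> ?P" for e
  proof -
    have "{v\<in>{..<n} - W. v \<in> e} = e"
      using e simple verts unfolding uncovered_edges_def simple_graph_def by (auto 0 3)
    then show ?thesis using e simple unfolding uncovered_edges_def simple_graph_def by auto
  qed
  have "cost adj {..<n} W = (\<Sum>v\<in>{..<n} - W. card {e\<in>?P. v \<in> e})"
    unfolding cost_def using deg by simp
  also have "\<dots> = (\<Sum>e\<in>?P. 2)"
    by (rule sum_multicount_gen) (use finP two in auto)
  finally show ?thesis by simp
qed

text \<open>
  Components are independent, so it suffices to be optimal on each of them.
\<close>
theorem minimum_if_best:
  assumes W: "white_set_on adj {..<n} W"
    and c0: "\<And>g. g < n \<Longrightarrow> cost adj (component_of adj g) W \<le> cost adj (component_of adj g) {}"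
    and c: "\<And>g R. g < n \<Longrightarrow> R \<in> candidates adj n g \<Longrightarrow> white_set_on adj (component_of adj g) R \<Longrightarrow>
      cost adj (component_of adj g) W \<le> cost adj (component_of adj g) R"
  shows "minimum_perfect_edge_dominating G (uncovered_edges G W)"
  unfolding minimum_perfect_edge_dominating_def
proof (intro conjI allI impI)
  show "perfect_edge_dominating G (uncovered_edges G W)" by (rule peds_uncovered[OF W])
  fix Q assume Q: "perfect_edge_dominating G Q"
  define Z where "Z = {..<n} - \<Union>Q"
  have Z: "white_set_on adj {..<n} Z" "Q = uncovered_edges G Z" using peds_valid[OF Q] unfolding Z_def by auto
  have "cost adj {..<n} W \<le> cost adj {..<n} Z"
    unfolding cost_split
  proof (rule sum_mono)
    fix H assume "H \<in> component_of adj ` {..<n}"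
    then obtain g where g: "g < n" "H = component_of adj g" by blast
    have same: "component_of adj h = H" if "h \<in> H" for h
      using components_eq[OF comp_of_component comp_of_component[OF g(1)], of h h] comp_of_self that comp_of_sub[OF g(1)] g by auto
    have "cost adj (component_of adj g) W \<le> cost adj (component_of adj g) (Z \<inter> component_of adj g)"
    proof (rule candidate_good[OF g(1) white_set_on_component[OF Z(1) g(1)] c0[OF g(1)]])
      fix h R assume h: "h \<in> component_of adj g" "R \<in> candidates adj n h" "white_set_on adj (component_of adj g) R"
      then have "h < n" "component_of adj h = component_of adj g" using comp_of_sub[OF g(1)] same g by auto
      then show "cost adj (component_of adj g) W \<le> cost adj (component_of adj g) R" using c[of h R] h by simp
    qed
    then show "cost adj H W \<le> cost adj H Z" using cost_component[OF g(1)] g by simp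
  qed
  then show "card (uncovered_edges G W) \<le> card Q" using cost_card Z(2) by simp
qed

end

section \<open>Vector operations and their compilation\<close>

text \<open>
  \<open>VOp X b mx e h\<close> assigns to \<open>X[b + i]\<close>, for all \<open>i < n\<close>, the value
  of \<open>h\<close>, where \<open>t\<close> stands for the sum of the values of \<open>e\<close> over all
  \<open>j < n\<close>, or for their maximum if \<open>mx\<close> holds. The scalar \<open>g\<close> is the
  number of the current round of an outer loop.
\<close>
datatype vop = VOp name aexp bool aexp aexp

definition env :: "nat \<Rightarrow> nat \<Rightarrow> nat \<Rightarrow> nat \<Rightarrow> nat \<Rightarrow> (name \<Rightarrow> nat \<Rightarrow> nat) \<Rightarrow> state" where
  "env n g i j t A = \<lparr>scalars = (\<lambda>_. 0)(''n'' := n, ''g'' := g, ''i'' := i, ''j'' := j, ''t'' := t), arrays = A\<rparr>"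

definition reduction :: "bool \<Rightarrow> nat \<Rightarrow> (nat \<Rightarrow> nat) \<Rightarrow> nat" where
  "reduction mx k f = (if mx then Max (insert 0 (f ` {..<k})) else (\<Sum>j<k. f j))"

lemma red_0: "reduction mx 0 f = 0" unfolding reduction_def by simp

lemma red_Suc: "reduction mx (Suc k) f = (if mx then max (reduction mx k f) (f k) else reduction mx k f + f k)"
proof -
  have "insert 0 (f ` {..<Suc k}) = insert (f k) (insert 0 (f ` {..<k}))"
    by (auto simp: lessThan_Suc)
  then show ?thesis unfolding reduction_def by (simp add: max.commute)
qed

lemma red_le:
  assumes "\<And>j. j < k \<Longrightarrow> f j \<le> B"
  shows "reduction mx k f \<le> k * B"
  using assms
proof (induction k)
  case (Suc k)
  then have "reduction mx k f \<le> k * B" "f k \<le> B" by auto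
  then show ?case unfolding red_Suc by auto
qed (simp add: red_0)

fun op_row :: "nat \<Rightarrow> nat \<Rightarrow> vop \<Rightarrow> (name \<Rightarrow> nat \<Rightarrow> nat) \<Rightarrow> nat \<Rightarrow> nat" where
  "op_row n g (VOp X b mx e h) A i =
     aval h (env n g i 0 (reduction mx n (\<lambda>j. aval e (env n g i j 0 A))) A)"

fun op_base :: "nat \<Rightarrow> nat \<Rightarrow> vop \<Rightarrow> nat" where
  "op_base n g (VOp X b mx e h) = aval b (env n g 0 0 0 (\<lambda>_ _. 0))"

fun op_name :: "vop \<Rightarrow> name" where "op_name (VOp X b mx e h) = X"

definition run_op :: "nat \<Rightarrow> nat \<Rightarrow> vop \<Rightarrow> (name \<Rightarrow> nat \<Rightarrow> nat) \<Rightarrow> name \<Rightarrow> nat \<Rightarrow> nat" where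
  "run_op n g c A = A(op_name c := (\<lambda>k. if op_base n g c \<le> k \<and> k < op_base n g c + n
     then op_row n g c A (k - op_base n g c) else A (op_name c) k))"

definition run_ops :: "nat \<Rightarrow> nat \<Rightarrow> vop list \<Rightarrow> (name \<Rightarrow> nat \<Rightarrow> nat) \<Rightarrow> name \<Rightarrow> nat \<Rightarrow> nat" where
  "run_ops n g cs A = fold (run_op n g) cs A"

definition count_loop :: "name \<Rightarrow> com \<Rightarrow> com" where
  "count_loop x c = Seq (Assign x (Const 0))
     (While (Less (Var x) (Var ''n'')) (Seq c (Assign x (Plus (Var x) (Const 1)))))"

fun compile_op :: "vop \<Rightarrow> com" where
  "compile_op (VOp X b mx e h) =
     count_loop ''i'' (Seq (Assign ''t'' (Const 0)) (Seq
       (count_loop ''j'' (Assign ''t'' (if mx then Plus (Var ''t'') (Minus e (Var ''t'')) else Plus (Var ''t'') e)))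
       (Store X (Plus b (Var ''i'')) h)))"

definition compile_ops :: "vop list \<Rightarrow> com" where
  "compile_ops cs = foldr (\<lambda>c p. Seq (compile_op c) p) cs Skip"

primrec scalars_of :: "aexp \<Rightarrow> name list" where
  "scalars_of (Const c) = []"
| "scalars_of (Var x) = [x]"
| "scalars_of (Load A i) = scalars_of i"
| "scalars_of (Plus a b) = scalars_of a @ scalars_of b"
| "scalars_of (Minus a b) = scalars_of a @ scalars_of b"
| "scalars_of (Times a b) = scalars_of a @ scalars_of b"
| "scalars_of (Div a b) = scalars_of a @ scalars_of b"
| "scalars_of (Mod a b) = scalars_of a @ scalars_of b"

primrec arrays_of :: "aexp \<Rightarrow> name list" where
  "arrays_of (Const c) = []"
| "arrays_of (Var x) = []"
| "arrays_of (Load A i) = A # arrays_of i"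
| "arrays_of (Plus a b) = arrays_of a @ arrays_of b"
| "arrays_of (Minus a b) = arrays_of a @ arrays_of b"
| "arrays_of (Times a b) = arrays_of a @ arrays_of b"
| "arrays_of (Div a b) = arrays_of a @ arrays_of b"
| "arrays_of (Mod a b) = arrays_of a @ arrays_of b"

text \<open>
  An exponent \<open>d\<close> such that the value is at most \<open>(n + 2) ^ d\<close>, given exponents
  for the array entries and for the scalar \<open>t\<close>. The word-size bound thereby becomes a static
  check.
\<close>
primrec size_deg :: "(name \<Rightarrow> nat) \<Rightarrow> nat \<Rightarrow> aexp \<Rightarrow> nat" where
  "size_deg dg d (Const c) = (if c \<le> 1 then 0 else c)"
| "size_deg dg d (Var x) = (if x = ''t'' then d else 1)"
| "size_deg dg d (Load A i) = dg A"
| "size_deg dg d (Plus a b) = max (size_deg dg d a) (size_deg dg d b) + 1"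
| "size_deg dg d (Minus a b) = size_deg dg d a"
| "size_deg dg d (Times a b) = size_deg dg d a + size_deg dg d b"
| "size_deg dg d (Div a b) = size_deg dg d a"
| "size_deg dg d (Mod a b) = size_deg dg d a"

lemma aval_cong:
  "(\<And>x. x \<in> set (scalars_of a) \<Longrightarrow> scalars s x = scalars s' x) \<Longrightarrow>
   (\<And>X. X \<in> set (arrays_of a) \<Longrightarrow> arrays s X = arrays s' X) \<Longrightarrow> aval a s = aval a s'"
  by (induction a) auto

lemma aval_le:
  assumes "\<And>X k. arrays s X k \<le> (n + 2) ^ dg X" "\<And>x. x \<noteq> ''t'' \<Longrightarrow> scalars s x \<le> n"
    "scalars s ''t'' \<le> (n + 2) ^ d"
  shows "aval a s \<le> (n + 2) ^ size_deg dg d a"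
proof (induction a)
  case (Const c)
  have "c \<le> 2 ^ c" by (simp add: less_imp_le)
  also have "\<dots> \<le> (n + 2) ^ c" by (simp add: power_mono)
  finally show ?case by simp
next
  case (Var x)
  have "scalars s x \<le> (n + 2) ^ 1" if "x \<noteq> ''t''" using assms(2)[OF that] by simp
  then show ?case using assms(3) by simp
next
  case (Load X i) then show ?case using assms(1) by simp
next
  case (Plus a b)
  let ?m = "max (size_deg dg d a) (size_deg dg d b)"
  have "aval a s \<le> (n + 2) ^ ?m" "aval b s \<le> (n + 2) ^ ?m"
    using Plus by (meson le_trans max.cobounded1 max.cobounded2 power_increasing le_add2 one_le_numeral)+
  then have "aval a s + aval b s \<le> 2 * (n + 2) ^ ?m" by simp
  also have "\<dots> \<le> (n + 2) * (n + 2) ^ ?m" by (rule mult_le_mono1) simp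
  finally show ?case by simp
next
  case (Times a b) then show ?case by (simp add: power_add mult_le_mono)
next
  case (Div a b) then show ?case by simp (meson div_le_dividend le_trans)
next
  case (Mod a b) then show ?case by (simp add: le_trans[OF mod_less_eq_dividend])
qed (auto intro: le_trans[OF diff_le_self])

text \<open>
  The array \<open>X\<close> must not be read, because its entries change while the operation runs.
\<close>
fun op_ok :: "(name \<Rightarrow> nat) \<Rightarrow> nat \<Rightarrow> vop \<Rightarrow> bool" where
  "op_ok dg w (VOp X b mx e h) \<longleftrightarrow>
     list_all (\<lambda>x. x = ''n'' \<or> x = ''g'' \<or> x = ''i'' \<or> x = ''j'') (scalars_of e) \<and>
     list_all (\<lambda>x. x = ''n'' \<or> x = ''g'' \<or> x = ''i'' \<or> x = ''t'') (scalars_of h) \<and>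
     list_all (\<lambda>x. x = ''n'' \<or> x = ''g'') (scalars_of b) \<and> arrays_of b = [] \<and>
     list_all (\<lambda>Y. Y \<noteq> X) (arrays_of e) \<and> list_all (\<lambda>Y. Y \<noteq> X) (arrays_of h) \<and>
     size_deg dg 0 e + 1 \<le> w \<and> size_deg dg (size_deg dg 0 e + 1) h \<le> dg X \<and> dg X \<le> w \<and>
     size_deg dg 0 b + 2 \<le> w"

definition bounded_by :: "nat \<Rightarrow> (name \<Rightarrow> nat) \<Rightarrow> (name \<Rightarrow> nat \<Rightarrow> nat) \<Rightarrow> bool" where
  "bounded_by n dg A \<longleftrightarrow> (\<forall>X k. A X k \<le> (n + 2) ^ dg X)"

definition sees :: "nat \<Rightarrow> nat \<Rightarrow> (name \<Rightarrow> nat \<Rightarrow> nat) \<Rightarrow> state \<Rightarrow> bool" where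
  "sees n g A s \<longleftrightarrow> scalars s ''n'' = n \<and> scalars s ''g'' = g \<and> arrays s = A"

definition set_scalar :: "name \<Rightarrow> nat \<Rightarrow> state \<Rightarrow> state" where
  "set_scalar x v s = s\<lparr>scalars := (scalars s)(x := v)\<rparr>"

lemma set_scalar_simps [simp]:
  "scalars (set_scalar x v s) = (scalars s)(x := v)" "arrays (set_scalar x v s) = arrays s"
  unfolding set_scalar_def by auto

lemma exec_Assign': "aval a s \<le> W \<Longrightarrow> exec W (Assign x a) s (acost a + 1) (set_scalar x (aval a s) s)"
  unfolding set_scalar_def by (rule exec_Assign)

text \<open>
  The invariant has to survive assignments to the counter, so it cannot mention the counter; it depends on
  the number of completed rounds instead.
\<close>
lemma count_loop_exec:
  assumes body: "\<And>k s. k < n \<Longrightarrow> I k s \<Longrightarrow> scalars s x = k \<Longrightarrow> scalars s ''n'' = n \<Longrightarrow>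
      \<exists>t s'. exec W c s t s' \<and> t \<le> T \<and> I (Suc k) s' \<and> scalars s' x = k \<and> scalars s' ''n'' = n"
    and stable: "\<And>k s v. I k s \<Longrightarrow> I k (set_scalar x v s)"
    and init: "I 0 s" "scalars s ''n'' = n" and x: "x \<noteq> ''n''" and W: "n \<le> W"
  shows "\<exists>t s'. exec W (count_loop x c) s t s' \<and> t \<le> (n + 1) * (T + 10) \<and> I n s' \<and> scalars s' ''n'' = n"
proof -
  let ?W = "While (Less (Var x) (Var ''n'')) (Seq c (Assign x (Plus (Var x) (Const 1))))"
  have loop: "\<exists>t s'. exec W ?W s t s' \<and> t \<le> (n - k) * (T + 10) + 4 \<and> I n s' \<and> scalars s' ''n'' = n"
    if "k \<le> n" "I k s" "scalars s x = k" "scalars s ''n'' = n" for k s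
    using that
  proof (induction "n - k" arbitrary: k s)
    case 0
    then have "k = n" by simp
    have "exec W ?W s (bcost (Less (Var x) (Var ''n'')) + 1) s"
      by (rule exec_WhileFalse) (use 0 in simp)
    then show ?case using 0 \<open>k = n\<close> by (auto intro!: exI)
  next
    case (Suc m)
    then have k: "k < n" by simp
    obtain t s1 where 1: "exec W c s t s1" "t \<le> T" "I (Suc k) s1" "scalars s1 x = k" "scalars s1 ''n'' = n"
      using body[OF k Suc.prems(2-4)] by blast
    let ?s2 = "set_scalar x (Suc k) s1"
    have 2: "exec W (Assign x (Plus (Var x) (Const 1))) s1 4 ?s2"
      using exec_Assign'[of "Plus (Var x) (Const 1)" s1 W x] 1 k W by (simp add: numeral_eq_Suc)
    have "m = n - Suc k" using Suc.hyps(2) by simp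
    from Suc.hyps(1)[OF this, of ?s2]
    obtain t' s' where 3: "exec W ?W ?s2 t' s'" "t' \<le> (n - Suc k) * (T + 10) + 4" "I n s'" "scalars s' ''n'' = n"
      using k stable[OF 1(3)] 1(5) x by (metis Suc_leI fun_upd_apply set_scalar_simps(1))
    have "exec W ?W s (bcost (Less (Var x) (Var ''n'')) + (t + 4 + 1) + t' + 1) s'"
      by (rule exec_WhileTrue[OF _ exec_Seq[OF 1(1) 2] 3(1)]) (use Suc.prems k in simp)
    moreover have "bcost (Less (Var x) (Var ''n'')) + (t + 4 + 1) + t' + 1 \<le> (n - k) * (T + 10) + 4"
    proof -
      have "n - k = Suc (n - Suc k)" using k by simp
      then show ?thesis using 1(2) 3(2) by simp
    qed
    ultimately show ?case using 3(3,4) by blast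
  qed
  let ?s0 = "set_scalar x 0 s"
  have 1: "exec W (Assign x (Const 0)) s 2 ?s0" using exec_Assign'[of "Const 0" s W x] by (simp add: numeral_eq_Suc)
  obtain t s' where 2: "exec W ?W ?s0 t s'" "t \<le> n * (T + 10) + 4" "I n s'" "scalars s' ''n'' = n"
    using loop[of 0 ?s0] stable[OF init(1)] init(2) x by auto
  have "exec W (count_loop x c) s (2 + t + 1) s'" unfolding count_loop_def by (rule exec_Seq[OF 1 2(1)])
  moreover have "2 + t + 1 \<le> (n + 1) * (T + 10)" using 2(2) by simp
  ultimately show ?thesis using 2(3,4) by blast
qed

fun op_cost :: "vop \<Rightarrow> nat" where
  "op_cost (VOp X b mx e h) = acost e + acost b + acost h + 40"

lemma compile_op_exec:
  assumes ok: "op_ok dg w c" and A: "bounded_by n dg A" and s: "sees n g A s" and g: "g \<le> n"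
  shows "\<exists>t s'. exec ((n + 2) ^ w) (compile_op c) s t s' \<and> t \<le> op_cost c * (n + 1)\<^sup>2 \<and>
    sees n g (run_op n g c A) s'"
    and "bounded_by n dg (run_op n g c A)"
proof -
  obtain X b mx e h where c: "c = VOp X b mx e h" by (cases c)
  let ?W = "(n + 2) ^ w"
  define de where "de = size_deg dg 0 e"
  note ok' = ok[unfolded c op_ok.simps list_all_iff, folded de_def]
  have okE: "x = ''n'' \<or> x = ''g'' \<or> x = ''i'' \<or> x = ''j''" if "x \<in> set (scalars_of e)" for x using ok' that by blast
  have okH: "x = ''n'' \<or> x = ''g'' \<or> x = ''i'' \<or> x = ''t''" if "x \<in> set (scalars_of h)" for x using ok' that by blast
  have okB: "x = ''n'' \<or> x = ''g''" if "x \<in> set (scalars_of b)" for x using ok' that by blast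
  have okA: "arrays_of b = []" "Y \<in> set (arrays_of e) \<Longrightarrow> Y \<noteq> X" "Y \<in> set (arrays_of h) \<Longrightarrow> Y \<noteq> X" for Y using ok' by blast+
  have powW: "v \<le> ?W" if "v \<le> (n + 2) ^ d" "d \<le> w" for v d
    using that by (meson le_trans power_increasing le_add2 one_le_numeral)
  have nW: "n \<le> ?W" using powW[of n 1] ok' by simp
  \<comment> \<open>\<open>E\<close> and \<open>V\<close> are the values of \<open>e\<close> and \<open>h\<close>, and \<open>R\<close> is the value of \<open>t\<close> after \<open>k\<close> rounds of the inner loop.\<close>
  define E where "E i j = aval e (env n g i j 0 A)" for i j
  define R where "R i k = reduction mx k (E i)" for i k
  define V where "V i = aval h (env n g i 0 (R i n) A)" for i
  define B where "B = aval b (env n g 0 0 0 (\<lambda>_ _. 0))"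
  have envle: "scalars (env n g i j t A') x \<le> n" if "x \<noteq> ''t''" "i \<le> n" "j \<le> n" for i j t A' x
    using that g unfolding env_def by simp
  have Ale: "A Y k \<le> (n + 2) ^ dg Y" for Y k using A unfolding bounded_by_def by blast
  have E_le: "E i j \<le> (n + 2) ^ de" if "i < n" "j < n" for i j
    unfolding E_def de_def by (rule aval_le) (use Ale envle that in \<open>auto simp: env_def\<close>)
  have R_le: "R i k \<le> (n + 2) ^ (de + 1)" if "i < n" "k \<le> n" for i k
  proof -
    have "R i k \<le> k * (n + 2) ^ de" unfolding R_def by (rule red_le) (use E_le that in auto)
    also have "\<dots> \<le> (n + 2) * (n + 2) ^ de" using that by (intro mult_le_mono1) simp
    finally show ?thesis by simp
  qed
  have V_le: "V i \<le> (n + 2) ^ dg X" if "i < n" for i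
  proof -
    have "V i \<le> (n + 2) ^ size_deg dg (de + 1) h"
      unfolding V_def by (rule aval_le) (use Ale envle that R_le[of i n] in \<open>auto simp: env_def\<close>)
    also have "\<dots> \<le> (n + 2) ^ dg X" using ok' by (intro power_increasing) auto
    finally show ?thesis .
  qed
  have run: "run_op n g c A = A(X := (\<lambda>k. if B \<le> k \<and> k < B + n then V (k - B) else A X k))"
    unfolding run_op_def c V_def R_def E_def B_def
    by (simp only: op_row.simps op_base.simps op_name.simps)
  show "bounded_by n dg (run_op n g c A)"
    unfolding bounded_by_def run using Ale V_le by auto
  define Ak where "Ak i = A(X := (\<lambda>k. if B \<le> k \<and> k < B + i then V (k - B) else A X k))" for i
  have Ak_other: "Ak i Y = A Y" if "Y \<noteq> X" for i Y using that unfolding Ak_def by simp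
  have B_le: "B \<le> (n + 2) ^ size_deg dg 0 b"
    unfolding B_def by (rule aval_le) (use g in \<open>auto simp: env_def\<close>)
  have Bi_le: "B + i \<le> ?W" if "i < n" for i
  proof -
    let ?m = "size_deg dg 0 b + 1"
    have "B \<le> (n + 2) ^ ?m" by (rule le_trans[OF B_le power_increasing]) auto
    moreover have "i \<le> (n + 2) ^ ?m"
      by (rule le_trans[of _ "(n + 2) ^ 1"]) (use that in simp, intro power_increasing, auto)
    ultimately have "B + i \<le> 2 * (n + 2) ^ ?m" by simp
    also have "\<dots> \<le> (n + 2) * (n + 2) ^ ?m" by (rule mult_le_mono1) simp
    finally show ?thesis using powW[of "B + i" "size_deg dg 0 b + 2"] ok' by simp
  qed
  let ?te = "if mx then Plus (Var ''t'') (Minus e (Var ''t'')) else Plus (Var ''t'') e"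
  have te_cost: "acost ?te \<le> acost e + 4" by simp
  define T1 where "T1 = acost e + 5"
  define T2 where "T2 = 2 + ((n + 1) * (T1 + 10) + (acost b + acost h + 3) + 1) + 1"
  let ?I = "\<lambda>i k (s :: state). scalars s ''g'' = g \<and> scalars s ''i'' = i \<and> arrays s = Ak i \<and> scalars s ''t'' = R i k"
  have inner: "\<exists>t s'. exec ?W (count_loop ''j'' (Assign ''t'' ?te)) s t s' \<and> t \<le> (n + 1) * (T1 + 10) \<and>
      ?I i n s' \<and> scalars s' ''n'' = n"
    if i: "i < n" and I0: "?I i 0 s" "scalars s ''n'' = n" for i s
  proof (rule count_loop_exec[where I = "?I i"])
    fix k s assume k: "k < n" and I: "?I i k s" and sj: "scalars s ''j'' = k" and sn: "scalars s ''n'' = n"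
    have e: "aval e s = E i k"
      unfolding E_def
      proof (rule aval_cong)
        fix x assume "x \<in> set (scalars_of e)"
        from okE[OF this] show "scalars s x = scalars (env n g i k 0 A) x"
          using I sj sn by (elim disjE) (simp_all add: env_def)
      next
        fix Y assume "Y \<in> set (arrays_of e)"
        then show "arrays s Y = arrays (env n g i k 0 A) Y"
          using okA(2)[of Y] Ak_other[of Y] I by (simp add: env_def)
      qed
    have v: "aval ?te s = R i (Suc k)" using I e unfolding R_def red_Suc by (simp add: max_def)
    have vW: "aval ?te s \<le> ?W" using powW[OF R_le[OF i, of "Suc k"]] k ok' v by (simp add: de_def)
    have "acost ?te + 1 \<le> T1" using te_cost unfolding T1_def by linarith
    moreover have "exec ?W (Assign ''t'' ?te) s (acost ?te + 1) (set_scalar ''t'' (aval ?te s) s)"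
      by (rule exec_Assign'[OF vW])
    ultimately show "\<exists>t s'. exec ?W (Assign ''t'' ?te) s t s' \<and> t \<le> T1 \<and> ?I i (Suc k) s' \<and>
        scalars s' ''j'' = k \<and> scalars s' ''n'' = n"
      using I sj sn v by (intro exI[of _ "acost ?te + 1"] exI[of _ "set_scalar ''t'' (aval ?te s) s"]) simp
  qed (use I0 nW in auto)
  let ?J = "\<lambda>k (s :: state). scalars s ''g'' = g \<and> arrays s = Ak k"
  have "\<exists>t s'. exec ?W (compile_op c) s t s' \<and> t \<le> (n + 1) * (T2 + 10) \<and> ?J n s' \<and> scalars s' ''n'' = n"
    unfolding c compile_op.simps
  proof (rule count_loop_exec[where I = ?J])
    fix k s assume k: "k < n" and J: "?J k s" and si: "scalars s ''i'' = k" and sn: "scalars s ''n'' = n"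
    let ?s1 = "set_scalar ''t'' 0 s"
    have 1: "exec ?W (Assign ''t'' (Const 0)) s 2 ?s1"
      using exec_Assign'[of "Const 0" s ?W "''t''"] by (simp add: numeral_eq_Suc)
    obtain t2 s2 where 2: "exec ?W (count_loop ''j'' (Assign ''t'' ?te)) ?s1 t2 s2"
      "t2 \<le> (n + 1) * (T1 + 10)" "?I k n s2" "scalars s2 ''n'' = n"
      using inner[OF k, of ?s1] J si sn by (auto simp: R_def red_0)
    have h: "aval h s2 = V k"
      unfolding V_def
      proof (rule aval_cong)
        fix x assume "x \<in> set (scalars_of h)"
        from okH[OF this] show "scalars s2 x = scalars (env n g k 0 (R k n) A) x"
          using 2(3,4) by (elim disjE) (simp_all add: env_def)
      next
        fix Y assume "Y \<in> set (arrays_of h)"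
        then show "arrays s2 Y = arrays (env n g k 0 (R k n) A) Y"
          using okA(3)[of Y] Ak_other[of Y] 2(3) by (simp add: env_def)
      qed
    have b: "aval b s2 = B"
      unfolding B_def
      proof (rule aval_cong)
        fix x assume "x \<in> set (scalars_of b)"
        from okB[OF this] show "scalars s2 x = scalars (env n g 0 0 0 (\<lambda>_ _. 0)) x"
          using 2(3,4) by (elim disjE) (simp_all add: env_def)
      next
        fix Y assume "Y \<in> set (arrays_of b)"
        then show "arrays s2 Y = arrays (env n g 0 0 0 (\<lambda>_ _. 0)) Y"
          using okA(1) 2(3) by (simp add: env_def)
      qed
    let ?a = "Plus b (Var ''i'')"
    have a: "aval ?a s2 = B + k" using b 2(3) by simp
    let ?s3 = "s2\<lparr>arrays := (arrays s2)(X := (arrays s2 X)(aval ?a s2 := aval h s2))\<rparr>"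
    have 3: "exec ?W (Store X ?a h) s2 (acost ?a + acost h + 1) ?s3"
    proof (rule exec_Store)
      show "aval ?a s2 \<le> ?W" unfolding a by (rule Bi_le[OF k])
      show "aval h s2 \<le> ?W" unfolding h using powW[OF V_le[OF k]] ok' by simp
    qed
    have arr: "arrays ?s3 = Ak (Suc k)"
      using 2(3) a h unfolding Ak_def by (auto simp: fun_eq_iff)
    let ?c = "Seq (Assign ''t'' (Const 0)) (Seq (count_loop ''j'' (Assign ''t'' ?te)) (Store X ?a h))"
    have ex: "exec ?W ?c s (2 + (t2 + (acost ?a + acost h + 1) + 1) + 1) ?s3"
      by (rule exec_Seq[OF 1 exec_Seq[OF 2(1) 3]])
    have tb: "2 + (t2 + (acost ?a + acost h + 1) + 1) + 1 \<le> T2" using 2(2) unfolding T2_def by simp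
    have "?J (Suc k) ?s3 \<and> scalars ?s3 ''i'' = k \<and> scalars ?s3 ''n'' = n" using arr 2(3,4) by simp
    then show "\<exists>t s'. exec ?W ?c s t s' \<and> t \<le> T2 \<and> ?J (Suc k) s' \<and> scalars s' ''i'' = k \<and> scalars s' ''n'' = n"
      using ex tb by blast
  qed (use s nW in \<open>auto simp: sees_def Ak_def fun_eq_iff\<close>)
  then obtain t s' where r: "exec ?W (compile_op c) s t s'" "t \<le> (n + 1) * (T2 + 10)" "?J n s'" "scalars s' ''n'' = n"
    by blast
  have "T2 + 10 \<le> op_cost c * (n + 1)"
    unfolding c op_cost.simps T2_def T1_def by (simp add: algebra_simps)
  then have "(n + 1) * (T2 + 10) \<le> op_cost c * (n + 1)\<^sup>2"
    using mult_le_mono2[of "T2 + 10" "op_cost c * (n + 1)" "n + 1"] by (simp add: power2_eq_square algebra_simps)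
  moreover have "sees n g (run_op n g c A) s'" using r unfolding sees_def run Ak_def by simp
  ultimately show "\<exists>t s'. exec ?W (compile_op c) s t s' \<and> t \<le> op_cost c * (n + 1)\<^sup>2 \<and>
    sees n g (run_op n g c A) s'" using r by (meson le_trans)
qed

definition ops_cost :: "vop list \<Rightarrow> nat" where "ops_cost cs = (\<Sum>c\<leftarrow>cs. op_cost c + 1) + 1"

lemma compile_ops_exec:
  assumes "list_all (op_ok dg w) cs" "bounded_by n dg A" "sees n g A s" "g \<le> n"
  shows "(\<exists>t s'. exec ((n + 2) ^ w) (compile_ops cs) s t s' \<and> t \<le> ops_cost cs * (n + 1)\<^sup>2 \<and>
    sees n g (run_ops n g cs A) s') \<and> bounded_by n dg (run_ops n g cs A)"
  using assms
proof (induction cs arbitrary: A s)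
  case Nil
  have "exec ((n + 2) ^ w) (compile_ops []) s 1 s"
    unfolding compile_ops_def by (simp add: exec_Skip[unfolded One_nat_def])
  then show ?case using Nil by (auto simp: run_ops_def ops_cost_def intro!: exI)
next
  case (Cons c cs)
  obtain t s1 where 1: "exec ((n + 2) ^ w) (compile_op c) s t s1" "t \<le> op_cost c * (n + 1)\<^sup>2"
    "sees n g (run_op n g c A) s1" "bounded_by n dg (run_op n g c A)"
    using compile_op_exec[of dg w c n A g s] Cons.prems by auto
  obtain t' s' where 2: "exec ((n + 2) ^ w) (compile_ops cs) s1 t' s'" "t' \<le> ops_cost cs * (n + 1)\<^sup>2"
    "sees n g (run_ops n g cs (run_op n g c A)) s'" "bounded_by n dg (run_ops n g cs (run_op n g c A))"
    using Cons.IH[OF _ 1(4,3)] Cons.prems by auto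
  have "exec ((n + 2) ^ w) (compile_ops (c # cs)) s (t + t' + 1) s'"
    using exec_Seq[OF 1(1) 2(1)] unfolding compile_ops_def by simp
  moreover have "t + t' + 1 \<le> ops_cost (c # cs) * (n + 1)\<^sup>2"
  proof -
    have "1 \<le> (n + 1)\<^sup>2" by simp
    then have "t + t' + 1 \<le> op_cost c * (n + 1)\<^sup>2 + ops_cost cs * (n + 1)\<^sup>2 + (n + 1)\<^sup>2"
      using 1(2) 2(2) by linarith
    then show ?thesis unfolding ops_cost_def by (simp add: algebra_simps)
  qed
  ultimately show ?case using 2(3,4) unfolding run_ops_def by auto
qed

definition run_loop :: "nat \<Rightarrow> vop list \<Rightarrow> nat \<Rightarrow> (name \<Rightarrow> nat \<Rightarrow> nat) \<Rightarrow> name \<Rightarrow> nat \<Rightarrow> nat" where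
  "run_loop n cs k A = fold (\<lambda>g. run_ops n g cs) [0..<k] A"

lemma compile_loop_exec:
  fixes s :: state
  assumes "list_all (op_ok dg w) cs" "bounded_by n dg A" "arrays s = A" "scalars s ''n'' = n" "1 \<le> w"
  shows "\<exists>t s'. exec ((n + 2) ^ w) (count_loop ''g'' (compile_ops cs)) s t s' \<and>
    t \<le> (ops_cost cs + 10) * (n + 1) ^ 3 \<and> arrays s' = run_loop n cs n A \<and> scalars s' ''n'' = n \<and>
    bounded_by n dg (run_loop n cs n A)"
proof -
  let ?W = "(n + 2) ^ w" and ?T = "ops_cost cs * (n + 1)\<^sup>2"
  let ?I = "\<lambda>k (s :: state). arrays s = run_loop n cs k A \<and> bounded_by n dg (run_loop n cs k A)"
  have "(n + 2) ^ 1 \<le> ?W" by (rule power_increasing) (use assms in auto)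
  then have nW: "n \<le> ?W" by simp
  have "\<exists>t s'. exec ?W (count_loop ''g'' (compile_ops cs)) s t s' \<and> t \<le> (n + 1) * (?T + 10) \<and> ?I n s' \<and> scalars s' ''n'' = n"
  proof (rule count_loop_exec[where I = ?I])
    fix k s assume k: "k < n" "?I k s" "scalars s ''g'' = k" "scalars s ''n'' = n"
    then have "sees n k (run_loop n cs k A) s" unfolding sees_def by simp
    moreover have "run_loop n cs (Suc k) A = run_ops n k cs (run_loop n cs k A)" unfolding run_loop_def by simp
    ultimately show "\<exists>t s'. exec ?W (compile_ops cs) s t s' \<and> t \<le> ?T \<and> ?I (Suc k) s' \<and>
        scalars s' ''g'' = k \<and> scalars s' ''n'' = n"
      using compile_ops_exec[OF assms(1), of n "run_loop n cs k A" k s] k unfolding sees_def by fastforce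
  qed (use assms nW in \<open>auto simp: run_loop_def\<close>)
  moreover have "(n + 1) * (?T + 10) \<le> (ops_cost cs + 10) * (n + 1) ^ 3"
  proof -
    have "1 * (n + 1) \<le> (n + 1)\<^sup>2 * (n + 1)" by (rule mult_le_mono1) simp
    then have "10 * (n + 1) \<le> 10 * (n + 1) ^ 3" by (simp add: power3_eq_cube power2_eq_square)
    moreover have "(n + 1) * ?T = ops_cost cs * (n + 1) ^ 3"
      by (simp only: power3_eq_cube power2_eq_square ac_simps)
    ultimately show ?thesis unfolding distrib_right distrib_left by linarith
  qed
  ultimately show ?thesis using le_trans by blast
qed

section \<open>The vector program for one guess\<close>

abbreviation "vI \<equiv> Var ''i''"
abbreviation "vJ \<equiv> Var ''j''"
abbreviation "vT \<equiv> Var ''t''"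
abbreviation "vN \<equiv> Var ''n''"
abbreviation "vG \<equiv> Var ''g''"

text \<open>
  Truth values are represented by one and zero, so that truncated subtraction yields the connectives and
  multiplication is conjunction.
\<close>
definition posE :: "aexp \<Rightarrow> aexp" where "posE a = Minus (Const 1) (Minus (Const 1) a)"
definition negE :: "aexp \<Rightarrow> aexp" where "negE a = Minus (Const 1) a"
definition orE :: "aexp \<Rightarrow> aexp \<Rightarrow> aexp" where "orE a b = posE (Plus a b)"
definition eqE :: "aexp \<Rightarrow> aexp \<Rightarrow> aexp" where "eqE a b = negE (Plus (Minus a b) (Minus b a))"
definition adjE :: "aexp \<Rightarrow> aexp \<Rightarrow> aexp" where "adjE a b = Load ''adj'' (Plus (Times a vN) b)"

definition count_op :: "name \<Rightarrow> name \<Rightarrow> aexp \<Rightarrow> vop" where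
  "count_op X Y h = VOp X (Const 0) False (Times (adjE vI vJ) (Load Y vJ)) h"
definition map_op :: "name \<Rightarrow> aexp \<Rightarrow> vop" where
  "map_op X h = VOp X (Const 0) False (Const 0) h"
definition sum_op :: "name \<Rightarrow> aexp \<Rightarrow> aexp \<Rightarrow> vop" where
  "sum_op X e h = VOp X (Const 0) False e h"
definition max_op :: "name \<Rightarrow> aexp \<Rightarrow> vop" where
  "max_op X e = VOp X (Const 0) True e vT"
definition spread_op :: "aexp \<Rightarrow> name \<Rightarrow> name \<Rightarrow> vop" where
  "spread_op a X Y = count_op X Y (orE (Load Y vI) (Times a vT))"

definition component_ops :: "vop list" where
  "component_ops = [map_op ''c0'' (eqE vI vG), spread_op (Const 1) ''c1'' ''c0'', spread_op (Const 1) ''c2'' ''c1'',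
     spread_op (Const 1) ''c3'' ''c2'', spread_op (Const 1) ''comp'' ''c3'']"

text \<open>
  These read the block from the array \<open>d\<close>; the levels, the matched and the unmatched vertices
  become the arrays \<open>l1\<close>, \<open>l2\<close>, \<open>l3\<close>, \<open>m\<close> and
  \<open>u\<close>.
\<close>
definition level_ops :: "vop list" where
  "level_ops =
    [count_op ''l1'' ''d'' (Times (negE (Load ''d'' vI)) (posE vT)),
     count_op ''l2'' ''l1'' (Times (negE (Load ''d'' vI)) (Times (negE (Load ''l1'' vI)) (posE vT))),
     count_op ''l3'' ''l2'' (Times (negE (Load ''d'' vI)) (Times (negE (Load ''l1'' vI)) (Times (negE (Load ''l2'' vI)) (posE vT)))),
     count_op ''m'' ''l2'' (Times (Load ''l2'' vI) (posE vT)),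
     map_op ''u'' (Times (Load ''l2'' vI) (negE (Load ''m'' vI)))]"

definition around_block_tail_ops :: "vop list" where
  "around_block_tail_ops =
    [count_op ''f'' ''m'' (Times (Load ''l3'' vI) (negE (posE vT))),
     count_op ''e'' ''l3'' (Times (Load ''f'' vI) (posE vT)),
     count_op ''s'' ''e'' (Times (Load ''u'' vI) (posE vT)),
     count_op ''el'' ''s'' (Times (Load ''f'' vI) (orE (Load ''e'' vI) (negE (posE vT)))),
     sum_op ''key'' (adjE vI vJ) (Plus (Plus (Times vT vN) vI) (Const 1)),
     max_op ''best'' (Times (Times (adjE vI vJ) (Load ''el'' vJ)) (Load ''key'' vJ)),
     sum_op ''pk'' (Times (Times (adjE vI vJ) (Load ''u'' vJ)) (eqE (Load ''best'' vJ) (Load ''key'' vI)))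
       (Times (Load ''el'' vI) (posE vT)),
     map_op ''r'' (orE (Load ''l1'' vI) (Times (Load ''l3'' vI) (negE (Load ''pk'' vI))))]"

definition around_block_ops :: "vop list" where "around_block_ops = level_ops @ around_block_tail_ops"

definition ball_op :: vop where "ball_op = map_op ''d'' (orE (eqE vI vG) (adjE vI vG))"

text \<open>
  The unspoilt vertices of levels one and three are in \<open>k2\<close> and \<open>k4\<close>; those of
  level two are the unmatched vertices in \<open>u\<close>.
\<close>
definition around_core_tail_ops :: "vop list" where
  "around_core_tail_ops =
    [count_op ''k1'' ''d'' (Times (Load ''l1'' vI) (eqE vT (Const 1))),
     count_op ''k2'' ''l1'' (Times (Load ''k1'' vI) (negE (posE vT))),
     count_op ''k4'' ''l3'' (Times (Load ''l3'' vI) (eqE vT (Const 1))),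
     map_op ''b0'' (Times (negE (Load ''d'' vI)) (negE (orE (Load ''k2'' vI) (orE (Load ''u'' vI) (Load ''k4'' vI))))),
     spread_op (negE (Load ''d'' vI)) ''b1'' ''b0'', spread_op (negE (Load ''d'' vI)) ''b2'' ''b1'',
     spread_op (negE (Load ''d'' vI)) ''b3'' ''b2'', spread_op (negE (Load ''d'' vI)) ''b4'' ''b3'',
     map_op ''r'' (Times (Load ''l2'' vI) (negE (Load ''b4'' vI)))]"

definition around_core_ops :: "vop list" where "around_core_ops = ball_op # level_ops @ around_core_tail_ops"

definition around_white_ops :: "vop list" where
  "around_white_ops = map_op ''d'' (eqE vI vG) # level_ops @ [map_op ''r'' (orE (Load ''d'' vI) (Load ''u'' vI))]"

definition pair_op :: "aexp \<Rightarrow> aexp \<Rightarrow> vop" where "pair_op a b = map_op ''d'' (orE (eqE vI a) (eqE vI b))"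

definition corner_ops :: "name \<Rightarrow> name \<Rightarrow> name \<Rightarrow> vop list" where
  "corner_ops X Y1 Y2 =
    [sum_op ''x'' (Times (adjE (Load X vI) vJ) (adjE vI vJ)) (Times (adjE (Load X vI) vI) (posE vT)),
     max_op Y1 (Times (Load ''x'' vJ) vJ),
     max_op Y2 (Times (Times (adjE (Load X vI) vJ) (adjE (Load Y1 vI) vJ)) vJ)]"

definition unmatched_ops :: "name \<Rightarrow> name \<Rightarrow> name \<Rightarrow> vop list" where
  "unmatched_ops X Y Z = pair_op (Load X vI) (Load Y vI) # level_ops @ [max_op Z (Times (Load ''u'' vJ) vJ)]"

definition root_ops :: "vop list" where
  "root_ops = [max_op ''q1'' (Times (Load ''comp'' vJ) vJ), max_op ''q2'' (Times (adjE (Load ''q1'' vI) vJ) vJ)] @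
    corner_ops ''q1'' ''q3'' ''q4'' @ corner_ops ''q2'' ''q5'' ''q6'' @
    unmatched_ops ''q1'' ''q3'' ''z1'' @ unmatched_ops ''q1'' ''q4'' ''z2'' @ unmatched_ops ''q2'' ''q5'' ''z3'' @ unmatched_ops ''q2'' ''q6'' ''z4''"

text \<open>
  The candidate is in \<open>r\<close>, the current white set in \<open>cur\<close>. The component of
  \<open>g\<close> takes over the candidate if the candidate has no defects there and is strictly cheaper.
  Quantities that belong to the whole component, such as the numbers of defects and the costs, are stored in
  every entry of an array.
\<close>
definition update_ops :: "vop list" where
  "update_ops =
    [count_op ''wn'' ''r'' vT, map_op ''nr'' (negE (Load ''r'' vI)), count_op ''nn'' ''nr'' vT,
     map_op ''bad'' (Times (Load ''comp'' vI) (Times (posE (Load ''wn'' vI))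
       (orE (Load ''r'' vI) (negE (eqE (Load ''nn'' vI) (Const 1)))))),
     sum_op ''vio'' (Load ''bad'' vJ) vT,
     sum_op ''cr'' (Times (Load ''comp'' vJ) (Times (Load ''nr'' vJ) (Load ''nn'' vJ))) vT,
     map_op ''nc'' (negE (Load ''cur'' vI)), count_op ''cn'' ''nc'' vT,
     sum_op ''cc'' (Times (Load ''comp'' vJ) (Times (Load ''nc'' vJ) (Load ''cn'' vJ))) vT,
     map_op ''up'' (Times (negE (posE (Load ''vio'' vI))) (posE (Minus (Load ''cc'' vI) (Load ''cr'' vI)))),
     map_op ''nx'' (orE (Times (Load ''comp'' vI) (orE (Times (Load ''up'' vI) (Load ''r'' vI)) (Times (negE (Load ''up'' vI)) (Load ''cur'' vI))))
       (Times (negE (Load ''comp'' vI)) (Load ''cur'' vI))),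
     map_op ''cur'' (Load ''nx'' vI)]"

definition root_names :: "name list" where
  "root_names = [''q1'', ''q2'', ''z1'', ''z2'', ''z3'', ''z4'']"

definition body_ops :: "vop list" where
  "body_ops = component_ops @ around_core_ops @ update_ops @ around_white_ops @ update_ops @ (ball_op # around_block_ops) @ update_ops @
     root_ops @ concat (map (\<lambda>F. (pair_op (Load F vI) vG # around_block_ops) @ update_ops) root_names)"

definition out_op :: vop where
  "out_op = VOp ''out'' (Times vG vN) False (Const 0)
     (Times (adjE vG vI) (Times (negE (Load ''cur'' vG)) (negE (Load ''cur'' vI))))"

text \<open>
  Entries are zero or one unless they are counts, costs, vertices or ranks.
\<close>
definition entry_degree :: "name \<Rightarrow> nat" where
  "entry_degree X = (if X = ''key'' then 4 else if X = ''best'' then 5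
     else if X \<in> {''cr'', ''cc'', ''q1'', ''q2'', ''q3'', ''q4'', ''q5'', ''q6'', ''z1'', ''z2'', ''z3'', ''z4''} then 2
     else if X \<in> {''wn'', ''nn'', ''cn'', ''vio''} then 1 else 0)"

lemma component_ops_ok: "list_all (op_ok entry_degree 7) component_ops" by code_simp
lemma around_block_ops_ok: "list_all (op_ok entry_degree 7) around_block_ops" by code_simp
lemma around_core_ops_ok: "list_all (op_ok entry_degree 7) around_core_ops" by code_simp
lemma around_white_ops_ok: "list_all (op_ok entry_degree 7) around_white_ops" by code_simp
lemma update_ops_ok: "list_all (op_ok entry_degree 7) update_ops" by code_simp
lemma root_ops_ok: "list_all (op_ok entry_degree 7) root_ops" by code_simp
lemma pair_ops_ok: "list_all (\<lambda>F. op_ok entry_degree 7 (pair_op (Load F vI) vG)) root_names" by code_simp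
lemma ball_op_ok: "op_ok entry_degree 7 ball_op" by code_simp

lemma body_ops_ok: "list_all (op_ok entry_degree 7) body_ops"
  using component_ops_ok around_block_ops_ok around_core_ops_ok around_white_ops_ok update_ops_ok root_ops_ok pair_ops_ok ball_op_ok
  unfolding body_ops_def by (simp add: list_all_iff ball_Un)

lemma out_op_ok: "list_all (op_ok entry_degree 7) [out_op]"
  by code_simp

lemma aval_posE [simp]: "aval (posE a) s = of_bool (0 < aval a s)" unfolding posE_def by simp
lemma aval_negE [simp]: "aval (negE a) s = 1 - aval a s" unfolding negE_def by simp
lemma aval_orE [simp]: "aval (orE a b) s = of_bool (0 < aval a s \<or> 0 < aval b s)" unfolding orE_def by simp
lemma aval_eqE [simp]: "aval (eqE a b) s = of_bool (aval a s = aval b s)" unfolding eqE_def by auto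
lemma aval_adjE [simp]: "aval (adjE a b) s = arrays s ''adj'' (aval a s * scalars s ''n'' + aval b s)"
  unfolding adjE_def by simp

lemma env_simps [simp]:
  "scalars (env n g i j t A) ''n'' = n" "scalars (env n g i j t A) ''g'' = g"
  "scalars (env n g i j t A) ''i'' = i" "scalars (env n g i j t A) ''j'' = j"
  "scalars (env n g i j t A) ''t'' = t" "arrays (env n g i j t A) = A"
  unfolding env_def by simp_all

lemma op_names [simp]: "op_name (count_op X Y h) = X" "op_name (map_op X h) = X" "op_name (sum_op X e h) = X"
  "op_name (max_op X e) = X" "op_name (spread_op a X Y) = X" "op_name ball_op = ''d''" "op_name (pair_op a b) = ''d''"
  unfolding count_op_def map_op_def sum_op_def max_op_def spread_op_def ball_op_def pair_op_def by simp_all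

lemma run_op_other [simp]: "Y \<noteq> op_name c \<Longrightarrow> run_op n g c A Y = A Y"
  unfolding run_op_def by simp

lemma run_ops_Nil [simp]: "run_ops n g [] A = A" unfolding run_ops_def by simp
lemma run_ops_Cons: "run_ops n g (c # cs) A = run_ops n g cs (run_op n g c A)"
  unfolding run_ops_def by simp
lemma run_ops_append: "run_ops n g (cs @ ds) A = run_ops n g ds (run_ops n g cs A)"
  unfolding run_ops_def by simp

lemma run_ops_other: "Y \<notin> op_name ` set cs \<Longrightarrow> run_ops n g cs A Y = A Y"
  by (induction cs arbitrary: A) (simp_all add: run_ops_Cons)

context p6free_input begin

definition stores :: "(nat \<Rightarrow> nat) \<Rightarrow> nat set \<Rightarrow> bool" where
  "stores f S \<longleftrightarrow> (\<forall>i<n. f i = of_bool (i \<in> S))"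

lemma storesD: "stores f S \<Longrightarrow> i < n \<Longrightarrow> f i = of_bool (i \<in> S)" unfolding stores_def by simp

definition stores_graph :: "(name \<Rightarrow> nat \<Rightarrow> nat) \<Rightarrow> bool" where
  "stores_graph A \<longleftrightarrow> (\<forall>i<n. \<forall>j<n. A ''adj'' (i * n + j) = of_bool (adj i j))"

lemma graphD: "stores_graph A \<Longrightarrow> i < n \<Longrightarrow> j < n \<Longrightarrow> A ''adj'' (i * n + j) = of_bool (adj i j)"
  unfolding stores_graph_def by simp

lemma stores_graph_run_op: "stores_graph A \<Longrightarrow> op_name c \<noteq> ''adj'' \<Longrightarrow> stores_graph (run_op n g c A)"
  unfolding stores_graph_def by simp

lemma sum_of_bool_card: "(\<Sum>j<n. of_bool (P j)) = card {j. j < n \<and> P j}"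
proof -
  have "(\<Sum>j<n. of_bool (P j)) = (\<Sum>j\<in>{j. j < n \<and> P j}. 1)"
    by (rule sum.mono_neutral_cong_right) auto
  then show ?thesis unfolding card_eq_sum .
qed

lemma count_red:
  assumes "stores_graph A" "stores (A Y) S" "i < n"
  shows "reduction False n (\<lambda>j. aval (Times (adjE vI vJ) (Load Y vJ)) (env n g i j 0 A)) = card {u. adj i u \<and> u \<in> S}"
proof -
  have "reduction False n (\<lambda>j. aval (Times (adjE vI vJ) (Load Y vJ)) (env n g i j 0 A)) =
      (\<Sum>j<n. of_bool (adj i j \<and> j \<in> S))"
    unfolding reduction_def using assms by (simp add: graphD storesD flip: of_bool_conj)
  also have "\<dots> = card {u. adj i u \<and> u \<in> S}"
    unfolding sum_of_bool_card using adj_less by (auto intro!: arg_cong[of _ _ card])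
  finally show ?thesis .
qed

lemma count_op_val:
  assumes "stores_graph A" "stores (A Y) S" "i < n"
  shows "run_op n g (count_op X Y h) A X i = aval h (env n g i 0 (card {u. adj i u \<and> u \<in> S}) A)"
  using count_red[OF assms, of g] assms(3) unfolding run_op_def count_op_def by simp

lemma map_op_val: "i < n \<Longrightarrow> run_op n g (map_op X h) A X i = aval h (env n g i 0 0 A)"
  unfolding run_op_def map_op_def by (simp add: reduction_def)

lemma sum_op_val: "i < n \<Longrightarrow> run_op n g (sum_op X e h) A X i =
    aval h (env n g i 0 (\<Sum>j<n. aval e (env n g i j 0 A)) A)"
  unfolding run_op_def sum_op_def by (simp add: reduction_def)

lemma max_op_val: "i < n \<Longrightarrow> run_op n g (max_op X e) A X i =
    Max (insert 0 ((\<lambda>j. aval e (env n g i j 0 A)) ` {..<n}))"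
  unfolding run_op_def max_op_def by (simp add: reduction_def)

lemma count_op_stores:
  assumes "stores_graph A" "stores (A Y) S"
    and "\<And>i. i < n \<Longrightarrow> aval h (env n g i 0 (card {u. adj i u \<and> u \<in> S}) A) = of_bool (i \<in> Z)"
  shows "stores (run_op n g (count_op X Y h) A X) Z"
  unfolding stores_def using count_op_val[OF assms(1,2)] assms(3) by simp

lemma map_op_stores:
  assumes "\<And>i. i < n \<Longrightarrow> aval h (env n g i 0 0 A) = of_bool (i \<in> Z)"
  shows "stores (run_op n g (map_op X h) A X) Z"
  unfolding stores_def using map_op_val assms by simp

lemma card_nb_pos [simp]: "0 < card {u. adj v u \<and> u \<in> S} \<longleftrightarrow> (\<exists>u\<in>S. adj v u)"
  using finite_nb'[of v "\<lambda>u. u \<in> S"] by (auto simp: card_gt_0_iff)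

lemma card_nb_zero [simp]: "card {u. adj v u \<and> u \<in> S} = 0 \<longleftrightarrow> \<not> (\<exists>u\<in>S. adj v u)"
  using card_nb_pos[of v S] by linarith

lemma card_nb_one: "card {u. adj v u \<and> P u} = Suc 0 \<longleftrightarrow> (\<exists>!u. adj v u \<and> P u)"
  by (auto simp: card_1_singleton_iff set_eq_iff) metis+

lemma spread_op_stores:
  assumes "stores_graph A" "stores (A Y) S" "\<And>i. i < n \<Longrightarrow> \<forall>t. aval a (env n g i 0 t A) = of_bool (i \<notin> B)"
  shows "stores (run_op n g (spread_op a X Y) A X) (spread adj B S)"
  unfolding spread_op_def
  by (rule count_op_stores[OF assms(1,2)]) (use assms(3) in \<open>auto simp: storesD[OF assms(2)] spread_def\<close>)

lemma component_ops_stores: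
  assumes A: "stores_graph A" and g: "g < n"
  shows "stores (run_ops n g component_ops A ''comp'') (component_of adj g)"
proof -
  define A0 where "A0 = run_op n g (map_op ''c0'' (eqE vI vG)) A"
  define A1 where "A1 = run_op n g (spread_op (Const 1) ''c1'' ''c0'') A0"
  define A2 where "A2 = run_op n g (spread_op (Const 1) ''c2'' ''c1'') A1"
  define A3 where "A3 = run_op n g (spread_op (Const 1) ''c3'' ''c2'') A2"
  define A4 where "A4 = run_op n g (spread_op (Const 1) ''comp'' ''c3'') A3"
  have i: "stores_graph A0" "stores_graph A1" "stores_graph A2" "stores_graph A3" unfolding A0_def A1_def A2_def A3_def by (intro stores_graph_run_op A; simp)+
  have 0: "stores (A0 ''c0'') {g}" unfolding A0_def by (rule map_op_stores) simp
  have 1: "stores (A1 ''c1'') (spread adj {} {g})" unfolding A1_def by (rule spread_op_stores[OF i(1) 0]) simp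
  have 2: "stores (A2 ''c2'') (spread adj {} (spread adj {} {g}))" unfolding A2_def by (rule spread_op_stores[OF i(2) 1]) simp
  have 3: "stores (A3 ''c3'') (spread adj {} (spread adj {} (spread adj {} {g})))" unfolding A3_def by (rule spread_op_stores[OF i(3) 2]) simp
  have 4: "stores (A4 ''comp'') (spread4 adj {} {g})" unfolding A4_def spread4_def by (rule spread_op_stores[OF i(4) 3]) simp
  show ?thesis using 4 unfolding component_ops_def run_ops_Cons run_ops_Nil A0_def A1_def A2_def A3_def A4_def component_of_def .
qed

lemma level_ops_stores:
  fixes g :: nat
  assumes A: "stores_graph A" and d: "stores (A ''d'') D"
  defines "A' \<equiv> run_ops n g level_ops A"
  shows "stores_graph A'" "stores (A' ''d'') D" "stores (A' ''l1'') (level1 adj D)" "stores (A' ''l2'') (level2 adj D)" "stores (A' ''l3'') (level3 adj D)"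
    "stores (A' ''m'') (matched adj D)" "stores (A' ''u'') (unmatched adj D)"
proof -
  define A1 where "A1 = run_op n g (level_ops ! 0) A"
  define A2 where "A2 = run_op n g (level_ops ! 1) A1"
  define A3 where "A3 = run_op n g (level_ops ! 2) A2"
  define A4 where "A4 = run_op n g (level_ops ! 3) A3"
  define A5 where "A5 = run_op n g (level_ops ! 4) A4"
  note defs = A1_def A2_def A3_def A4_def A5_def level_ops_def
  have A': "A' = A5" unfolding A'_def defs by (simp add: run_ops_Cons)
  have i: "stores_graph A1" "stores_graph A2" "stores_graph A3" "stores_graph A4" "stores_graph A5" using A unfolding defs by (simp_all add: stores_graph_run_op)
  have d': "A1 ''d'' = A ''d''" "A2 ''d'' = A ''d''" "A3 ''d'' = A ''d''" "A4 ''d'' = A ''d''" "A5 ''d'' = A ''d''"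
    "A2 ''l1'' = A1 ''l1''" "A3 ''l1'' = A1 ''l1''" "A4 ''l1'' = A1 ''l1''" "A5 ''l1'' = A1 ''l1''"
    "A3 ''l2'' = A2 ''l2''" "A4 ''l2'' = A2 ''l2''" "A5 ''l2'' = A2 ''l2''"
    "A4 ''l3'' = A3 ''l3''" "A5 ''l3'' = A3 ''l3''" "A5 ''m'' = A4 ''m''"
    unfolding defs by simp_all
  have 1: "stores (A1 ''l1'') (level1 adj D)"
    unfolding A1_def level_ops_def nth_Cons_0
    by (rule count_op_stores[OF A d]) (auto simp: storesD[OF d] level1_def)
  have 2: "stores (A2 ''l2'') (level2 adj D)"
    unfolding A2_def level_ops_def One_nat_def nth_Cons_Suc nth_Cons_0
    by (rule count_op_stores[OF i(1) 1]) (auto simp: d' storesD[OF d] storesD[OF 1] level2_def)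
  have 3: "stores (A3 ''l3'') (level3 adj D)"
    unfolding A3_def level_ops_def numeral_2_eq_2 nth_Cons_Suc nth_Cons_0
    by (rule count_op_stores[OF i(2) 2]) (auto simp: d' storesD[OF d] storesD[OF 1] storesD[OF 2] level3_def)
  have 4: "stores (A4 ''m'') (matched adj D)"
    unfolding A4_def level_ops_def numeral_3_eq_3 nth_Cons_Suc nth_Cons_0
    by (rule count_op_stores[OF i(3)]) (use 2 in \<open>auto simp: d' storesD[OF 2] matched_def\<close>)
  have 5: "stores (A5 ''u'') (unmatched adj D)"
    unfolding A5_def level_ops_def
    by (simp, rule map_op_stores) (use 2 4 in \<open>auto simp: d' storesD[OF 2] storesD[OF 4] matched_def unmatched_def\<close>)
  show "stores_graph A'" "stores (A' ''d'') D" "stores (A' ''l1'') (level1 adj D)" "stores (A' ''l2'') (level2 adj D)" "stores (A' ''l3'') (level3 adj D)"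
    "stores (A' ''m'') (matched adj D)" "stores (A' ''u'') (unmatched adj D)"
    unfolding A' d' using i d 1 2 3 4 5 by simp_all
qed

lemma around_block_ops_stores:
  fixes g :: nat
  assumes A: "stores_graph A" and d: "stores (A ''d'') D"
  shows "stores (run_ops n g around_block_ops A ''r'') (around_block adj (degree_key adj n) D)"
proof -
  define A0 where "A0 = run_ops n g level_ops A"
  note L = level_ops_stores[OF A d, of g, folded A0_def]
  define A1 where "A1 = run_op n g (around_block_tail_ops ! 0) A0"
  define A2 where "A2 = run_op n g (around_block_tail_ops ! 1) A1"
  define A3 where "A3 = run_op n g (around_block_tail_ops ! 2) A2"
  define A4 where "A4 = run_op n g (around_block_tail_ops ! 3) A3"
  define A5 where "A5 = run_op n g (around_block_tail_ops ! 4) A4"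
  define A6 where "A6 = run_op n g (around_block_tail_ops ! 5) A5"
  define A7 where "A7 = run_op n g (around_block_tail_ops ! 6) A6"
  define A8 where "A8 = run_op n g (around_block_tail_ops ! 7) A7"
  note cs = around_block_tail_ops_def
  note defs = A1_def A2_def A3_def A4_def A5_def A6_def A7_def A8_def cs
  have fin: "run_ops n g around_block_ops A = A8"
    unfolding around_block_ops_def run_ops_append A0_def[symmetric] unfolding defs by (simp add: run_ops_Cons)
  have i: "stores_graph A1" "stores_graph A2" "stores_graph A3" "stores_graph A4" "stores_graph A5" "stores_graph A6" "stores_graph A7"
    using L(1) unfolding defs by (simp_all add: stores_graph_run_op)
  have keep: "A1 ''l3'' = A0 ''l3''" "A2 ''u'' = A0 ''u''" "A3 ''f'' = A1 ''f''" "A3 ''e'' = A2 ''e''"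
    "A5 ''el'' = A4 ''el''" "A6 ''el'' = A4 ''el''" "A6 ''key'' = A5 ''key''" "A6 ''u'' = A0 ''u''"
    "A7 ''l1'' = A0 ''l1''" "A7 ''l3'' = A0 ''l3''" "A2 ''f'' = A1 ''f''"
    unfolding defs by simp_all
  have 1: "stores (A1 ''f'') (undecided adj D)"
    unfolding A1_def cs nth_Cons_0
    by (rule count_op_stores[OF L(1,6)]) (auto simp: storesD[OF L(5)] undecided_def)
  have 2: "stores (A2 ''e'') (linked adj D)"
    unfolding A2_def cs One_nat_def nth_Cons_Suc nth_Cons_0
    by (rule count_op_stores[OF i(1)]) (use L(5) in \<open>auto simp: keep storesD[OF 1] linked_def\<close>)
  have 3: "stores (A3 ''s'') (served adj D)"
    unfolding A3_def cs numeral_2_eq_2 nth_Cons_Suc nth_Cons_0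
    by (rule count_op_stores[OF i(2) 2]) (auto simp: keep storesD[OF L(7)] served_def)
  have 4: "stores (A4 ''el'') (eligible adj D)"
    unfolding A4_def cs numeral_3_eq_3 nth_Cons_Suc nth_Cons_0
    by (rule count_op_stores[OF i(3) 3]) (auto simp: keep storesD[OF 1] storesD[OF 2] eligible_def)
  have 5: "A5 ''key'' v = degree_key adj n v" if v: "v < n" for v
  proof -
    have "(\<Sum>j<n. aval (adjE vI vJ) (env n g v j 0 A4)) = (\<Sum>j<n. of_bool (adj v j))"
      using v by (intro sum.cong) (simp_all add: graphD[OF i(4)])
    also have "\<dots> = card {u. adj v u}"
      unfolding sum_of_bool_card using adj_less by (auto intro!: arg_cong[of _ _ card])
    finally show ?thesis unfolding A5_def cs by (simp add: sum_op_val[OF v] degree_key_def del: aval_adjE)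
  qed
  have 6: "A6 ''best'' y = Max (insert 0 ((\<lambda>j. of_bool (adj y j \<and> j \<in> eligible adj D) * degree_key adj n j) ` {..<n}))"
    if y: "y < n" for y
  proof -
    have "(\<lambda>j. aval (Times (Times (adjE vI vJ) (Load ''el'' vJ)) (Load ''key'' vJ)) (env n g y j 0 A5)) ` {..<n} =
      (\<lambda>j. of_bool (adj y j \<and> j \<in> eligible adj D) * degree_key adj n j) ` {..<n}"
      using y by (intro image_cong) (simp_all add: graphD[OF i(5)] keep storesD[OF 4] 5)
    then show ?thesis unfolding A6_def cs by (simp add: max_op_val[OF y])
  qed
  have best: "A6 ''best'' y = degree_key adj n v \<longleftrightarrow> (\<forall>p\<in>eligible adj D. adj y p \<longrightarrow> degree_key adj n p \<le> degree_key adj n v)"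
    if v: "v \<in> eligible adj D" "adj y v" "y < n" for y v
  proof -
    let ?S = "(\<lambda>j. of_bool (adj y j \<and> j \<in> eligible adj D) * degree_key adj n j) ` {..<n}"
    \<comment> \<open>\<open>v\<close> itself is among the vertices over which the maximum is taken.\<close>
    have vS: "degree_key adj n v \<in> ?S" using v adj_less by (intro image_eqI[of _ _ v]) auto
    show ?thesis
    proof
      assume eq: "A6 ''best'' y = degree_key adj n v"
      show "\<forall>p\<in>eligible adj D. adj y p \<longrightarrow> degree_key adj n p \<le> degree_key adj n v"
      proof (intro ballI impI)
        fix p assume p: "p \<in> eligible adj D" "adj y p"
        then have "degree_key adj n p \<in> ?S" using adj_less by (intro image_eqI[of _ _ p]) auto
        then show "degree_key adj n p \<le> degree_key adj n v"
          using eq Max_ge[of "insert 0 ?S" "degree_key adj n p"] unfolding 6[OF v(3)] by simp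
      qed
    next
      assume max: "\<forall>p\<in>eligible adj D. adj y p \<longrightarrow> degree_key adj n p \<le> degree_key adj n v"
      show "A6 ''best'' y = degree_key adj n v"
        unfolding 6[OF v(3)] by (rule Max_eqI) (use max vS in auto)
    qed
  qed
  have 7: "stores (A7 ''pk'') (picked adj (degree_key adj n) D)"
    unfolding stores_def
  proof (intro allI impI)
    fix v assume v: "v < n"
    let ?P = "\<lambda>y. adj v y \<and> y \<in> unmatched adj D \<and> A6 ''best'' y = degree_key adj n v"
    have "(\<Sum>j<n. aval (Times (Times (adjE vI vJ) (Load ''u'' vJ)) (eqE (Load ''best'' vJ) (Load ''key'' vI))) (env n g v j 0 A6))
        = (\<Sum>j<n. of_bool (?P j))"
      using v by (intro sum.cong) (simp_all add: graphD[OF i(6)] keep storesD[OF L(7)] 5 flip: of_bool_conj)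
    then have "A7 ''pk'' v = of_bool (v \<in> eligible adj D \<and> (\<exists>y<n. ?P y))"
      unfolding A7_def cs using v
      by (simp add: sum_op_val[OF v] keep storesD[OF 4] sum_of_bool_card card_gt_0_iff del: aval_adjE aval_eqE)
    moreover have "v \<in> eligible adj D \<and> (\<exists>y<n. ?P y) \<longleftrightarrow> v \<in> picked adj (degree_key adj n) D"
      unfolding picked_def using best adj_less adj_sym by blast
    ultimately show "A7 ''pk'' v = of_bool (v \<in> picked adj (degree_key adj n) D)" by simp
  qed
  have "stores (A8 ''r'') (around_block adj (degree_key adj n) D)"
    unfolding A8_def cs
    by (simp, rule map_op_stores) (auto simp: keep storesD[OF L(3)] storesD[OF L(5)] storesD[OF 7] around_block_def)
  then show ?thesis unfolding fin .
qed

lemma ball_op_stores: "stores_graph A \<Longrightarrow> g < n \<Longrightarrow> stores (run_op n g ball_op A ''d'') (insert g {v. adj v g})"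
  unfolding ball_op_def by (rule map_op_stores) (auto simp: graphD)

lemma around_core_ops_stores:
  assumes A: "stores_graph A" and g: "g < n"
  shows "stores (run_ops n g around_core_ops A ''r'') (around_core adj g)"
proof -
  let ?B = "insert g {v. adj v g}"
  define Ad where "Ad = run_op n g ball_op A"
  have Ad: "stores_graph Ad" "stores (Ad ''d'') ?B"
    unfolding Ad_def using stores_graph_run_op[OF A, of ball_op g] ball_op_stores[OF A g] by simp_all
  define A0 where "A0 = run_ops n g level_ops Ad"
  note L = level_ops_stores[OF Ad, of g, folded A0_def]
  note cs = around_core_tail_ops_def
  define A1 where "A1 = run_op n g (around_core_tail_ops ! 0) A0"
  define A2 where "A2 = run_op n g (around_core_tail_ops ! 1) A1"
  define A3 where "A3 = run_op n g (around_core_tail_ops ! 2) A2"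
  define A4 where "A4 = run_op n g (around_core_tail_ops ! 3) A3"
  define A5 where "A5 = run_op n g (around_core_tail_ops ! 4) A4"
  define A6 where "A6 = run_op n g (around_core_tail_ops ! 5) A5"
  define A7 where "A7 = run_op n g (around_core_tail_ops ! 6) A6"
  define A8 where "A8 = run_op n g (around_core_tail_ops ! 7) A7"
  define A9 where "A9 = run_op n g (around_core_tail_ops ! 8) A8"
  note defs = A1_def A2_def A3_def A4_def A5_def A6_def A7_def A8_def A9_def cs
  have fin: "run_ops n g around_core_ops A = A9"
    unfolding around_core_ops_def run_ops_Cons run_ops_append Ad_def[symmetric] A0_def[symmetric]
    unfolding defs by (simp add: run_ops_Cons)
  have i: "stores_graph A1" "stores_graph A2" "stores_graph A3" "stores_graph A4" "stores_graph A5" "stores_graph A6" "stores_graph A7"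
    using L(1) unfolding defs by (simp_all add: stores_graph_run_op)
  have keep: "A1 ''l1'' = A0 ''l1''" "A2 ''l3'' = A0 ''l3''" "A3 ''d'' = A0 ''d''" "A3 ''k2'' = A2 ''k2''"
    "A3 ''u'' = A0 ''u''" "A4 ''d'' = A0 ''d''" "A5 ''d'' = A0 ''d''" "A6 ''d'' = A0 ''d''" "A7 ''d'' = A0 ''d''"
    "A8 ''l2'' = A0 ''l2''"
    unfolding defs by simp_all
  let ?K1 = "{v \<in> level1 adj ?B. \<exists>!u. adj v u \<and> u \<in> ?B}"
  let ?K2 = "{v \<in> level1 adj ?B. (\<exists>!u. adj v u \<and> u \<in> ?B) \<and> \<not> (\<exists>u\<in>level1 adj ?B. adj v u)}"
  let ?K4 = "{v \<in> level3 adj ?B. \<exists>!u. adj v u \<and> u \<in> level3 adj ?B}"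
  have 1: "stores (A1 ''k1'') ?K1"
    unfolding A1_def cs nth_Cons_0
    by (rule count_op_stores[OF L(1,2)]) (simp add: storesD[OF L(3)] card_nb_one)
  have 2: "stores (A2 ''k2'') ?K2"
    unfolding A2_def cs One_nat_def nth_Cons_Suc nth_Cons_0
    by (rule count_op_stores[OF i(1)]) (use L(3) in \<open>auto simp: keep storesD[OF 1]\<close>)
  have 3: "stores (A3 ''k4'') ?K4"
    unfolding A3_def cs numeral_2_eq_2 nth_Cons_Suc nth_Cons_0
    by (rule count_op_stores[OF i(2)]) (use L(5) in \<open>auto simp: keep storesD[OF L(5)] card_nb_one\<close>)
  have 4: "stores (A4 ''b0'') (- ?B - unspoilt adj ?B)"
    unfolding A4_def cs numeral_3_eq_3 nth_Cons_Suc nth_Cons_0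
  proof (rule map_op_stores)
    fix i assume i: "i < n"
    have "i \<in> unspoilt adj ?B \<longleftrightarrow> i \<in> ?K2 \<or> i \<in> unmatched adj ?B \<or> i \<in> ?K4"
      unfolding unspoilt_def unmatched_def by blast
    then show "aval (Times (negE (Load ''d'' vI)) (negE (orE (Load ''k2'' vI) (orE (Load ''u'' vI) (Load ''k4'' vI)))))
        (env n g i 0 0 A3) = of_bool (i \<in> - ?B - unspoilt adj ?B)"
      using storesD[OF L(2) i] storesD[OF L(7) i] storesD[OF 2 i] storesD[OF 3 i]
      by (simp add: keep del: insert_iff mem_Collect_eq)
  qed
  let ?g = "negE (Load ''d'' vI)"
  have 5: "stores (A5 ''b1'') (spread adj ?B (- ?B - unspoilt adj ?B))"
    unfolding A5_def cs by (simp, rule spread_op_stores[OF i(4) 4]) (simp add: keep storesD[OF L(2)])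
  have 6: "stores (A6 ''b2'') (spread adj ?B (spread adj ?B (- ?B - unspoilt adj ?B)))"
    unfolding A6_def cs by (simp, rule spread_op_stores[OF i(5) 5]) (simp add: keep storesD[OF L(2)])
  have 7: "stores (A7 ''b3'') (spread adj ?B (spread adj ?B (spread adj ?B (- ?B - unspoilt adj ?B))))"
    unfolding A7_def cs by (simp, rule spread_op_stores[OF i(6) 6]) (simp add: keep storesD[OF L(2)])
  have 8: "stores (A8 ''b4'') (spread4 adj ?B (- ?B - unspoilt adj ?B))"
    unfolding A8_def cs spread4_def by (simp, rule spread_op_stores[OF i(7) 7]) (simp add: keep storesD[OF L(2)])
  have "stores (A9 ''r'') (level2 adj ?B - spread4 adj ?B (- ?B - unspoilt adj ?B))"
    unfolding A9_def cs
    by (simp, rule map_op_stores) (simp add: keep storesD[OF L(4)] storesD[OF 8])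
  then show ?thesis unfolding fin around_core_def Let_def .
qed

lemma around_white_ops_stores:
  assumes A: "stores_graph A" and g: "g < n"
  shows "stores (run_ops n g around_white_ops A ''r'') (around_white adj g)"
proof -
  define Ad where "Ad = run_op n g (map_op ''d'' (eqE vI vG)) A"
  have "stores (Ad ''d'') {g}" unfolding Ad_def by (rule map_op_stores) simp
  moreover have "stores_graph Ad" unfolding Ad_def by (rule stores_graph_run_op[OF A]) simp
  ultimately have L: "stores (run_ops n g level_ops Ad ''d'') {g}" "stores (run_ops n g level_ops Ad ''u'') (unmatched adj {g})"
    using level_ops_stores(2,7)[of Ad "{g}" g] by simp_all
  define A0 where "A0 = run_ops n g level_ops Ad"
  have "stores (run_op n g (map_op ''r'' (orE (Load ''d'' vI) (Load ''u'' vI))) A0 ''r'') (around_white adj g)"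
    by (rule map_op_stores)
      (use L[folded A0_def] in \<open>auto simp: storesD[OF L(1)[folded A0_def]] storesD[OF L(2)[folded A0_def]] around_white_def unmatched_def\<close>)
  then show ?thesis unfolding around_white_ops_def run_ops_Cons run_ops_append Ad_def[symmetric] A0_def[symmetric] run_ops_Nil .
qed

definition is_constant :: "(nat \<Rightarrow> nat) \<Rightarrow> nat \<Rightarrow> bool" where "is_constant f c \<longleftrightarrow> (\<forall>i<n. f i = c)"

lemma constantD: "is_constant f c \<Longrightarrow> i < n \<Longrightarrow> f i = c" unfolding is_constant_def by simp

lemma pair_op_stores:
  assumes "\<And>i t. i < n \<Longrightarrow> aval a (env n g i 0 t A) = x" "\<And>i t. i < n \<Longrightarrow> aval b (env n g i 0 t A) = y"
  shows "stores (run_op n g (pair_op a b) A ''d'') {x, y}"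
  unfolding pair_op_def by (rule map_op_stores) (auto simp: assms)

lemma max_op_largest:
  assumes "\<And>i j. i < n \<Longrightarrow> j < n \<Longrightarrow> aval e (env n g i j 0 A) = of_bool (j \<in> S) * j" "S \<subseteq> {..<n}"
  shows "is_constant (run_op n g (max_op X e) A X) (largest S)"
  unfolding is_constant_def
proof (intro allI impI)
  fix i assume i: "i < n"
  have "(\<lambda>j. aval e (env n g i j 0 A)) ` {..<n} = (\<lambda>j. of_bool (j \<in> S) * j) ` {..<n}"
    using assms(1)[OF i] by (intro image_cong) auto
  moreover have "insert 0 ((\<lambda>j. of_bool (j \<in> S) * j) ` {..<n}) = insert 0 S"
    using assms(2) by (force simp: of_bool_def image_iff)
  ultimately show "run_op n g (max_op X e) A X i = largest S"
    unfolding max_op_val[OF i] largest_def by simp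
qed

lemma largest_less: "S \<subseteq> {..<n} \<Longrightarrow> g < n \<Longrightarrow> largest S < n"
  using largest_in[of S] finite_subset[of S "{..<n}"] by (cases "S = {}") (auto simp: largest_def)

lemma corner_ops_constant:
  assumes A: "stores_graph A" and g: "g < n" and X: "is_constant (A X) x" "x < n"
    and ne: "X \<noteq> ''x''" "X \<noteq> Y1" "X \<noteq> Y2" "Y1 \<noteq> Y2" "Y1 \<noteq> ''adj''" "Y1 \<noteq> ''x''"
  shows "is_constant (run_ops n g (corner_ops X Y1 Y2) A Y1) (triangle_left adj x)"
    "is_constant (run_ops n g (corner_ops X Y1 Y2) A Y2) (triangle_right adj x)"
proof -
  define A1 where "A1 = run_op n g (corner_ops X Y1 Y2 ! 0) A"
  define A2 where "A2 = run_op n g (corner_ops X Y1 Y2 ! 1) A1"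
  define A3 where "A3 = run_op n g (corner_ops X Y1 Y2 ! 2) A2"
  note defs = A1_def A2_def A3_def corner_ops_def
  have fin: "run_ops n g (corner_ops X Y1 Y2) A = A3" unfolding defs by (simp add: run_ops_Cons)
  have i: "stores_graph A1" "stores_graph A2" using A ne unfolding defs by (simp_all add: stores_graph_run_op)
  have keep: "A1 X = A X" "A2 X = A X" "A3 Y1 = A2 Y1" using ne unfolding defs by simp_all
  let ?S = "{b. adj x b \<and> (\<exists>c. adj x c \<and> adj b c)}"
  have 1: "stores (A1 ''x'') ?S"
    unfolding stores_def
  proof (intro allI impI)
    fix v assume v: "v < n"
    have "(\<Sum>j<n. aval (Times (adjE (Load X vI) vJ) (adjE vI vJ)) (env n g v j 0 A)) = (\<Sum>j<n. of_bool (adj x j \<and> adj v j))"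
      using v X by (intro sum.cong) (auto simp: graphD[OF A] constantD[OF X(1)])
    then have "A1 ''x'' v = of_bool (adj x v \<and> (\<exists>j<n. adj x j \<and> adj v j))"
      unfolding A1_def corner_ops_def using v X
      by (simp add: sum_op_val[OF v] sum_of_bool_card card_gt_0_iff graphD[OF A] constantD[OF X(1)] del: aval.simps(6))
        (auto simp: graphD[OF A] constantD[OF X(1)])
    then show "A1 ''x'' v = of_bool (v \<in> ?S)" using adj_less by auto
  qed
  have 2: "is_constant (A2 Y1) (triangle_left adj x)"
    unfolding A2_def corner_ops_def triangle_left_def One_nat_def nth_Cons_Suc nth_Cons_0
    by (rule max_op_largest) (use adj_less in \<open>auto simp: storesD[OF 1]\<close>)
  have t: "triangle_left adj x < n" unfolding triangle_left_def by (rule largest_less[OF _ g]) (use adj_less in auto)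
  have 3: "is_constant (A3 Y2) (triangle_right adj x)"
    unfolding A3_def corner_ops_def triangle_right_def numeral_2_eq_2 nth_Cons_Suc nth_Cons_0
    by (rule max_op_largest) (use adj_less X t in \<open>auto simp: keep graphD[OF i(2)] constantD[OF X(1)] constantD[OF 2]\<close>)
  show "is_constant (run_ops n g (corner_ops X Y1 Y2) A Y1) (triangle_left adj x)"
    "is_constant (run_ops n g (corner_ops X Y1 Y2) A Y2) (triangle_right adj x)"
    unfolding fin keep by (fact 2, fact 3)
qed

lemma unmatched_ops_constant:
  assumes A: "stores_graph A" and X: "is_constant (A X) x" and Y: "is_constant (A Y) y"
  shows "is_constant (run_ops n g (unmatched_ops X Y Z) A Z) (some_unmatched adj x y)"
proof -
  define Ad where "Ad = run_op n g (pair_op (Load X vI) (Load Y vI)) A"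
  have "stores (Ad ''d'') {x, y}" unfolding Ad_def
    by (rule pair_op_stores) (simp_all add: constantD[OF X] constantD[OF Y])
  moreover have "stores_graph Ad" unfolding Ad_def by (rule stores_graph_run_op[OF A]) simp
  ultimately have L: "stores (run_ops n g level_ops Ad ''u'') (unmatched adj {x, y})" using level_ops_stores(7)[of Ad "{x, y}" g] by simp
  have sub: "unmatched adj {x, y} \<subseteq> {..<n}" using adj_less unfolding unmatched_def level2_def by auto
  show ?thesis
    unfolding unmatched_ops_def run_ops_Cons run_ops_append Ad_def[symmetric] run_ops_Nil some_unmatched_def
    by (rule max_op_largest[OF _ sub]) (simp add: storesD[OF L])
qed

end

section \<open>Correctness of the algorithm\<close>

context p6free_input begin

lemma cost_cong:
  assumes "g < n" "\<And>v. v \<in> component_of adj g \<Longrightarrow> v \<in> W \<longleftrightarrow> v \<in> W'"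
  shows "cost adj (component_of adj g) W = cost adj (component_of adj g) W'"
proof -
  note cl = graph_component_closed[OF comp_of_component[OF assms(1)]]
  have "component_of adj g - W = component_of adj g - W'" using assms(2) by blast
  moreover have "{u. adj v u \<and> u \<notin> W} = {u. adj v u \<and> u \<notin> W'}" if "v \<in> component_of adj g" for v
    using assms(2) cl[OF that] by blast
  ultimately show ?thesis unfolding cost_def by simp
qed

definition defects :: "nat set \<Rightarrow> nat set \<Rightarrow> nat set" where
  "defects H R = {v\<in>H. (\<exists>u\<in>R. adj v u) \<and> (v \<in> R \<or> card {u. adj v u \<and> u \<notin> R} \<noteq> 1)}"

lemma no_defects: "white_set_on adj H R \<Longrightarrow> defects H R = {}"
proof (rule ccontr)
  assume v: "white_set_on adj H R" and "defects H R \<noteq> {}"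
  then obtain x u where x: "x \<in> H" "u \<in> R" "adj x u" "x \<in> R \<or> card {u. adj x u \<and> u \<notin> R} \<noteq> 1"
    unfolding defects_def by blast
  have "x \<notin> R" using v x unfolding white_set_on_def by blast
  then have "\<exists>!u. adj x u \<and> u \<notin> R" using v x unfolding white_set_on_def by blast
  then show False using x(4) \<open>x \<notin> R\<close> card_nb_one[of x "\<lambda>u. u \<notin> R"] by simp
qed

text \<open>
  No edge leaves a component, so replacing a white set inside a component is checked inside and outside
  separately.
\<close>
lemma white_set_glue:
  assumes g: "g < n" and W: "white_set_on adj {..<n} W" and b: "defects (component_of adj g) R = {}"
  shows "white_set_on adj {..<n} (component_of adj g \<inter> R \<union> (W - component_of adj g))" (is "white_set_on adj _ ?Z")
  unfolding white_set_on_def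
proof (intro conjI ballI impI)
  let ?H = "component_of adj g"
  note cl = graph_component_closed[OF comp_of_component[OF g]]
  have out: "u \<notin> ?H" if "v \<notin> ?H" "adj v u" for u v using cl[of u v] that adj_sym by blast
  have nb: "v \<notin> R" "card {x. adj v x \<and> x \<notin> R} = 1" if "v \<in> ?H" "u \<in> R" "adj v u" for u v
    using b that unfolding defects_def by blast+
  show "?Z \<subseteq> {..<n}" using comp_of_sub[OF g] W unfolding white_set_on_def by blast
  fix u v assume "u \<in> ?Z" "v \<in> ?Z"
  then show "\<not> adj u v" using W nb(1)[of u v] cl[of u v] out[of u v] unfolding white_set_on_def by blast
next
  let ?H = "component_of adj g"
  note cl = graph_component_closed[OF comp_of_component[OF g]]
  have out: "u \<notin> ?H" if "v \<notin> ?H" "adj v u" for u v using cl[of u v] that adj_sym by blast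
  fix v assume v: "v \<in> {..<n} - ?Z" and "\<exists>w\<in>?Z. adj v w"
  then obtain w where w: "w \<in> ?Z" "adj v w" by blast
  show "\<exists>!u. adj v u \<and> u \<notin> ?Z"
  proof (cases "v \<in> ?H")
    case True
    then have wR: "w \<in> R" using w cl by blast
    then have "card {x. adj v x \<and> x \<notin> R} = 1" using b True w unfolding defects_def by blast
    then have "\<exists>!u. adj v u \<and> u \<notin> R" using card_nb_one[of v "\<lambda>u. u \<notin> R"] by simp
    moreover have "adj v u \<and> u \<notin> ?Z \<longleftrightarrow> adj v u \<and> u \<notin> R" for u using cl[OF True, of u] by blast
    ultimately show ?thesis by simp
  next
    case False
    then have "w \<in> W" using w out[OF False w(2)] by blast
    then have "\<exists>!u. adj v u \<and> u \<notin> W" using W v w False unfolding white_set_on_def by blast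
    moreover have "adj v u \<and> u \<notin> ?Z \<longleftrightarrow> adj v u \<and> u \<notin> W" for u using out[OF False, of u] by blast
    ultimately show ?thesis by simp
  qed
qed

lemma cost_sum:
  assumes "H \<subseteq> {..<n}"
  shows "(\<Sum>j<n. of_bool (j \<in> H) * (of_bool (j \<notin> R) * card {u. adj j u \<and> u \<notin> R})) = cost adj H R"
  unfolding cost_def by (rule sum.mono_neutral_cong_right) (use assms in auto)

text \<open>
  Only the component of \<open>g\<close> changes, and only to a cheaper white set. A candidate that is a
  white set of this component has no defects, so it is refused only if it is not cheaper.
\<close>
lemma update_ops_sem:
  assumes A: "stores_graph A" and g: "g < n" and H: "stores (A ''comp'') (component_of adj g)" and R: "stores (A ''r'') R"
    and cur: "stores (A ''cur'') W" and W: "white_set_on adj {..<n} W"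
  obtains W' where "stores (run_ops n g update_ops A ''cur'') W'" "white_set_on adj {..<n} W'"
    "\<And>h. h < n \<Longrightarrow> cost adj (component_of adj h) W' \<le> cost adj (component_of adj h) W"
    "white_set_on adj (component_of adj g) R \<Longrightarrow> cost adj (component_of adj g) W' \<le> cost adj (component_of adj g) R"
proof -
  let ?H = "component_of adj g"
  note HV = comp_of_sub[OF g]
  define A1 where "A1 = run_op n g (update_ops ! 0) A"
  define A2 where "A2 = run_op n g (update_ops ! 1) A1"
  define A3 where "A3 = run_op n g (update_ops ! 2) A2"
  define A4 where "A4 = run_op n g (update_ops ! 3) A3"
  define A5 where "A5 = run_op n g (update_ops ! 4) A4"
  define A6 where "A6 = run_op n g (update_ops ! 5) A5"
  define A7 where "A7 = run_op n g (update_ops ! 6) A6"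
  define A8 where "A8 = run_op n g (update_ops ! 7) A7"
  define A9 where "A9 = run_op n g (update_ops ! 8) A8"
  define A10 where "A10 = run_op n g (update_ops ! 9) A9"
  define A11 where "A11 = run_op n g (update_ops ! 10) A10"
  define A12 where "A12 = run_op n g (update_ops ! 11) A11"
  note defs = A1_def A2_def A3_def A4_def A5_def A6_def A7_def A8_def A9_def A10_def A11_def A12_def update_ops_def
  have fin: "run_ops n g update_ops A = A12" unfolding defs by (simp add: run_ops_Cons)
  have i: "stores_graph A2" "stores_graph A7" using A unfolding defs by (simp_all add: stores_graph_run_op)
  have keep: "A1 ''r'' = A ''r''" "A3 ''comp'' = A ''comp''" "A3 ''wn'' = A1 ''wn''" "A3 ''r'' = A ''r''"
    "A5 ''comp'' = A ''comp''" "A5 ''nr'' = A2 ''nr''" "A5 ''nn'' = A3 ''nn''" "A6 ''cur'' = A ''cur''"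
    "A8 ''comp'' = A ''comp''" "A8 ''nc'' = A7 ''nc''" "A9 ''vio'' = A5 ''vio''" "A9 ''cr'' = A6 ''cr''"
    "A10 ''comp'' = A ''comp''" "A10 ''r'' = A ''r''" "A10 ''cur'' = A ''cur''"
    unfolding defs by simp_all
  have 1: "A1 ''wn'' v = card {u. adj v u \<and> u \<in> R}" if "v < n" for v
    unfolding A1_def update_ops_def using count_op_val[OF A R that, of g "''wn''" vT] by simp
  have 2: "stores (A2 ''nr'') (- R)"
    unfolding A2_def update_ops_def by (simp, rule map_op_stores) (simp add: keep storesD[OF R])
  have 3: "A3 ''nn'' v = card {u. adj v u \<and> u \<notin> R}" if "v < n" for v
    unfolding A3_def update_ops_def using count_op_val[OF i(1) 2 that, of g "''nn''" vT] by simp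
  have 4: "stores (A4 ''bad'') (defects ?H R)"
    unfolding A4_def update_ops_def
    by (simp, rule map_op_stores) (simp add: keep storesD[OF R] storesD[OF H] 1 3 defects_def flip: of_bool_conj)
  have 5: "A5 ''vio'' v = card (defects ?H R)" if "v < n" for v
  proof -
    have "(\<Sum>j<n. A4 ''bad'' j) = (\<Sum>j<n. of_bool (j \<in> defects ?H R))" by (simp add: storesD[OF 4])
    also have "\<dots> = card {j. j < n \<and> j \<in> defects ?H R}" by (rule sum_of_bool_card)
    also have "{j. j < n \<and> j \<in> defects ?H R} = defects ?H R" using HV unfolding defects_def by auto
    finally show ?thesis unfolding A5_def update_ops_def by (simp add: sum_op_val[OF that])
  qed
  have 6: "A6 ''cr'' v = cost adj ?H R" if "v < n" for v
  proof -
    have "(\<Sum>j<n. A5 ''comp'' j * (A5 ''nr'' j * A5 ''nn'' j)) = cost adj ?H R"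
      unfolding cost_sum[OF HV, symmetric] by (rule sum.cong) (simp_all add: keep storesD[OF H] storesD[OF 2] 3)
    then show ?thesis unfolding A6_def update_ops_def by (simp add: sum_op_val[OF that])
  qed
  have 7: "stores (A7 ''nc'') (- W)"
    unfolding A7_def update_ops_def by (simp, rule map_op_stores) (simp add: keep storesD[OF cur])
  have 8: "A8 ''cn'' v = card {u. adj v u \<and> u \<notin> W}" if "v < n" for v
    unfolding A8_def update_ops_def using count_op_val[OF i(2) 7 that, of g "''cn''" vT] by simp
  have 9: "A9 ''cc'' v = cost adj ?H W" if "v < n" for v
  proof -
    have "(\<Sum>j<n. A8 ''comp'' j * (A8 ''nc'' j * A8 ''cn'' j)) = cost adj ?H W"
      unfolding cost_sum[OF HV, symmetric] by (rule sum.cong) (simp_all add: keep storesD[OF H] storesD[OF 7] 8)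
    then show ?thesis unfolding A9_def update_ops_def by (simp add: sum_op_val[OF that])
  qed
  define better where "better \<longleftrightarrow> defects ?H R = {} \<and> cost adj ?H R < cost adj ?H W"
  have finb: "finite (defects ?H R)" by (rule finite_subset[of _ "{..<n}"]) (use HV in \<open>auto simp: defects_def\<close>)
  have 10: "A10 ''up'' v = of_bool better" if "v < n" for v
    unfolding A10_def update_ops_def
    by (simp add: map_op_val[OF that] keep 5[OF that] 6[OF that] 9[OF that] better_def finb card_gt_0_iff)
  define W' where "W' = (if better then ?H \<inter> R \<union> (W - ?H) else W)"
  have 11: "stores (A11 ''nx'') W'"
    unfolding A11_def update_ops_def
    by (simp, rule map_op_stores) (auto simp: keep 10 storesD[OF H] storesD[OF R] storesD[OF cur] W'_def)
  have 12: "stores (A12 ''cur'') W'"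
    unfolding A12_def update_ops_def by (simp, rule map_op_stores) (simp add: storesD[OF 11])
  show thesis
  proof (rule that)
    show "stores (run_ops n g update_ops A ''cur'') W'" unfolding fin by (rule 12)
    show "white_set_on adj {..<n} W'" unfolding W'_def using W white_set_glue[OF g W, of R] by (simp add: better_def)
    have H': "cost adj ?H W' = cost adj ?H R" if better
      by (rule cost_cong[OF g]) (use that in \<open>auto simp: W'_def\<close>)
    show "cost adj (component_of adj h) W' \<le> cost adj (component_of adj h) W" if h: "h < n" for h
    proof (cases "better \<and> component_of adj h = ?H")
      case True
      then show ?thesis using H' unfolding better_def by simp
    next
      case False
      have "cost adj (component_of adj h) W' = cost adj (component_of adj h) W"
      proof (rule cost_cong[OF h])
        fix v assume v: "v \<in> component_of adj h"
        show "v \<in> W' \<longleftrightarrow> v \<in> W"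
        proof (cases better)
          case True
          then have "v \<notin> ?H"
            using False components_eq[OF comp_of_component[OF h] comp_of_component[OF g] v] by blast
          then show ?thesis unfolding W'_def by simp
        qed (simp add: W'_def)
      qed
      then show ?thesis by simp
    qed
    show "cost adj ?H W' \<le> cost adj ?H R" if "white_set_on adj ?H R"
      using H' no_defects[OF that] unfolding better_def W'_def by (cases "cost adj ?H R < cost adj ?H W") auto
  qed
qed

definition state_ok :: "nat \<Rightarrow> (name \<Rightarrow> nat \<Rightarrow> nat) \<Rightarrow> nat set \<Rightarrow> bool" where
  "state_ok g A W \<longleftrightarrow> stores_graph A \<and> stores (A ''comp'') (component_of adj g) \<and> stores (A ''cur'') W \<and> white_set_on adj {..<n} W"

definition no_worse :: "nat set \<Rightarrow> nat set \<Rightarrow> bool" where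
  "no_worse W' W \<longleftrightarrow> (\<forall>h<n. cost adj (component_of adj h) W' \<le> cost adj (component_of adj h) W)"

definition beats :: "nat \<Rightarrow> nat set \<Rightarrow> nat set \<Rightarrow> bool" where
  "beats g W R \<longleftrightarrow> (white_set_on adj (component_of adj g) R \<longrightarrow> cost adj (component_of adj g) W \<le> cost adj (component_of adj g) R)"

lemma no_worse_trans: "no_worse A B \<Longrightarrow> no_worse B C \<Longrightarrow> no_worse A C"
  unfolding no_worse_def by (meson le_trans)
lemma no_worse_refl: "no_worse A A" unfolding no_worse_def by simp
lemma beats_mono: "no_worse W' W \<Longrightarrow> g < n \<Longrightarrow> beats g W R \<Longrightarrow> beats g W' R"
  unfolding no_worse_def beats_def by (meson le_trans)

lemma stores_graph_run_ops: "stores_graph A \<Longrightarrow> ''adj'' \<notin> op_name ` set cs \<Longrightarrow> stores_graph (run_ops n g cs A)"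
  unfolding stores_graph_def by (simp add: run_ops_other)

lemma state_ok_ops:
  assumes "state_ok g A W" "\<forall>X\<in>op_name ` set cs. X \<noteq> ''adj'' \<and> X \<noteq> ''comp'' \<and> X \<noteq> ''cur''"
  shows "state_ok g (run_ops n g cs A) W"
proof -
  have "''adj'' \<notin> op_name ` set cs" "''comp'' \<notin> op_name ` set cs" "''cur'' \<notin> op_name ` set cs"
    using assms(2) by blast+
  then show ?thesis
    using assms(1) stores_graph_run_ops[of A cs g] unfolding state_ok_def by (simp add: run_ops_other)
qed

lemma update_names: "''adj'' \<notin> op_name ` set update_ops" "''comp'' \<notin> op_name ` set update_ops"
  "X \<in> set root_names \<Longrightarrow> X \<notin> op_name ` set update_ops"
  unfolding update_ops_def root_names_def by auto

lemma level_names: "op_name ` set level_ops = {''l1'', ''l2'', ''l3'', ''m'', ''u''}"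
  unfolding level_ops_def by simp

lemma candidate_block:
  assumes s: "state_ok g A W" and g: "g < n"
    and cs: "\<forall>X\<in>op_name ` set cs. X \<noteq> ''adj'' \<and> X \<noteq> ''comp'' \<and> X \<noteq> ''cur''"
    and R: "stores (run_ops n g cs A ''r'') R"
  shows "\<exists>W'. state_ok g (run_ops n g (cs @ update_ops) A) W' \<and> no_worse W' W \<and> beats g W' R"
proof -
  let ?A = "run_ops n g cs A"
  have s': "state_ok g ?A W" by (rule state_ok_ops[OF s cs])
  then have *: "stores_graph ?A" "stores (?A ''comp'') (component_of adj g)" "stores (?A ''cur'') W" "white_set_on adj {..<n} W"
    unfolding state_ok_def by auto
  show ?thesis
  proof (rule update_ops_sem[OF *(1) g *(2) R *(3,4)])
    fix W' assume W': "stores (run_ops n g update_ops ?A ''cur'') W'" "white_set_on adj {..<n} W'"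
      "\<And>h. h < n \<Longrightarrow> cost adj (component_of adj h) W' \<le> cost adj (component_of adj h) W"
      "white_set_on adj (component_of adj g) R \<Longrightarrow> cost adj (component_of adj g) W' \<le> cost adj (component_of adj g) R"
    have "state_ok g (run_ops n g update_ops ?A) W'"
      unfolding state_ok_def using W' * stores_graph_run_ops[OF *(1) update_names(1)] run_ops_other[OF update_names(2), of n g ?A] by simp
    then show ?thesis using W' unfolding run_ops_append no_worse_def beats_def by blast
  qed
qed

lemma around_block_names: "op_name ` set around_block_ops = {''l1'', ''l2'', ''l3'', ''m'', ''u'', ''f'', ''e'', ''s'', ''el'', ''key'', ''best'', ''pk'', ''r''}"
  unfolding around_block_ops_def around_block_tail_ops_def set_append image_Un level_names by auto

lemma around_core_names: "op_name ` set around_core_ops \<subseteq> {''l1'', ''l2'', ''l3'', ''m'', ''u'', ''d'', ''k1'', ''k2'', ''k4'', ''b0'', ''b1'', ''b2'', ''b3'', ''b4'', ''r''}"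
  unfolding around_core_ops_def around_core_tail_ops_def list.set image_insert set_append image_Un level_names by auto

lemma around_white_names: "op_name ` set around_white_ops \<subseteq> {''l1'', ''l2'', ''l3'', ''m'', ''u'', ''d'', ''r''}"
  unfolding around_white_ops_def list.set image_insert set_append image_Un level_names by auto

lemma unmatched_names: "op_name ` set (unmatched_ops X Y Z) = {''d'', ''l1'', ''l2'', ''l3'', ''m'', ''u'', Z}"
  unfolding unmatched_ops_def list.set image_insert set_append image_Un level_names by auto

lemma corner_names: "op_name ` set (corner_ops X Y Z) = {''x'', Y, Z}"
  unfolding corner_ops_def by auto

lemma constant_run_ops: "X \<notin> op_name ` set cs \<Longrightarrow> is_constant (A X) c \<Longrightarrow> is_constant (run_ops n g cs A X) c"
  by (simp add: run_ops_other)

lemma root_ops_sem: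
  assumes A: "stores_graph A" and g: "g < n" and H: "stores (A ''comp'') (component_of adj g)"
  defines "A' \<equiv> run_ops n g root_ops A"
  shows "\<forall>f\<in>roots adj g. \<exists>X\<in>set root_names. is_constant (A' X) f"
    "\<forall>X\<in>set root_names. \<exists>f. is_constant (A' X) f"
proof -
  define u where "u = largest (component_of adj g)"
  define v where "v = some_nbr adj u"
  define A1 where "A1 = run_op n g (max_op ''q1'' (Times (Load ''comp'' vJ) vJ)) A"
  define A2 where "A2 = run_op n g (max_op ''q2'' (Times (adjE (Load ''q1'' vI) vJ) vJ)) A1"
  define A3 where "A3 = run_ops n g (corner_ops ''q1'' ''q3'' ''q4'') A2"
  define A4 where "A4 = run_ops n g (corner_ops ''q2'' ''q5'' ''q6'') A3"
  define A5 where "A5 = run_ops n g (unmatched_ops ''q1'' ''q3'' ''z1'') A4"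
  define A6 where "A6 = run_ops n g (unmatched_ops ''q1'' ''q4'' ''z2'') A5"
  define A7 where "A7 = run_ops n g (unmatched_ops ''q2'' ''q5'' ''z3'') A6"
  define A8 where "A8 = run_ops n g (unmatched_ops ''q2'' ''q6'' ''z4'') A7"
  have A': "A' = A8"
    unfolding A'_def root_ops_def A1_def A2_def A3_def A4_def A5_def A6_def A7_def A8_def
    by (simp add: run_ops_append run_ops_Cons)
  have i1: "stores_graph A1" "stores_graph A2" using A unfolding A1_def A2_def by (simp_all add: stores_graph_run_op)
  have i3: "stores_graph A3" unfolding A3_def by (rule stores_graph_run_ops[OF i1(2)]) (simp add: corner_names)
  have i4: "stores_graph A4" unfolding A4_def by (rule stores_graph_run_ops[OF i3]) (simp add: corner_names)
  have i5: "stores_graph A5" unfolding A5_def by (rule stores_graph_run_ops[OF i4]) (simp add: unmatched_names)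
  have i6: "stores_graph A6" unfolding A6_def by (rule stores_graph_run_ops[OF i5]) (simp add: unmatched_names)
  have i7: "stores_graph A7" unfolding A7_def by (rule stores_graph_run_ops[OF i6]) (simp add: unmatched_names)
  have un: "u < n" unfolding u_def by (rule largest_less[OF comp_of_sub[OF g] g])
  have vn: "v < n" unfolding v_def some_nbr_def by (rule largest_less[OF _ g]) (use adj_less in auto)
  have q1: "is_constant (A1 ''q1'') u"
    unfolding A1_def u_def by (rule max_op_largest[OF _ comp_of_sub[OF g]]) (simp add: storesD[OF H])
  have q2: "is_constant (A2 ''q2'') v"
    unfolding A2_def v_def some_nbr_def
    by (rule max_op_largest) (use adj_less un in \<open>auto simp: constantD[OF q1] graphD[OF i1(1)]\<close>)
  have q1': "is_constant (A2 ''q1'') u" unfolding A2_def using q1 by simp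
  have q34: "is_constant (A3 ''q3'') (triangle_left adj u)" "is_constant (A3 ''q4'') (triangle_right adj u)"
    unfolding A3_def by (rule corner_ops_constant[OF i1(2) g q1' un]; simp)+
  have q2': "is_constant (A3 ''q2'') v" unfolding A3_def by (rule constant_run_ops) (use q2 in \<open>simp_all add: corner_names\<close>)
  have q1'': "is_constant (A3 ''q1'') u" unfolding A3_def by (rule constant_run_ops) (use q1' in \<open>simp_all add: corner_names\<close>)
  have q56: "is_constant (A4 ''q5'') (triangle_left adj v)" "is_constant (A4 ''q6'') (triangle_right adj v)"
    unfolding A4_def by (rule corner_ops_constant[OF i3 g q2' vn]; simp)+
  have k4: "is_constant (A4 ''q1'') u" "is_constant (A4 ''q2'') v" "is_constant (A4 ''q3'') (triangle_left adj u)" "is_constant (A4 ''q4'') (triangle_right adj u)"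
    unfolding A4_def using q1'' q2' q34 by (simp_all add: constant_run_ops corner_names)
  have keep: "A5 X = A4 X" "A6 X = A4 X" "A7 X = A4 X" "A8 X = A4 X"
    if "X \<in> {''q1'', ''q2'', ''q3'', ''q4'', ''q5'', ''q6''}" for X
  proof -
    show 5: "A5 X = A4 X" unfolding A5_def by (rule run_ops_other) (use that in \<open>auto simp: unmatched_names\<close>)
    show 6: "A6 X = A4 X" unfolding 5[symmetric] A6_def by (rule run_ops_other) (use that in \<open>auto simp: unmatched_names\<close>)
    show 7: "A7 X = A4 X" unfolding 6[symmetric] A7_def by (rule run_ops_other) (use that in \<open>auto simp: unmatched_names\<close>)
    show "A8 X = A4 X" unfolding 7[symmetric] A8_def by (rule run_ops_other) (use that in \<open>auto simp: unmatched_names\<close>)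
  qed
  have z1: "is_constant (A5 ''z1'') (some_unmatched adj u (triangle_left adj u))"
    unfolding A5_def by (rule unmatched_ops_constant[OF i4 k4(1,3)])
  have z2: "is_constant (A6 ''z2'') (some_unmatched adj u (triangle_right adj u))"
    unfolding A6_def by (rule unmatched_ops_constant[OF i5]) (simp_all add: keep k4)
  have z3: "is_constant (A7 ''z3'') (some_unmatched adj v (triangle_left adj v))"
    unfolding A7_def by (rule unmatched_ops_constant[OF i6]) (simp_all add: keep k4 q56)
  have z4: "is_constant (A8 ''z4'') (some_unmatched adj v (triangle_right adj v))"
    unfolding A8_def by (rule unmatched_ops_constant[OF i7]) (simp_all add: keep k4 q56)
  have z: "is_constant (A8 ''z1'') (some_unmatched adj u (triangle_left adj u))" "is_constant (A8 ''z2'') (some_unmatched adj u (triangle_right adj u))"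
    "is_constant (A8 ''z3'') (some_unmatched adj v (triangle_left adj v))"
  proof -
    have 6: "is_constant (A6 ''z1'') (some_unmatched adj u (triangle_left adj u))"
      unfolding A6_def using z1 by (simp add: constant_run_ops unmatched_names)
    have 7: "is_constant (A7 ''z1'') (some_unmatched adj u (triangle_left adj u))" "is_constant (A7 ''z2'') (some_unmatched adj u (triangle_right adj u))"
      unfolding A7_def using 6 z2 by (simp_all add: constant_run_ops unmatched_names)
    show "is_constant (A8 ''z1'') (some_unmatched adj u (triangle_left adj u))" "is_constant (A8 ''z2'') (some_unmatched adj u (triangle_right adj u))"
      "is_constant (A8 ''z3'') (some_unmatched adj v (triangle_left adj v))"
      unfolding A8_def using 7 z3 by (simp_all add: constant_run_ops unmatched_names)
  qed
  have q: "is_constant (A8 ''q1'') u" "is_constant (A8 ''q2'') v" using keep k4 by simp_all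
  show "\<forall>f\<in>roots adj g. \<exists>X\<in>set root_names. is_constant (A' X) f"
    unfolding roots_def Let_def u_def[symmetric] v_def[symmetric] A' root_names_def using q z z4 by simp
  show "\<forall>X\<in>set root_names. \<exists>f. is_constant (A' X) f"
    unfolding A' root_names_def using q z z4 by auto
qed

lemma pair_blocks:
  assumes g: "g < n" and Fs: "set Fs \<subseteq> set root_names"
    and c: "\<And>X. X \<in> set Fs \<Longrightarrow> is_constant (A X) (val X)" and s: "state_ok g A W"
  shows "\<exists>W'. state_ok g (run_ops n g (concat (map (\<lambda>F. (pair_op (Load F vI) vG # around_block_ops) @ update_ops) Fs)) A) W' \<and>
    no_worse W' W \<and> (\<forall>X\<in>set Fs. beats g W' (around_block adj (degree_key adj n) {val X, g}))"
  using Fs c s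
proof (induction Fs arbitrary: A W)
  case Nil
  then show ?case using no_worse_refl by auto
next
  case (Cons F Fs)
  let ?cs = "pair_op (Load F vI) vG # around_block_ops"
  let ?A1 = "run_op n g (pair_op (Load F vI) vG) A"
  have "stores (?A1 ''d'') {val F, g}"
    by (rule pair_op_stores) (use constantD[OF Cons.prems(2)] in simp_all)
  moreover have "stores_graph ?A1" by (rule stores_graph_run_op) (use Cons.prems in \<open>auto simp: state_ok_def\<close>)
  ultimately have R: "stores (run_ops n g ?cs A ''r'') (around_block adj (degree_key adj n) {val F, g})"
    unfolding run_ops_Cons using around_block_ops_stores by blast
  have names: "op_name ` set ?cs = insert ''d'' (op_name ` set around_block_ops)" by simp
  have "\<exists>W1. state_ok g (run_ops n g (?cs @ update_ops) A) W1 \<and> no_worse W1 W \<and>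
      beats g W1 (around_block adj (degree_key adj n) {val F, g})"
    by (rule candidate_block[OF Cons.prems(3) g _ R]) (unfold names around_block_names, auto)
  then obtain W1 where W1: "state_ok g (run_ops n g (?cs @ update_ops) A) W1" "no_worse W1 W"
      "beats g W1 (around_block adj (degree_key adj n) {val F, g})" by blast
  have "is_constant (run_ops n g (?cs @ update_ops) A X) (val X)" if X: "X \<in> set Fs" for X
  proof (rule constant_run_ops)
    show "is_constant (A X) (val X)" using Cons.prems X by simp
  next
    have "X \<in> set root_names" using Cons.prems X by auto
    then show "X \<notin> op_name ` set (?cs @ update_ops)"
      unfolding set_append image_Un names around_block_names using update_names(3) by (auto simp: root_names_def)
  qed
  then have "\<exists>W2. state_ok g (run_ops n g (concat (map (\<lambda>F. (pair_op (Load F vI) vG # around_block_ops) @ update_ops) Fs))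
        (run_ops n g (?cs @ update_ops) A)) W2 \<and> no_worse W2 W1 \<and>
      (\<forall>X\<in>set Fs. beats g W2 (around_block adj (degree_key adj n) {val X, g}))"
    by (intro Cons.IH[OF _ _ W1(1)]) (use Cons.prems(1) in auto)
  then obtain W2 where W2: "state_ok g (run_ops n g (concat (map (\<lambda>F. (pair_op (Load F vI) vG # around_block_ops) @ update_ops) Fs))
        (run_ops n g (?cs @ update_ops) A)) W2" "no_worse W2 W1"
      "\<forall>X\<in>set Fs. beats g W2 (around_block adj (degree_key adj n) {val X, g})"
    by blast
  have "state_ok g (run_ops n g (concat (map (\<lambda>F. (pair_op (Load F vI) vG # around_block_ops) @ update_ops) (F # Fs))) A) W2"
    using W2(1) unfolding list.map concat.simps run_ops_append .
  moreover have "no_worse W2 W" by (rule no_worse_trans[OF W2(2) W1(2)])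
  moreover have "\<forall>X\<in>set (F # Fs). beats g W2 (around_block adj (degree_key adj n) {val X, g})"
    using W2(3) beats_mono[OF W2(2) g W1(3)] by simp
  ultimately show ?case by blast
qed

lemma body_ops_sem:
  assumes A: "stores_graph A" and g: "g < n" and cur: "stores (A ''cur'') W" and W: "white_set_on adj {..<n} W"
  shows "\<exists>W'. stores_graph (run_ops n g body_ops A) \<and> stores (run_ops n g body_ops A ''cur'') W' \<and> white_set_on adj {..<n} W' \<and>
    no_worse W' W \<and> (\<forall>R\<in>candidates adj n g. beats g W' R)"
proof -
  define A0 where "A0 = run_ops n g component_ops A"
  have names0: "op_name ` set component_ops = {''c0'', ''c1'', ''c2'', ''c3'', ''comp''}"
    unfolding component_ops_def by simp
  have "A0 ''cur'' = A ''cur''" unfolding A0_def by (rule run_ops_other) (unfold names0, simp)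
  moreover have "stores_graph A0" unfolding A0_def by (rule stores_graph_run_ops[OF A]) (unfold names0, simp)
  ultimately have s0: "state_ok g A0 W"
    unfolding state_ok_def using component_ops_stores[OF A g] cur W unfolding A0_def by simp
  have i: "stores_graph B" if "state_ok g B Z" for B Z using that unfolding state_ok_def by simp
  define A1 where "A1 = run_ops n g (around_core_ops @ update_ops) A0"
  have "\<exists>W1. state_ok g A1 W1 \<and> no_worse W1 W \<and> beats g W1 (around_core adj g)"
    unfolding A1_def by (rule candidate_block[OF s0 g _ around_core_ops_stores[OF i[OF s0] g]]) (use around_core_names in auto)
  then obtain W1 where 1: "state_ok g A1 W1" "no_worse W1 W" "beats g W1 (around_core adj g)" by blast
  define A2 where "A2 = run_ops n g (around_white_ops @ update_ops) A1"
  have "\<exists>W2. state_ok g A2 W2 \<and> no_worse W2 W1 \<and> beats g W2 (around_white adj g)"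
    unfolding A2_def by (rule candidate_block[OF 1(1) g _ around_white_ops_stores[OF i[OF 1(1)] g]]) (use around_white_names in auto)
  then obtain W2 where 2: "state_ok g A2 W2" "no_worse W2 W1" "beats g W2 (around_white adj g)" by blast
  define A3 where "A3 = run_ops n g ((ball_op # around_block_ops) @ update_ops) A2"
  let ?S = "around_block adj (degree_key adj n) (insert g {v. adj v g})"
  have R: "stores (run_ops n g (ball_op # around_block_ops) A2 ''r'') ?S"
    unfolding run_ops_Cons
    by (rule around_block_ops_stores) (use stores_graph_run_op[OF i[OF 2(1)], of ball_op] ball_op_stores[OF i[OF 2(1)] g] in simp_all)
  have names: "op_name ` set (ball_op # around_block_ops) = insert ''d'' (op_name ` set around_block_ops)" by simp
  have "\<exists>W3. state_ok g A3 W3 \<and> no_worse W3 W2 \<and> beats g W3 ?S"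
    unfolding A3_def by (rule candidate_block[OF 2(1) g _ R]) (unfold names around_block_names, auto)
  then obtain W3 where 3: "state_ok g A3 W3" "no_worse W3 W2" "beats g W3 ?S" by blast
  define A4 where "A4 = run_ops n g root_ops A3"
  have names4: "op_name ` set root_ops \<subseteq> {''q1'', ''q2'', ''q3'', ''q4'', ''q5'', ''q6'', ''x'', ''d'', ''l1'', ''l2'', ''l3'',
      ''m'', ''u'', ''z1'', ''z2'', ''z3'', ''z4''}"
    unfolding root_ops_def set_append image_Un corner_names unmatched_names by auto
  have s4: "state_ok g A4 W3" unfolding A4_def by (rule state_ok_ops[OF 3(1)]) (use names4 in auto)
  have H3: "stores (A3 ''comp'') (component_of adj g)" using 3(1) unfolding state_ok_def by simp
  note roots4 = root_ops_sem[OF i[OF 3(1)] g H3, folded A4_def]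
  obtain val where val: "\<And>X. X \<in> set root_names \<Longrightarrow> is_constant (A4 X) (val X)" using roots4(2) by metis
  define A5 where "A5 = run_ops n g (concat (map (\<lambda>F. (pair_op (Load F vI) vG # around_block_ops) @ update_ops) root_names)) A4"
  obtain W5 where 5: "state_ok g A5 W5" "no_worse W5 W3"
      "\<forall>X\<in>set root_names. beats g W5 (around_block adj (degree_key adj n) {val X, g})"
    using pair_blocks[OF g subset_refl val s4] unfolding A5_def by blast
  have fin: "run_ops n g body_ops A = A5"
    unfolding body_ops_def A5_def A4_def A3_def A2_def A1_def A0_def run_ops_append ..
  have "beats g W5 (around_block adj (degree_key adj n) {f, g})" if f: "f \<in> roots adj g" for f
  proof -
    obtain X where X: "X \<in> set root_names" "is_constant (A4 X) f"
      using bspec[OF roots4(1) f] by blast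
    have "val X = f" using constantD[OF val[OF X(1)] g] constantD[OF X(2) g] by simp
    then show ?thesis using bspec[OF 5(3) X(1)] by simp
  qed
  moreover have "beats g W5 (around_core adj g)" "beats g W5 (around_white adj g)" "beats g W5 ?S"
    using beats_mono[OF 5(2) g beats_mono[OF 3(2) g beats_mono[OF 2(2) g 1(3)]]]
      beats_mono[OF 5(2) g beats_mono[OF 3(2) g 2(3)]] beats_mono[OF 5(2) g 3(3)] by simp_all
  ultimately have "\<forall>R\<in>candidates adj n g. beats g W5 R" unfolding candidates_def by blast
  moreover have "no_worse W5 W"
    using no_worse_trans[OF 5(2) no_worse_trans[OF 3(2) no_worse_trans[OF 2(2) 1(2)]]] .
  ultimately show ?thesis using 5(1) unfolding fin state_ok_def by blast
qed

text \<open>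
  What a round has achieved is preserved by the later rounds, since no component ever gets more expensive.
\<close>
lemma loop_sem:
  assumes "stores_graph A" "stores (A ''cur'') {}" "k \<le> n"
  shows "\<exists>W. stores_graph (run_loop n body_ops k A) \<and> stores (run_loop n body_ops k A ''cur'') W \<and> white_set_on adj {..<n} W \<and>
    no_worse W {} \<and> (\<forall>g<k. \<forall>R\<in>candidates adj n g. beats g W R)"
  using assms(3)
proof (induction k)
  case 0
  have "white_set_on adj {..<n} {}" unfolding white_set_on_def by simp
  then show ?case using assms no_worse_refl unfolding run_loop_def by auto
next
  case (Suc k)
  then obtain W where W: "stores_graph (run_loop n body_ops k A)" "stores (run_loop n body_ops k A ''cur'') W" "white_set_on adj {..<n} W"
      "no_worse W {}" "\<forall>g<k. \<forall>R\<in>candidates adj n g. beats g W R" by auto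
  have step: "run_loop n body_ops (Suc k) A = run_ops n k body_ops (run_loop n body_ops k A)"
    unfolding run_loop_def by simp
  obtain W' where W': "stores_graph (run_loop n body_ops (Suc k) A)" "stores (run_loop n body_ops (Suc k) A ''cur'') W'" "white_set_on adj {..<n} W'"
      "no_worse W' W" "\<forall>R\<in>candidates adj n k. beats k W' R"
    using body_ops_sem[OF W(1) _ W(2,3), of k] Suc.prems unfolding step by auto
  have "beats g W' R" if "g < Suc k" "R \<in> candidates adj n g" for g R
  proof (cases "g = k")
    case False
    then show ?thesis using that W(5) beats_mono[OF W'(4), of g R] Suc.prems by simp
  qed (use W'(5) that in simp)
  then show ?case using W' W(4) no_worse_trans by blast
qed

lemma out_sem:
  assumes "stores_graph A" "stores (A ''cur'') W" "k \<le> n"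
  shows "stores_graph (run_loop n [out_op] k A) \<and> stores (run_loop n [out_op] k A ''cur'') W \<and>
    (\<forall>g<k. \<forall>i<n. run_loop n [out_op] k A ''out'' (g * n + i) = of_bool (adj g i \<and> g \<notin> W \<and> i \<notin> W))"
  using assms(3)
proof (induction k)
  case 0 then show ?case using assms unfolding run_loop_def by simp
next
  case (Suc k)
  let ?B = "run_loop n [out_op] k A"
  have B: "stores_graph ?B" "stores (?B ''cur'') W"
    "\<And>g i. g < k \<Longrightarrow> i < n \<Longrightarrow> ?B ''out'' (g * n + i) = of_bool (adj g i \<and> g \<notin> W \<and> i \<notin> W)"
    using Suc by auto
  have step: "run_loop n [out_op] (Suc k) A = run_op n k out_op ?B"
    unfolding run_loop_def by (simp add: run_ops_Cons)
  have name: "op_name out_op = ''out''" unfolding out_op_def by simp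
  have row: "run_op n k out_op ?B ''out'' (g * n + i) = of_bool (adj g i \<and> g \<notin> W \<and> i \<notin> W)"
    if "g < Suc k" "i < n" for g i
  proof (cases "g = k")
    case True
    then show ?thesis using that Suc.prems B
      unfolding run_op_def out_op_def by (simp add: reduction_def graphD storesD)
  next
    case False
    then have "g * n + n \<le> k * n" using that mult_le_mono1[of "Suc g" k n] by simp
    then have "g * n + i < k * n" using that by simp
    then show ?thesis using that False B(3)[of g i] unfolding run_op_def out_op_def by simp
  qed
  show ?case unfolding step using B row stores_graph_run_op[OF B(1), of out_op k] by (simp add: name)
qed

end

definition perfect_edge_domination_program :: com where
  "perfect_edge_domination_program =
     Seq (count_loop ''g'' (compile_ops body_ops)) (count_loop ''g'' (compile_ops [out_op]))"

lemma program_correct: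
  assumes "simple_graph G" "card (verts G) = n" "verts G = {..<n}" "P6_free G"
  shows "\<exists>t s. exec ((n + 2) ^ 7) perfect_edge_domination_program (input_state G) t s \<and>
    t \<le> (ops_cost body_ops + ops_cost [out_op] + 21) * (n + 1) ^ 3 \<and>
    (\<exists>P. minimum_perfect_edge_dominating G P \<and> outputs_edge_set n s P)"
proof -
  interpret p6free_input G n by unfold_locales (use assms in auto)
  define A where "A = arrays (input_state G)"
  have idx: "i * n + j < n * n" if "i < n" "j < n" for i j
  proof -
    have "i * n + j < (i + 1) * n" using that by simp
    also have "\<dots> \<le> n * n" by (rule mult_le_mono1) (use that in simp)
    finally show ?thesis .
  qed
  have stores_graph: "stores_graph A" unfolding stores_graph_def A_def input_state_def adj_matrix_def graph_adj_def
    using assms(2) idx by auto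
  have cur: "stores (A ''cur'') {}" unfolding stores_def A_def input_state_def by simp
  have bnd: "bounded_by n entry_degree A"
    unfolding bounded_by_def A_def input_state_def adj_matrix_def by (simp add: entry_degree_def)
  have n0: "scalars (input_state G) ''n'' = n" unfolding input_state_def using assms(2) by simp
  obtain t1 s1 where 1: "exec ((n + 2) ^ 7) (count_loop ''g'' (compile_ops body_ops)) (input_state G) t1 s1"
      "t1 \<le> (ops_cost body_ops + 10) * (n + 1) ^ 3" "arrays s1 = run_loop n body_ops n A"
      "scalars s1 ''n'' = n" "bounded_by n entry_degree (run_loop n body_ops n A)"
    using compile_loop_exec[OF body_ops_ok bnd A_def[symmetric] n0] by auto
  obtain t2 s2 where 2: "exec ((n + 2) ^ 7) (count_loop ''g'' (compile_ops [out_op])) s1 t2 s2"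
      "t2 \<le> (ops_cost [out_op] + 10) * (n + 1) ^ 3" "arrays s2 = run_loop n [out_op] n (run_loop n body_ops n A)"
    using compile_loop_exec[OF out_op_ok 1(5,3,4)] by auto
  obtain W where W: "stores_graph (run_loop n body_ops n A)" "stores (run_loop n body_ops n A ''cur'') W" "white_set_on adj {..<n} W"
      "no_worse W {}" "\<forall>g<n. \<forall>R\<in>candidates adj n g. beats g W R"
    using loop_sem[OF stores_graph cur order_refl] by blast
  have min: "minimum_perfect_edge_dominating G (uncovered_edges G W)"
    by (rule minimum_if_best[OF W(3)]) (use W(4,5) in \<open>auto simp: no_worse_def beats_def\<close>)
  have out: "outputs_edge_set n s2 (uncovered_edges G W)"
    unfolding outputs_edge_set_def
  proof (intro allI impI)
    fix k assume k: "k < n * n"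
    then have n: "0 < n" by (cases n) auto
    define g i where "g = k div n" and "i = k mod n"
    have gi: "g < n" "i < n" "k = g * n + i"
      unfolding g_def i_def using k n by (auto simp: less_mult_imp_div_less)
    have "arrays s2 ''out'' k = of_bool (adj g i \<and> g \<notin> W \<and> i \<notin> W)"
      unfolding 2(3) gi(3) using out_sem[OF W(1,2) order_refl] gi by blast
    moreover have "adj_matrix n (uncovered_edges G W) k = of_bool (adj g i \<and> g \<notin> W \<and> i \<notin> W)"
      unfolding adj_matrix_def uncovered_edges_def graph_adj_def using k g_def i_def by auto
    ultimately show "arrays s2 ''out'' k = adj_matrix n (uncovered_edges G W) k" by simp
  qed
  have "exec ((n + 2) ^ 7) perfect_edge_domination_program (input_state G) (t1 + t2 + 1) s2"
    unfolding perfect_edge_domination_program_def by (rule exec_Seq[OF 1(1) 2(1)])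
  moreover have "t1 + t2 + 1 \<le> (ops_cost body_ops + ops_cost [out_op] + 21) * (n + 1) ^ 3"
  proof -
    have "1 \<le> (n + 1) ^ 3" by simp
    then have "t1 + t2 + 1 \<le> (ops_cost body_ops + 10) * (n + 1) ^ 3 + (ops_cost [out_op] + 10) * (n + 1) ^ 3 + (n + 1) ^ 3"
      using 1(2) 2(2) by linarith
    also have "\<dots> = (ops_cost body_ops + ops_cost [out_op] + 21) * (n + 1) ^ 3" by (simp add: distrib_right)
    finally show ?thesis .
  qed
  ultimately show ?thesis using min out by blast
qed

theorem theorem4p1:
  "\<exists>(algo :: com) (w :: nat) (T :: nat \<Rightarrow> nat).
     (\<lambda>n. real (T n)) \<in> O(\<lambda>n. real n ^ 3) \<and>
     (\<forall>(G :: nat graph) n.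
        simple_graph G \<and> card (verts G) = n \<and> verts G = {..<n} \<and> P6_free G \<longrightarrow>
        (\<exists>t s. exec ((n + 2) ^ w) algo (input_state G) t s \<and> t \<le> T n \<and>
           (\<exists>P. minimum_perfect_edge_dominating G P \<and> outputs_edge_set n s P)))"
proof -
  define C where "C = ops_cost body_ops + ops_cost [out_op] + 21"
  have "(\<lambda>n. real (C * (n + 1) ^ 3)) \<in> O(\<lambda>n. real n ^ 3)"
  proof (rule bigoI[where c = "8 * real C"])
    show "\<forall>\<^sub>F n in sequentially. norm (real (C * (n + 1) ^ 3)) \<le> 8 * real C * norm (real n ^ 3)"
    proof (rule eventually_sequentiallyI[of 1])
      fix n :: nat assume n: "1 \<le> n"
      \<comment> \<open>\<open>n + 1 \<le> 2 * n\<close> explains the factor eight.\<close>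
      have "(real n + 1) ^ 3 \<le> (2 * real n) ^ 3" by (rule power_mono) (use n in auto)
      then have "real C * (real n + 1) ^ 3 \<le> real C * (8 * real n ^ 3)"
        by (intro mult_left_mono) (auto simp: power_mult_distrib)
      then show "norm (real (C * (n + 1) ^ 3)) \<le> 8 * real C * norm (real n ^ 3)" by (simp add: ac_simps)
    qed
  qed
  moreover have "\<exists>t s. exec ((n + 2) ^ 7) perfect_edge_domination_program (input_state G) t s \<and>
      t \<le> C * (n + 1) ^ 3 \<and> (\<exists>P. minimum_perfect_edge_dominating G P \<and> outputs_edge_set n s P)"
    if "simple_graph G \<and> card (verts G) = n \<and> verts G = {..<n} \<and> P6_free G" for G n
    using program_correct[of G n] that unfolding C_def by blast
  ultimately show ?thesis
    by (intro exI[of _ perfect_edge_domination_program] exI[of _ 7] exI[of _ "\<lambda>n. C * (n + 1) ^ 3"]) blast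
qed

end
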